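(* Let $p\in\{2,\infty\}$ and let $H\in H^p(\mathbb B^d_{\mathbb N})$ be non-zero. Then $H$ factors as $H=B\cdot S\cdot F$ with $B,S\in H^\infty(\mathbb B^d_{\mathbb N})$ and $F\in H^p(\mathbb B^d_{\mathbb N})$, where $B$ is an NC Blaschke inner with $\mathrm{Sing}(B)=\mathrm{Sing}(H)$, $S$ is an NC singular inner, and $F$ is an NC outer function. The factors are unique up to scalars of unit modulus: if $H=B'\cdot S'\cdot F'$ is another factorization of this kind, then each of $B',S',F'$ is a unimodular constant multiple of $B,S,F$ respectively.
   Context: Fix the number of variables $d\in\mathbb N\cup\{\infty\}$. $\mathbb F^d$ is the free monoid of words in the letters $1,\dots,d$; for $\alpha=i_1\cdots i_k$ put $|\alpha|=k$, $Z^\alpha=Z_{i_1}\cdots Z_{i_k}$. Put $\mathbb C^\infty:=\ell^2(\mathbb N)$ and $\mathbb C^{\infty\times\infty}:=\mathcal L(\ell^2(\mathbb N))$. For $n\in\mathbb N\cup\{\infty\}$, $\mathbb B^d_n$ is the set of $d$-tuples $Z=(Z_1,\dots,Z_d)$ of elements of $\mathbb C^{n\times n}$ which are strict row contractions (the row operator $Z$ from $\mathbb C^n\otimes\mathbb C^d$ to $\mathbb C^n$ has norm $<1$). $\mathbb B^d_{\mathbb N}=\bigsqcup_{n\in\mathbb N}\mathbb B^d_n$. $H^2(\mathbb B^d_{\mathbb N})$ (the full Fock space) is the Hilbert space of power series $f(Z)=\sum_{\alpha\in\mathbb F^d}\hat f_\alpha Z^\alpha$ with $\|f\|^2=\sum|\hat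 f_\alpha|^2<\infty$; the series (summed over homogeneous components) converges absolutely in operator norm at every $Z\in\mathbb B^d_n$, $n\in\mathbb N\cup\{\infty\}$. The operators $(R_kf)(Z)=f(Z)Z_k$ are the right free shifts. $H^\infty(\mathbb B^d_{\mathbb N})$ is the algebra of uniformly bounded functions on $\mathbb B^d_{\mathbb N}$ given by such power series; it equals the left multiplier algebra of $H^2(\mathbb B^d_{\mathbb N})$, and for $F\in H^\infty(\mathbb B^d_{\mathbb N})$, $F(L)$ denotes the bounded operator $f\mapsto Ff$ on $H^2(\mathbb B^d_{\mathbb N})$. Products are pointwise, and $H^\infty(\mathbb B^d_{\mathbb N})\subset H^2(\mathbb B^d_{\mathbb N})$. For $H\in H^p(\mathbb B^d_{\mathbb N})$ the left NC variety is $\mathrm{Sing}(H)=\bigsqcup_{n\in\mathbb N\cup\{\infty\}}\{(Z,y)\in\mathbb B^d_n\times\mathbb C^n: y^*H(Z)=0\}$ and the singularity space is $\mathcal S(H)=\{h\in H^2(\mathbb B^d_{\mathbb N}): y^*h(Z)=0\ \forall (Z,y)\in\mathrm{Sing}(H)\}$. $\Theta\in H^\infty(\mathbb B^d_{\mathbb N})$ is NC inner if $\Theta(L)$ is an isometry. An NC inner $\Theta$ is Blaschke if $\mathrm{Ran}(\Theta(L))=\mathcal S(\Theta)$, and singular if $\mathcal S(\Theta)=H^2(\mathbb B^d_{\mathbb N})$. $f\in H^2(\mathbb B^d_{\mathbb N})$ is NC outer if it is cyclic for the right free shifts; for $F\in H^\infty(\mathbb B^d_{\mathbb N})$ this is equivalent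 to $F(L)$ having dense range. *)

theory Defs
  imports "HOL-Analysis.Analysis" "HOL-Library.Extended_Nat"
begin

section \<open>Square-summable families as a Hilbert space\<close>

typedef 'a ell2 = "{x :: 'a \<Rightarrow> complex. (\<lambda>i. (cmod (x i))\<^sup>2) summable_on UNIV}"
  morphisms ell2_coeff Abs_ell2
proof
  show "(\<lambda>_. 0) \<in> {x :: 'a \<Rightarrow> complex. (\<lambda>i. (cmod (x i))\<^sup>2) summable_on UNIV}"
    by simp
qed

setup_lifting type_definition_ell2

lemma cmod_add_sq_le: "(cmod (a + b))\<^sup>2 \<le> 2 * (cmod a)\<^sup>2 + 2 * (cmod b)\<^sup>2"
proof -
  have "(cmod (a + b))\<^sup>2 \<le> (cmod a + cmod b)\<^sup>2"
    by (intro power_mono norm_triangle_ineq) auto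
  also have "\<dots> \<le> 2 * (cmod a)\<^sup>2 + 2 * (cmod b)\<^sup>2"
    using sum_squares_bound[of "cmod a" "cmod b"] by (simp add: power2_sum)
  finally show ?thesis .
qed

lemma cmod_mult_le_sq: "cmod a * cmod b \<le> (cmod a)\<^sup>2 + (cmod b)\<^sup>2"
proof -
  have "2 * (cmod a * cmod b) \<le> (cmod a)\<^sup>2 + (cmod b)\<^sup>2"
    using sum_squares_bound[of "cmod a" "cmod b"] by simp
  moreover have "0 \<le> cmod a * cmod b" by simp
  ultimately show ?thesis by linarith
qed

lemma ell2_summable_add:
  fixes x y :: "'a \<Rightarrow> complex"
  assumes "(\<lambda>i. (cmod (x i))\<^sup>2) summable_on UNIV" "(\<lambda>i. (cmod (y i))\<^sup>2) summable_on UNIV"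
  shows "(\<lambda>i. (cmod (x i + y i))\<^sup>2) summable_on UNIV"
proof (rule summable_on_comparison_test)
  show "(\<lambda>i. 2 * (cmod (x i))\<^sup>2 + 2 * (cmod (y i))\<^sup>2) summable_on UNIV"
    by (intro summable_on_add summable_on_cmult_right assms)
qed (auto simp: cmod_add_sq_le)

lemma ell2_summable_scale:
  fixes x :: "'a \<Rightarrow> complex"
  assumes "(\<lambda>i. (cmod (x i))\<^sup>2) summable_on UNIV"
  shows "(\<lambda>i. (cmod (c * x i))\<^sup>2) summable_on UNIV"
  unfolding norm_mult power_mult_distrib by (intro summable_on_cmult_right assms)

lemma ell2_summable_mult:
  fixes x y :: "'a \<Rightarrow> complex"
  assumes "(\<lambda>i. (cmod (x i))\<^sup>2) summable_on UNIV" "(\<lambda>i. (cmod (y i))\<^sup>2) summable_on UNIV"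
  shows "(\<lambda>i. cnj (x i) * y i) summable_on UNIV"
proof (rule abs_summable_summable)
  show "(\<lambda>i. norm (cnj (x i) * y i)) summable_on UNIV"
  proof (rule summable_on_comparison_test)
    show "(\<lambda>i. (cmod (x i))\<^sup>2 + (cmod (y i))\<^sup>2) summable_on UNIV"
      by (intro summable_on_add assms)
  qed (auto simp: norm_mult cmod_mult_le_sq)
qed

lift_definition scaleC :: "complex \<Rightarrow> 'a ell2 \<Rightarrow> 'a ell2"  (infixr "*\<^sub>C" 75)
  is "\<lambda>c x i. c * x i"
  by (rule ell2_summable_scale)

lift_definition cinner :: "'a ell2 \<Rightarrow> 'a ell2 \<Rightarrow> complex"
  is "\<lambda>x y. \<Sum>\<^sub>\<infinity>i. cnj (x i) * y i" .

instantiation ell2 :: (type) real_vector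
begin

lift_definition zero_ell2 :: "'a ell2" is "\<lambda>_. 0" by simp
lift_definition plus_ell2 :: "'a ell2 \<Rightarrow> 'a ell2 \<Rightarrow> 'a ell2" is "\<lambda>x y i. x i + y i"
  by (rule ell2_summable_add)
lift_definition uminus_ell2 :: "'a ell2 \<Rightarrow> 'a ell2" is "\<lambda>x i. - x i" by simp
lift_definition minus_ell2 :: "'a ell2 \<Rightarrow> 'a ell2 \<Rightarrow> 'a ell2" is "\<lambda>x y i. x i - y i"
  subgoal for x y using ell2_summable_add[of x "\<lambda>i. - y i"] by simp
  done
lift_definition scaleR_ell2 :: "real \<Rightarrow> 'a ell2 \<Rightarrow> 'a ell2" is "\<lambda>r x i. of_real r * x i"
  by (rule ell2_summable_scale)

instance
proof
  fix x y z :: "'a ell2" and a b :: real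
  show "x + y + z = x + (y + z)" by transfer (simp add: add.assoc)
  show "x + y = y + x" by transfer (simp add: add.commute)
  show "0 + x = x" by transfer simp
  show "- x + x = 0" by transfer simp
  show "x - y = x + - y" by transfer simp
  show "a *\<^sub>R (x + y) = a *\<^sub>R x + a *\<^sub>R y" by transfer (simp add: distrib_left)
  show "(a + b) *\<^sub>R x = a *\<^sub>R x + b *\<^sub>R x" by transfer (simp add: distrib_right)
  show "a *\<^sub>R b *\<^sub>R x = (a * b) *\<^sub>R x" by transfer (simp add: mult.assoc)
  show "1 *\<^sub>R x = x" by transfer simp
qed

end

instantiation ell2 :: (type) real_inner
begin

definition inner_ell2 :: "'a ell2 \<Rightarrow> 'a ell2 \<Rightarrow> real" where
  "inner_ell2 x y = Re (cinner x y)"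
definition norm_ell2 :: "'a ell2 \<Rightarrow> real" where
  "norm_ell2 x = sqrt (inner x x)"
definition dist_ell2 :: "'a ell2 \<Rightarrow> 'a ell2 \<Rightarrow> real" where
  "dist_ell2 x y = norm (x - y)"
definition sgn_ell2 :: "'a ell2 \<Rightarrow> 'a ell2" where
  "sgn_ell2 x = inverse (norm x) *\<^sub>R x"
definition uniformity_ell2 :: "('a ell2 \<times> 'a ell2) filter" where
  "uniformity_ell2 = (INF e\<in>{0<..}. principal {(x, y). dist x y < e})"
definition open_ell2 :: "'a ell2 set \<Rightarrow> bool" where
  "open_ell2 U \<longleftrightarrow> (\<forall>x\<in>U. \<forall>\<^sub>F (x', y) in uniformity. x' = x \<longrightarrow> y \<in> U)"

lemma inner_ell2_self: "inner x x = (\<Sum>\<^sub>\<infinity>i. (cmod (ell2_coeff x i))\<^sup>2)"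
  and summable_ell2: "(\<lambda>i. (cmod (ell2_coeff x i))\<^sup>2) summable_on UNIV"
proof -
  show s: "(\<lambda>i. (cmod (ell2_coeff x i))\<^sup>2) summable_on UNIV"
    using ell2_coeff[of x] by simp
  have "cinner x x = (\<Sum>\<^sub>\<infinity>i. of_real ((cmod (ell2_coeff x i))\<^sup>2))"
    unfolding cinner.rep_eq
    by (intro infsum_cong) (metis complex_norm_square mult.commute)
  also have "\<dots> = of_real (\<Sum>\<^sub>\<infinity>i. (cmod (ell2_coeff x i))\<^sup>2)"
    by (intro infsumI has_sum_of_real has_sum_infsum s)
  finally show "inner x x = (\<Sum>\<^sub>\<infinity>i. (cmod (ell2_coeff x i))\<^sup>2)"
    by (simp add: inner_ell2_def)
qed

instance
proof
  fix x y z :: "'a ell2" and r :: real and U :: "'a ell2 set"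
  show "dist x y = norm (x - y)" by (rule dist_ell2_def)
  show "sgn x = x /\<^sub>R norm x" by (rule sgn_ell2_def)
  show "uniformity = (INF e\<in>{0<..}. principal {(x, y::'a ell2). dist x y < e})"
    by (rule uniformity_ell2_def)
  show "open U \<longleftrightarrow> (\<forall>x\<in>U. \<forall>\<^sub>F (x', y) in uniformity. x' = x \<longrightarrow> y \<in> U)"
    by (rule open_ell2_def)
  show "norm x = sqrt (inner x x)" by (rule norm_ell2_def)
  have prod: "(\<lambda>i. cnj (ell2_coeff x i) * ell2_coeff y i) summable_on UNIV" for x y :: "'a ell2"
    by (intro ell2_summable_mult summable_ell2)
  have "cinner y x = cnj (cinner x y)"
    unfolding cinner.rep_eq infsum_cnj[symmetric] by (intro infsum_cong) simp
  then show "inner x y = inner y x"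
    by (simp add: inner_ell2_def)
  have "cinner (x + y) z = cinner x z + cinner y z"
    unfolding cinner.rep_eq
    by (subst infsum_add[symmetric, OF prod prod])
      (auto simp: plus_ell2.rep_eq algebra_simps intro!: infsum_cong)
  then show "inner (x + y) z = inner x z + inner y z"
    by (simp add: inner_ell2_def)
  have "cinner (r *\<^sub>R x) y = of_real r * cinner x y"
    unfolding cinner.rep_eq
    by (subst infsum_cmult_right'[symmetric])
      (auto simp: scaleR_ell2.rep_eq algebra_simps intro!: infsum_cong)
  then show "inner (r *\<^sub>R x) y = r * inner x y"
    by (simp add: inner_ell2_def)
  show "0 \<le> inner x x"
    unfolding inner_ell2_self by (intro infsum_nonneg) auto
  show "inner x x = 0 \<longleftrightarrow> x = 0"
  proof
    assume "inner x x = 0"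
    then have "(\<Sum>\<^sub>\<infinity>i. (cmod (ell2_coeff x i))\<^sup>2) \<le> 0"
      unfolding inner_ell2_self by simp
    then have "(cmod (ell2_coeff x i))\<^sup>2 = 0" for i
      by (rule nonneg_infsum_le_0D[OF _ summable_ell2]) auto
    then have "ell2_coeff x = ell2_coeff 0"
      by (auto simp: zero_ell2.rep_eq)
    then show "x = 0" by (simp add: ell2_coeff_inject)
  next
    assume "x = 0"
    then show "inner x x = 0" by (simp add: inner_ell2_self zero_ell2.rep_eq)
  qed
qed

end

lemma norm_ell2_sq: "(norm x)\<^sup>2 = (\<Sum>\<^sub>\<infinity>i. (cmod (ell2_coeff x i))\<^sup>2)"
  by (simp add: power2_norm_eq_inner inner_ell2_self)

lemma norm_scaleC: "norm (c *\<^sub>C x) = cmod c * norm x"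
proof (rule power2_eq_imp_eq)
  show "(norm (c *\<^sub>C x))\<^sup>2 = (cmod c * norm x)\<^sup>2"
    unfolding norm_ell2_sq power_mult_distrib scaleC.rep_eq norm_mult
    by (rule infsum_cmult_right')
qed auto

lemma bounded_linear_scaleC: "bounded_linear ((*\<^sub>C) c)"
proof (rule bounded_linear_intro)
  show "c *\<^sub>C (x + y) = c *\<^sub>C x + c *\<^sub>C y" for x y :: "'a ell2"
    by transfer (simp add: algebra_simps)
  show "c *\<^sub>C (r *\<^sub>R x) = r *\<^sub>R (c *\<^sub>C x)" for r and x :: "'a ell2"
    by transfer (simp add: algebra_simps)
  show "norm (c *\<^sub>C x) \<le> norm x * cmod c" for x :: "'a ell2"
    by (simp add: norm_scaleC)
qed

section \<open>The spaces \<open>\<complex>\<^sup>n\<close> and the matrix algebras \<open>\<complex>\<^sup>n\<^sup>\<times>\<^sup>n\<close>, \<open>1 \<le> n \<le> \<infinity>\<close>\<close>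

text \<open>All levels \<open>n\<close> are realised inside \<open>\<ell>\<^sup>2(\<nat>)\<close>: \<open>\<complex>\<^sup>n\<close> is the space of vectors supported
  on the indices below \<open>n\<close>, and \<open>\<complex>\<^sup>n\<^sup>\<times>\<^sup>n\<close> is the corner of operators on \<open>\<ell>\<^sup>2(\<nat>)\<close> that vanish on the
  orthogonal complement of \<open>\<complex>\<^sup>n\<close> and have range in \<open>\<complex>\<^sup>n\<close>. Its unit is the orthogonal
  projection \<open>unit_op n\<close>. For \<open>n = \<infinity>\<close> these are \<open>\<ell>\<^sup>2(\<nat>)\<close> and all bounded complex linear
  operators on it.\<close>

type_synonym operator = "nat ell2 \<Rightarrow>\<^sub>L nat ell2"

definition vec_space :: "enat \<Rightarrow> nat ell2 set" where
  "vec_space n = {x. \<forall>i. \<not> enat i < n \<longrightarrow> ell2_coeff x i = 0}"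

lift_definition truncate :: "enat \<Rightarrow> nat ell2 \<Rightarrow> nat ell2"
  is "\<lambda>n x i. if enat i < n then x i else 0"
  subgoal for n x
    by (rule summable_on_comparison_test[of "\<lambda>i. (cmod (x i))\<^sup>2"]) auto
  done

lemma bounded_linear_truncate: "bounded_linear (truncate n)"
proof (rule bounded_linear_intro)
  fix x y :: "nat ell2" and r :: real
  show "truncate n (x + y) = truncate n x + truncate n y"
    by transfer auto
  show "truncate n (r *\<^sub>R x) = r *\<^sub>R truncate n x"
    by transfer auto
  have "(norm (truncate n x))\<^sup>2 \<le> (norm x)\<^sup>2"
    unfolding norm_ell2_sq
    by (intro infsum_mono summable_ell2) (simp add: truncate.rep_eq)
  then have "norm (truncate n x) \<le> norm x"
    by (rule power2_le_imp_le) (rule norm_ge_zero)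
  then show "norm (truncate n x) \<le> norm x * 1"
    by simp
qed

definition unit_op :: "enat \<Rightarrow> operator" where
  "unit_op n = Blinfun (truncate n)"

lemma unit_op_apply [simp]: "blinfun_apply (unit_op n) x = truncate n x"
  by (simp add: unit_op_def bounded_linear_Blinfun_apply bounded_linear_truncate)

definition scaleC_op :: "complex \<Rightarrow> operator \<Rightarrow> operator"  (infixr "*\<^sub>O" 75) where
  "c *\<^sub>O T = Blinfun (\<lambda>x. c *\<^sub>C blinfun_apply T x)"

lemma scaleC_op_apply [simp]: "blinfun_apply (c *\<^sub>O T) x = c *\<^sub>C blinfun_apply T x"
  by (simp add: scaleC_op_def bounded_linear_Blinfun_apply
      bounded_linear_compose[OF bounded_linear_scaleC blinfun.bounded_linear_right])

definition mat_space :: "enat \<Rightarrow> operator set" where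
  "mat_space n = {T. (\<forall>c x. blinfun_apply T (c *\<^sub>C x) = c *\<^sub>C blinfun_apply T x) \<and>
     unit_op n o\<^sub>L T o\<^sub>L unit_op n = T}"

section \<open>NC functions on the row ball\<close>

text \<open>The \<open>d\<close> letters are the elements of a countable type \<open>'d\<close>, so that
  \<open>d = CARD('d) \<in> {1, 2, \<dots>}\<close> for finite \<open>'d\<close> and \<open>d = \<infinity>\<close> otherwise. A vector of \<open>\<complex>\<^sup>n \<otimes> \<complex>\<^sup>d\<close> is a square-summable
  family \<open>x\<close> of vectors \<open>x k \<in> \<complex>\<^sup>n\<close>, and the row operator maps it to the sum of the
  \<open>Z k (x k)\<close>.\<close>

definition row_ball :: "enat \<Rightarrow> ('d::countable \<Rightarrow> operator) set" where
  "row_ball n = {Z. (\<forall>k. Z k \<in> mat_space n) \<and>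
     (\<exists>r<1. \<forall>x. (\<forall>k. x k \<in> vec_space n) \<and> (\<lambda>k. (norm (x k))\<^sup>2) summable_on UNIV \<longrightarrow>
        (\<lambda>k. Z k (x k)) summable_on UNIV \<and>
        norm (\<Sum>\<^sub>\<infinity>k. Z k (x k)) \<le> r * sqrt (\<Sum>\<^sub>\<infinity>k. (norm (x k))\<^sup>2))}"

fun word_op :: "enat \<Rightarrow> ('d \<Rightarrow> operator) \<Rightarrow> 'd list \<Rightarrow> operator" where
  "word_op n Z [] = unit_op n"
| "word_op n Z (k # w) = Z k o\<^sub>L word_op n Z w"

text \<open>The elements of \<open>H\<^sup>2\<close> are represented by their square-summable coefficient families,
  indexed by words; both sums defining the value at \<open>Z\<close> converge in operator norm.\<close>

type_synonym 'd fock = "'d list ell2"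

definition nc_eval :: "enat \<Rightarrow> 'd::countable fock \<Rightarrow> ('d \<Rightarrow> operator) \<Rightarrow> operator" where
  "nc_eval n f Z = (\<Sum>m. \<Sum>\<^sub>\<infinity>w\<in>{w. length w = m}. ell2_coeff f w *\<^sub>O word_op n Z w)"

definition H_inf :: "'d::countable fock set" where
  "H_inf = {f. \<exists>M. \<forall>n::nat. 0 < n \<longrightarrow> (\<forall>Z\<in>row_ball (enat n). norm (nc_eval (enat n) f Z) \<le> M)}"

text \<open>Only used for \<open>p = 2\<close> and \<open>p = \<infinity>\<close>.\<close>

definition H_space :: "enat \<Rightarrow> 'd::countable fock set" where
  "H_space p = (if p = \<infinity> then H_inf else UNIV)"

text \<open>\<open>represents g \<phi>\<close>: the power series \<open>g\<close> has values \<open>\<phi>\<close> on the row ball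
  over all finite levels. This determines \<open>g\<close>.\<close>

definition represents :: "'d::countable fock \<Rightarrow> (enat \<Rightarrow> ('d \<Rightarrow> operator) \<Rightarrow> operator) \<Rightarrow> bool" where
  "represents g \<phi> \<longleftrightarrow>
     (\<forall>n::nat. 0 < n \<longrightarrow> (\<forall>Z\<in>row_ball (enat n). nc_eval (enat n) g Z = \<phi> (enat n) Z))"

definition right_shift :: "'d::countable \<Rightarrow> 'd fock \<Rightarrow> 'd fock" where
  "right_shift k f = (THE g. represents g (\<lambda>n Z. nc_eval n f Z o\<^sub>L Z k))"

text \<open>The operator \<open>F(L)\<close> of left multiplication, for \<open>F \<in> H\<^sup>\<infinity>\<close>.\<close>

definition left_mult :: "'d::countable fock \<Rightarrow> 'd fock \<Rightarrow> 'd fock" where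
  "left_mult F f = (THE g. represents g (\<lambda>n Z. nc_eval n F Z o\<^sub>L nc_eval n f Z))"

section \<open>Singularity loci, inner and outer functions\<close>

text \<open>\<open>left_null n y T\<close> says \<open>y\<^sup>* T = 0\<close> for \<open>T \<in> \<complex>\<^sup>n\<^sup>\<times>\<^sup>n\<close>.\<close>

definition left_null :: "enat \<Rightarrow> nat ell2 \<Rightarrow> operator \<Rightarrow> bool" where
  "left_null n y T \<longleftrightarrow> (\<forall>x\<in>vec_space n. cinner y (T x) = 0)"

definition Sing :: "'d::countable fock \<Rightarrow> (enat \<times> ('d \<Rightarrow> operator) \<times> nat ell2) set" where
  "Sing H = {(n, Z, y). 0 < n \<and> Z \<in> row_ball n \<and> y \<in> vec_space n \<and> left_null n y (nc_eval n H Z)}"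

definition sing_space :: "'d::countable fock \<Rightarrow> 'd fock set" where
  "sing_space H = {h. \<forall>(n, Z, y)\<in>Sing H. left_null n y (nc_eval n h Z)}"

definition nc_inner :: "'d::countable fock \<Rightarrow> bool" where
  "nc_inner \<Theta> \<longleftrightarrow> \<Theta> \<in> H_inf \<and> (\<forall>f. norm (left_mult \<Theta> f) = norm f)"

definition nc_blaschke :: "'d::countable fock \<Rightarrow> bool" where
  "nc_blaschke \<Theta> \<longleftrightarrow> nc_inner \<Theta> \<and> range (left_mult \<Theta>) = sing_space \<Theta>"

definition nc_singular_inner :: "'d::countable fock \<Rightarrow> bool" where
  "nc_singular_inner \<Theta> \<longleftrightarrow> nc_inner \<Theta> \<and> sing_space \<Theta> = UNIV"

text \<open>Cyclicity for the right shifts. The library's \<open>span\<close> is the real span; taking it of all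
  complex multiples gives the complex span.\<close>

definition nc_outer :: "'d::countable fock \<Rightarrow> bool" where
  "nc_outer f \<longleftrightarrow> closure (span {c *\<^sub>C fold right_shift w f | c w. True}) = UNIV"

definition BSF_factorization ::
    "enat \<Rightarrow> 'd::countable fock \<Rightarrow> 'd fock \<Rightarrow> 'd fock \<Rightarrow> 'd fock \<Rightarrow> bool" where
  "BSF_factorization p H B S F \<longleftrightarrow>
     B \<in> H_inf \<and> S \<in> H_inf \<and> F \<in> H_space p \<and>
     represents H (\<lambda>n Z. nc_eval n B Z o\<^sub>L nc_eval n S Z o\<^sub>L nc_eval n F Z) \<and>
     nc_blaschke B \<and> Sing B = Sing H \<and> nc_singular_inner S \<and> nc_outer F"

end

(* Testing the singularity condition at the level-infinity points rL (L the left free shift) shows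
   that h lies in the singularity space of H iff, for every r < 1, the dilation h_r lies in the
   right-shift cyclic subspace generated by H_r. If H_r = B_r F_r is the inner-outer factorization
   (the Wold argument for a cyclic subspace), then h_r = B_r g_r with norm g_r at most norm h, and
   a coefficientwise limit as r tends to 1 gives h = B g with norm g at most norm h for one
   contractive B, which itself lies in the singularity space. Hence B is inner, its range is the
   singularity space, and B is the Blaschke factor.

   Write H = B g. For s < 1 the inclusion of B_s in the range of the inner factor of H_s exhibits
   the outer factor of H_s as a product G g_s; multiplied by a suitable polynomial and dilated once
   more it is a small perturbation of 1. As multiplication by a nonzero power series is injective,
   this makes every dilation of g right invertible, so the inner factor of g is singular.

   Membership in H-infinity is interchangeable with being a bounded left multiplier: one direction
   evaluates at finite compressions of rL, the other is Popescu's von Neumann inequality, proved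
   with the Poisson kernel at a finite level. *)
theory Submission
  imports Defs "HOL-Complex_Analysis.Great_Picard"
begin

section \<open>The Hilbert space \<open>\<ell>\<^sup>2\<close>\<close>

text \<open>For p = 2 the outer factor is merely an H^2 function, and a product of two H^2 functions
  need not be square-summable. Products are therefore formed on coefficient families
  (\<open>conv\<close>), where associativity and cancellation are purely algebraic; norms enter
  through \<open>multiplier\<close>.

  The singularity space is closed and invariant under the right shifts, but the Wold argument by
  itself would only present it as an orthogonal sum of ranges of possibly many inner functions.
  After dilation, membership is in a cyclic subspace, which has a single generator. The vector that
  tests this membership is the residual of a projection and in general has infinitely many nonzero
  coefficients, hence the points of level infinity.

  Cyclicity of an outer F yields polynomials p with Fp close to 1 in the Hilbert norm, which does
  not make Fp invertible. Dilating by t < 1 turns a small Hilbert norm into a small multiplier norm,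
  at the price of a factor 1/(1 - t); this is the reason for dilating a second time.\<close>

lemmas ell2_coeff_simps [simp] =
  zero_ell2.rep_eq plus_ell2.rep_eq uminus_ell2.rep_eq minus_ell2.rep_eq
  scaleR_ell2.rep_eq scaleC.rep_eq truncate.rep_eq

lemma ell2_eqI: "(\<And>i. ell2_coeff x i = ell2_coeff y i) \<Longrightarrow> x = y"
  by (simp add: ell2_coeff_inject[symmetric] fun_eq_iff)

lemma ell2_coeff_sum [simp]: "ell2_coeff (sum f A) i = (\<Sum>a\<in>A. ell2_coeff (f a) i)"
  by (induction A rule: infinite_finite_induct) auto

lemma scaleC_add_right [simp]: "c *\<^sub>C (x + y) = c *\<^sub>C x + c *\<^sub>C y"
  and scaleC_diff_right [simp]: "c *\<^sub>C (x - y) = c *\<^sub>C x - c *\<^sub>C y"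
  and scaleC_add_left: "(a + b) *\<^sub>C x = a *\<^sub>C x + b *\<^sub>C x"
  and scaleC_scaleC [simp]: "a *\<^sub>C (b *\<^sub>C x) = (a * b) *\<^sub>C x"
  and scaleC_one [simp]: "1 *\<^sub>C x = x"
  and scaleC_zero_left [simp]: "0 *\<^sub>C x = 0"
  and scaleC_zero_right [simp]: "c *\<^sub>C 0 = 0"
  and scaleC_minus1: "(-1) *\<^sub>C x = - x"
  and scaleR_scaleC: "r *\<^sub>R x = of_real r *\<^sub>C x"
  by (auto intro!: ell2_eqI simp: algebra_simps)

lemma scaleC_sum_right: "c *\<^sub>C sum f A = (\<Sum>a\<in>A. c *\<^sub>C f a)"
  by (auto intro!: ell2_eqI simp: sum_distrib_left)

lemma truncate_scaleC [simp]: "truncate n (c *\<^sub>C x) = c *\<^sub>C truncate n x"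
  and truncate_truncate [simp]: "truncate n (truncate n x) = truncate n x"
  by (auto intro!: ell2_eqI)

lemma truncate_in_vec_space [simp]: "truncate n x \<in> vec_space n"
  by (simp add: vec_space_def)

lemma truncate_vec_space [simp]: "x \<in> vec_space n \<Longrightarrow> truncate n x = x"
  by (auto intro!: ell2_eqI simp: vec_space_def)

section \<open>The complex inner product\<close>

lemma cinner_reindex:
  assumes "inj h" "\<And>i. i \<notin> range h \<Longrightarrow> ell2_coeff x i = 0"
    and "\<And>j. ell2_coeff x' j = ell2_coeff x (h j)" "\<And>j. ell2_coeff y' j = ell2_coeff y (h j)"
  shows "cinner x y = cinner x' y'"
proof -
  have "cinner x y = (\<Sum>\<^sub>\<infinity>i\<in>range h. cnj (ell2_coeff x i) * ell2_coeff y i)"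
    unfolding cinner.rep_eq by (rule infsum_cong_neutral) (use assms(2) in auto)
  then show ?thesis
    by (simp add: cinner.rep_eq infsum_reindex[OF assms(1)] o_def assms(3,4))
qed

lemma summable_cinner: "(\<lambda>i. cnj (ell2_coeff x i) * ell2_coeff y i) summable_on UNIV"
  by (intro ell2_summable_mult summable_ell2)

lemma has_sum_cinner: "((\<lambda>i. cnj (ell2_coeff x i) * ell2_coeff y i) has_sum cinner x y) UNIV"
  unfolding cinner.rep_eq by (intro has_sum_infsum summable_cinner)

lemma cinner_commute: "cinner y x = cnj (cinner x y)"
  unfolding cinner.rep_eq infsum_cnj[symmetric] by (intro infsum_cong) simp

lemma cinner_add_right: "cinner x (y + z) = cinner x y + cinner x z"
  unfolding cinner.rep_eq
  by (subst infsum_add[symmetric, OF summable_cinner summable_cinner])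
    (auto simp: algebra_simps intro!: infsum_cong)

lemma cinner_scaleC_right [simp]: "cinner x (c *\<^sub>C y) = c * cinner x y"
  unfolding cinner.rep_eq
  by (subst infsum_cmult_right'[symmetric]) (auto simp: algebra_simps intro!: infsum_cong)

lemma cinner_add_left: "cinner (x + y) z = cinner x z + cinner y z"
  by (subst (1 2 3) cinner_commute) (simp add: cinner_add_right)

lemma cinner_scaleC_left [simp]: "cinner (c *\<^sub>C x) y = cnj c * cinner x y"
  by (subst (1 2) cinner_commute) simp

lemma cinner_zero [simp]: "cinner 0 x = 0" "cinner x 0 = 0"
  by (simp_all add: cinner.rep_eq)

lemma cinner_uminus [simp]: "cinner (- x) y = - cinner x y" "cinner x (- y) = - cinner x y"
  by (simp_all flip: scaleC_minus1)

lemma cinner_diff_right: "cinner x (y - z) = cinner x y - cinner x z"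
  using cinner_add_right[of x y "- z"] by simp

lemma cinner_diff_left: "cinner (x - y) z = cinner x z - cinner y z"
  using cinner_add_left[of x "- y" z] by simp

lemma cinner_sum_right: "cinner x (sum f A) = (\<Sum>a\<in>A. cinner x (f a))"
  by (induction A rule: infinite_finite_induct) (auto simp: cinner_add_right)

lemma cinner_sum_left: "cinner (sum f A) x = (\<Sum>a\<in>A. cinner (f a) x)"
  by (induction A rule: infinite_finite_induct) (auto simp: cinner_add_left)

lemma cinner_self: "cinner x x = of_real ((norm x)\<^sup>2)"
proof (rule complex_eqI)
  show "Re (cinner x x) = Re (of_real ((norm x)\<^sup>2))"
    by (simp add: power2_norm_eq_inner inner_ell2_def)
  have "cinner x x = cnj (cinner x x)"
    by (rule cinner_commute)
  then show "Im (cinner x x) = Im (of_real ((norm x)\<^sup>2))"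
    by (simp add: complex_eq_iff)
qed

lemma cinner_eq_zero [simp]: "cinner x x = 0 \<longleftrightarrow> x = 0"
  by (simp add: cinner_self)

lemma cinner_norm_le: "cmod (cinner x y) \<le> norm x * norm y"
proof (cases "cinner x y = 0")
  case False
  define c where "c = cnj (sgn (cinner x y))"
  have "c * cinner x y = cinner x y * cnj (cinner x y) / of_real (cmod (cinner x y))"
    by (simp add: c_def sgn_eq mult.commute)
  also have "\<dots> = of_real (cmod (cinner x y))"
    using False by (simp add: power2_eq_square flip: complex_norm_square)
  finally have "cmod (cinner x y) = Re (c * cinner x y)"
    by simp
  also have "\<dots> = inner x (c *\<^sub>C y)"
    by (simp add: inner_ell2_def)
  also have "\<dots> \<le> norm x * norm (c *\<^sub>C y)"
    by (rule norm_cauchy_schwarz)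
  also have "\<dots> = norm x * norm y"
    using False by (simp add: norm_scaleC c_def norm_sgn)
  finally show ?thesis .
qed auto

lemma bounded_linear_cinner_right: "bounded_linear (cinner x)"
proof (rule bounded_linear_intro)
  show "cinner x (r *\<^sub>R y) = r *\<^sub>R cinner x y" for r y
    by (simp add: scaleR_scaleC scaleR_conv_of_real)
  show "norm (cinner x y) \<le> norm y * norm x" for y
    using cinner_norm_le[of x y] by (simp add: mult.commute)
qed (rule cinner_add_right)

lemma cinner_eqI: "(\<And>z. cinner z x = cinner z y) \<Longrightarrow> x = y"
  by (metis cinner_diff_right cinner_eq_zero eq_iff_diff_eq_0)

lemma has_sum_norm_ell2: "((\<lambda>i. (cmod (ell2_coeff x i))\<^sup>2) has_sum (norm x)\<^sup>2) UNIV"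
  unfolding norm_ell2_sq by (intro has_sum_infsum summable_ell2)

lemma sum_coeff_le_norm: "finite A \<Longrightarrow> (\<Sum>i\<in>A. (cmod (ell2_coeff x i))\<^sup>2) \<le> (norm x)\<^sup>2"
  unfolding norm_ell2_sq by (intro finite_sum_le_infsum summable_ell2) auto

lemma cmod_coeff_le_norm: "cmod (ell2_coeff x i) \<le> norm x"
  by (rule power2_le_imp_le) (use sum_coeff_le_norm[of "{i}" x] in auto)

lemma bounded_linear_ell2_coeff: "bounded_linear (\<lambda>x. ell2_coeff x i)"
  by (rule bounded_linear_intro[where K = 1])
    (auto simp: scaleR_conv_of_real cmod_coeff_le_norm)

text \<open>For functions that need not be square-summable, \<open>ell2_le C x\<close> expresses membership in
  \<open>\<ell>\<^sup>2\<close> together with a norm bound.\<close>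

definition ell2_le :: "real \<Rightarrow> ('a \<Rightarrow> complex) \<Rightarrow> bool" where
  "ell2_le C x \<longleftrightarrow> 0 \<le> C \<and> (\<forall>A. finite A \<longrightarrow> (\<Sum>i\<in>A. (cmod (x i))\<^sup>2) \<le> C\<^sup>2)"

lemma ell2_le_coeff: "norm x \<le> C \<Longrightarrow> ell2_le C (ell2_coeff x)"
  by (auto simp: ell2_le_def intro: order_trans[OF norm_ge_zero]
      order_trans[OF sum_coeff_le_norm power_mono])

lemma ell2_le_inj:
  fixes h :: "'b \<Rightarrow> 'a" and x :: "'a ell2"
  assumes "inj h"
  shows "ell2_le (norm x) (\<lambda>i. ell2_coeff x (h i))"
  unfolding ell2_le_def
proof (intro conjI allI impI)
  fix A :: "'b set" assume "finite A"
  then have "(\<Sum>i\<in>h ` A. (cmod (ell2_coeff x i))\<^sup>2) \<le> (norm x)\<^sup>2"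
    by (intro sum_coeff_le_norm) simp
  then show "(\<Sum>i\<in>A. (cmod (ell2_coeff x (h i)))\<^sup>2) \<le> (norm x)\<^sup>2"
    by (simp add: sum.reindex[OF inj_on_subset[OF assms subset_UNIV]])
qed simp

lemma ell2_le_norm:
  assumes "ell2_le C (ell2_coeff x)"
  shows "norm x \<le> C"
proof (rule power2_le_imp_le)
  show "(norm x)\<^sup>2 \<le> C\<^sup>2"
    unfolding norm_ell2_sq
    by (rule infsum_le_finite_sums) (use assms in \<open>auto simp: ell2_le_def summable_ell2\<close>)
qed (use assms in \<open>auto simp: ell2_le_def\<close>)

lemma ell2_le_Abs:
  assumes "ell2_le C x"
  shows "ell2_coeff (Abs_ell2 x) = x" "norm (Abs_ell2 x) \<le> C"
proof -
  have "(\<lambda>i. (cmod (x i))\<^sup>2) summable_on UNIV"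
    by (rule nonneg_bounded_partial_sums_imp_summable_on[where C = "C\<^sup>2"])
      (use assms in \<open>auto simp: ell2_le_def intro!: eventually_finite_subsets_at_top_weakI\<close>)
  then show eq: "ell2_coeff (Abs_ell2 x) = x"
    by (intro Abs_ell2_inverse) auto
  show "norm (Abs_ell2 x) \<le> C"
    by (rule ell2_le_norm) (simp add: eq assms)
qed

text \<open>Fatou's lemma for coefficientwise limits: every finite partial sum passes to the limit.
  All later compactness arguments rest on it.\<close>

lemma ell2_le_lim:
  assumes "\<And>n. ell2_le (C n) (x n)" "C \<longlonglongrightarrow> c" "\<And>i. (\<lambda>n. x n i) \<longlonglongrightarrow> y i"
  shows "ell2_le c y"
  unfolding ell2_le_def
proof (intro conjI allI impI)
  show "0 \<le> c"
    using assms(1,2) by (intro LIMSEQ_le_const[of C]) (auto simp: ell2_le_def)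
  fix A :: "'a set" assume "finite A"
  show "(\<Sum>i\<in>A. (cmod (y i))\<^sup>2) \<le> c\<^sup>2"
    by (rule LIMSEQ_le[of "\<lambda>n. \<Sum>i\<in>A. (cmod (x n i))\<^sup>2" _ "\<lambda>n. (C n)\<^sup>2"])
      (use assms \<open>finite A\<close> in \<open>auto intro!: tendsto_intros simp: ell2_le_def\<close>)
qed

instance ell2 :: (type) banach
proof
  fix X :: "nat \<Rightarrow> 'a ell2" assume X: "Cauchy X"
  have "Cauchy (\<lambda>n. ell2_coeff (X n) i)" for i
    using bounded_linear.Cauchy[OF bounded_linear_ell2_coeff X] .
  then have "\<exists>l. (\<lambda>n. ell2_coeff (X n) i) \<longlonglongrightarrow> l" for i
    by (simp add: Cauchy_convergent_iff convergent_def)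
  then obtain y where y: "\<And>i. (\<lambda>n. ell2_coeff (X n) i) \<longlonglongrightarrow> y i"
    by metis
  obtain M where M: "norm (X n) \<le> M" for n
    using Cauchy_Bseq[OF X] by (auto simp: Bseq_def)
  have "ell2_le M y"
    using ell2_le_lim[of "\<lambda>_. M" "\<lambda>n. ell2_coeff (X n)" M y] y M by (auto intro: ell2_le_coeff)
  then have Y: "ell2_coeff (Abs_ell2 y) = y"
    by (rule ell2_le_Abs)
  have "X \<longlonglongrightarrow> Abs_ell2 y"
  proof (rule metric_LIMSEQ_I)
    fix e :: real assume "e > 0"
    then obtain N where N: "\<And>m n. m \<ge> N \<Longrightarrow> n \<ge> N \<Longrightarrow> dist (X m) (X n) < e / 2"
      using X unfolding Cauchy_def by (meson half_gt_zero)
    have "dist (X n) (Abs_ell2 y) < e" if "n \<ge> N" for n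
    proof -
      \<comment> \<open>Coefficientwise limit of the Cauchy estimate in its second index;
        \<open>e / 2\<close> leaves room for the strict inequality that is lost in the
        limit.\<close>
      have "ell2_le (e / 2) (\<lambda>i. ell2_coeff (X n - Abs_ell2 y) i)"
      proof (rule ell2_le_lim[of "\<lambda>_. e / 2" "\<lambda>m. ell2_coeff (X n - X (m + N))"])
        show "ell2_le (e / 2) (ell2_coeff (X n - X (m + N)))" for m
          using N[of n "m + N"] that by (intro ell2_le_coeff) (simp add: dist_norm)
        show "(\<lambda>m. ell2_coeff (X n - X (m + N)) i) \<longlonglongrightarrow> ell2_coeff (X n - Abs_ell2 y) i" for i
          using LIMSEQ_ignore_initial_segment[OF y[of i], of N] by (auto intro!: tendsto_intros simp: Y)
      qed auto
      then show ?thesis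
        using ell2_le_norm[of "e / 2" "X n - Abs_ell2 y"] \<open>e > 0\<close> by (simp add: dist_norm)
    qed
    then show "\<exists>no. \<forall>n\<ge>no. dist (X n) (Abs_ell2 y) < e"
      by blast
  qed
  then show "convergent X"
    by (auto simp: convergent_def)
qed

text \<open>Convergence from orthogonality rather than from absolute summability: the squared norm
  of a piece of \<open>f\<close> beyond \<open>F0\<close> is at most the corresponding piece of the
  convergent sum of \<open>g\<close>, so the net of finite sums is Cauchy. It serves basis
  expansions, row operators and evaluation alike.\<close>

lemma summable_on_square_bound:
  fixes f :: "'i \<Rightarrow> 'b::banach"
  assumes f: "\<And>F. finite F \<Longrightarrow> F \<subseteq> A \<Longrightarrow> (norm (sum f F))\<^sup>2 \<le> sum g F"
    and g: "g summable_on A"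
  shows "f summable_on A" "(norm (infsum f A))\<^sup>2 \<le> infsum g A"
proof -
  have g0: "g x \<ge> 0" if "x \<in> A" for x
    using f[of "{x}"] that by (simp add: order_trans[OF zero_le_power2])
  have "\<exists>P. eventually P (finite_subsets_at_top A) \<and>
              (\<forall>F F'. P F \<and> P F' \<longrightarrow> dist (sum f F) (sum f F') < e)" if "e > 0" for e
  proof -
    obtain F0 where F0: "finite F0" "F0 \<subseteq> A" "dist (sum g F0) (infsum g A) \<le> (e/4)\<^sup>2"
      using infsum_finite_approximation[OF g, of "(e/4)\<^sup>2"] \<open>e > 0\<close> by auto
    define P where "P F \<longleftrightarrow> finite F \<and> F0 \<subseteq> F \<and> F \<subseteq> A" for F
    have near: "norm (sum f F - sum f F0) \<le> e/4" if "P F" for F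
    proof (rule power2_le_imp_le)
      have "(norm (sum f F - sum f F0))\<^sup>2 = (norm (sum f (F - F0)))\<^sup>2"
        using that F0 by (subst sum_diff) (auto simp: P_def)
      also have "\<dots> \<le> sum g (F - F0)"
        using that by (intro f) (auto simp: P_def)
      also have "\<dots> = sum g F - sum g F0"
        using that F0 by (subst sum_diff) (auto simp: P_def)
      also have "\<dots> \<le> infsum g A - sum g F0"
        using that by (intro diff_right_mono finite_sum_le_infsum g) (auto simp: P_def g0)
      also have "\<dots> \<le> (e/4)\<^sup>2"
        using F0(3) by (simp add: dist_real_def)
      finally show "(norm (sum f F - sum f F0))\<^sup>2 \<le> (e/4)\<^sup>2" .
    qed (use \<open>e > 0\<close> in auto)
    have "dist (sum f F) (sum f F') < e" if "P F" "P F'" for F F'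
    proof -
      have "norm (sum f F - sum f F') \<le> norm (sum f F - sum f F0) + norm (sum f F' - sum f F0)"
        by (metis (no_types, opaque_lifting) diff_diff_eq2 diff_add_cancel norm_triangle_ineq4)
      then show ?thesis
        using near[OF that(1)] near[OF that(2)] \<open>e > 0\<close> by (simp add: dist_norm)
    qed
    moreover have "eventually P (finite_subsets_at_top A)"
      unfolding P_def eventually_finite_subsets_at_top using F0 by blast
    ultimately show ?thesis by blast
  qed
  then have "cauchy_filter (filtermap (sum f) (finite_subsets_at_top A))"
    by (simp add: cauchy_filter_metric_filtermap)
  then obtain L where L: "(sum f \<longlongrightarrow> L) (finite_subsets_at_top A)"
    using complete_uniform[where S = "UNIV :: 'b set"] complete_UNIV by (force simp: filterlim_def)
  then show sf: "f summable_on A"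
    using summable_on_def has_sum_def by blast
  show "(norm (infsum f A))\<^sup>2 \<le> infsum g A"
  proof (rule tendsto_le)
    show "((\<lambda>F. (norm (sum f F))\<^sup>2) \<longlongrightarrow> (norm (infsum f A))\<^sup>2) (finite_subsets_at_top A)"
      by (intro tendsto_intros infsum_tendsto sf)
    show "(sum g \<longlongrightarrow> infsum g A) (finite_subsets_at_top A)"
      by (intro infsum_tendsto g)
    show "\<forall>\<^sub>F F in finite_subsets_at_top A. (norm (sum f F))\<^sup>2 \<le> sum g F"
      by (intro eventually_finite_subsets_at_top_weakI f)
  qed auto
qed

section \<open>The standard orthonormal basis\<close>

definition ket :: "'a \<Rightarrow> 'a ell2" where
  "ket i = Abs_ell2 (\<lambda>j. if j = i then 1 else 0)"

lemma ell2_coeff_ket [simp]: "ell2_coeff (ket i) j = (if j = i then 1 else 0)"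
proof -
  have "(\<Sum>j\<in>A. (cmod (if j = i then 1 else 0))\<^sup>2) \<le> 1" if "finite A" for A
    using that by (simp add: if_distrib if_distribR cong: if_cong)
  then have "ell2_le 1 (\<lambda>j. if j = i then 1 else 0)"
    by (auto simp: ell2_le_def)
  from ell2_le_Abs(1)[OF this] show ?thesis
    by (simp add: ket_def)
qed

lemma cinner_ket_left [simp]: "cinner (ket i) x = ell2_coeff x i"
proof -
  have "((\<lambda>j. cnj (ell2_coeff (ket i) j) * ell2_coeff x j) has_sum (\<Sum>j\<in>{i}. ell2_coeff x j)) UNIV"
    by (rule has_sum_cong_neutral[THEN iffD2, OF _ _ _ has_sum_finite, of "{i}"]) auto
  then show ?thesis
    using has_sum_unique[OF has_sum_cinner] by force
qed

lemma cinner_ket_right [simp]: "cinner x (ket i) = cnj (ell2_coeff x i)"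
  by (subst cinner_commute) simp

lemma norm_ket [simp]: "norm (ket i) = 1"
proof -
  have "of_real ((norm (ket i))\<^sup>2) = (1 :: complex)"
    unfolding cinner_self[symmetric] by simp
  then have "(norm (ket i))\<^sup>2 = 1"
    using of_real_eq_1_iff by blast
  then show ?thesis
    by (simp add: power2_eq_1_iff) (metis norm_ge_zero neg_0_le_iff_le not_one_le_zero)
qed

lemma norm_sum_ket: "finite A \<Longrightarrow> (norm (\<Sum>i\<in>A. c i *\<^sub>C ket i))\<^sup>2 = (\<Sum>i\<in>A. (cmod (c i))\<^sup>2)"
proof -
  assume A: "finite A"
  have "of_real ((norm (\<Sum>i\<in>A. c i *\<^sub>C ket i))\<^sup>2) = (of_real (\<Sum>i\<in>A. (cmod (c i))\<^sup>2) :: complex)"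
    unfolding cinner_self[symmetric] using A
    by (simp add: cinner_sum_left cinner_sum_right complex_norm_square[unfolded of_real_power]
        if_distrib cong: if_cong)
  then show ?thesis
    using of_real_eq_iff by blast
qed

lemma has_sum_ket: "((\<lambda>i. ell2_coeff x i *\<^sub>C ket i) has_sum x) UNIV"
proof -
  let ?f = "\<lambda>i. ell2_coeff x i *\<^sub>C ket i"
  have s: "?f summable_on UNIV"
    by (rule summable_on_square_bound(1)[OF _ summable_ell2[of x]]) (simp add: norm_sum_ket)
  have "infsum ?f UNIV = x"
  proof (rule ell2_eqI)
    fix j
    have "((\<lambda>i. ell2_coeff (?f i) j) has_sum ell2_coeff (infsum ?f UNIV) j) UNIV"
      by (intro has_sum_bounded_linear[OF bounded_linear_ell2_coeff] has_sum_infsum s)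
    moreover have "((\<lambda>i. ell2_coeff (?f i) j) has_sum (\<Sum>i\<in>{j}. ell2_coeff x i)) UNIV"
      by (rule has_sum_cong_neutral[THEN iffD2, OF _ _ _ has_sum_finite, of "{j}"]) auto
    ultimately show "ell2_coeff (infsum ?f UNIV) j = ell2_coeff x j"
      using has_sum_unique by force
  qed
  then show ?thesis
    using has_sum_infsum[OF s] by simp
qed

section \<open>Closed subspaces and orthogonal projections\<close>

text \<open>The class instances of \<open>ell2\<close> know real scalars only, so invariance under
  complex scalars is part of the definition.\<close>

definition closed_csubspace :: "'a ell2 set \<Rightarrow> bool" where
  "closed_csubspace M \<longleftrightarrow> closed M \<and> 0 \<in> M \<and> (\<forall>x\<in>M. \<forall>y\<in>M. x + y \<in> M) \<and> (\<forall>c. \<forall>x\<in>M. c *\<^sub>C x \<in> M)"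

lemma closed_csubspaceD:
  assumes "closed_csubspace M"
  shows "closed M" "0 \<in> M" "x \<in> M \<Longrightarrow> y \<in> M \<Longrightarrow> x + y \<in> M" "x \<in> M \<Longrightarrow> c *\<^sub>C x \<in> M"
    "x \<in> M \<Longrightarrow> r *\<^sub>R x \<in> M" "x \<in> M \<Longrightarrow> y \<in> M \<Longrightarrow> x - y \<in> M"
proof -
  show *: "closed M" "0 \<in> M" "x \<in> M \<Longrightarrow> y \<in> M \<Longrightarrow> x + y \<in> M" "x \<in> M \<Longrightarrow> c *\<^sub>C x \<in> M" for x y c
    using assms by (auto simp: closed_csubspace_def)
  show "x \<in> M \<Longrightarrow> r *\<^sub>R x \<in> M"
    by (simp add: scaleR_scaleC *)
  show "x \<in> M \<Longrightarrow> y \<in> M \<Longrightarrow> x - y \<in> M"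
    using *(3)[of x "(-1) *\<^sub>C y"] *(4)[of y "-1"] by (simp add: scaleC_minus1)
qed

lemma closed_csubspace_subspace: "closed_csubspace M \<Longrightarrow> subspace M"
  by (simp add: subspace_def closed_csubspaceD)

definition closed_cspan :: "'a ell2 set \<Rightarrow> 'a ell2 set" where
  "closed_cspan X = closure (span {c *\<^sub>C x | c x. x \<in> X})"

lemma closed_cspan_least: "closed_csubspace M \<Longrightarrow> X \<subseteq> M \<Longrightarrow> closed_cspan X \<subseteq> M"
  unfolding closed_cspan_def
  by (intro closure_minimal span_minimal closed_csubspace_subspace) (auto intro: closed_csubspaceD)

lemma closed_cspan_base: "x \<in> X \<Longrightarrow> x \<in> closed_cspan X"
proof -
  assume "x \<in> X"
  then have "1 *\<^sub>C x \<in> span {c *\<^sub>C x | c x. x \<in> X}"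
    by (intro span_base) blast
  then show ?thesis
    unfolding closed_cspan_def using closure_subset by auto
qed

lemma closed_csubspace_closed_cspan: "closed_csubspace (closed_cspan X)"
proof -
  let ?G = "{c *\<^sub>C x | c x. x \<in> X}"
  have add: "x + y \<in> closure (span ?G)" if x: "x \<in> closure (span ?G)" and y: "y \<in> closure (span ?G)" for x y
  proof -
    obtain f where f: "\<forall>n. f n \<in> span ?G" "f \<longlonglongrightarrow> x"
      using x closure_sequential[of x "span ?G"] by blast
    obtain g where g: "\<forall>n. g n \<in> span ?G" "g \<longlonglongrightarrow> y"
      using y closure_sequential[of y "span ?G"] by blast
    have "\<forall>n. f n + g n \<in> span ?G" "(\<lambda>n. f n + g n) \<longlonglongrightarrow> x + y"
      using f g by (auto intro: span_add tendsto_add)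
    then show ?thesis
      by (subst closure_sequential) (intro exI[of _ "\<lambda>n. f n + g n"] conjI)
  qed
  have zero: "0 \<in> closure (span ?G)"
    using closure_subset span_zero by blast
  \<comment> \<open>A complex scalar merges with the complex coefficient of each generator, so the
    real span of all complex multiples is already a complex subspace.\<close>
  have span: "c *\<^sub>C x \<in> span ?G" if "x \<in> span ?G" for c x
    using that
  proof (induction rule: span_induct_alt)
    case base
    then show ?case by (simp add: span_zero)
  next
    case (step r g y)
    then obtain b z where g: "g = b *\<^sub>C z" "z \<in> X" by blast
    have "c *\<^sub>C r *\<^sub>R g = (c * (of_real r * b)) *\<^sub>C z"
      by (simp add: g(1) scaleR_scaleC)
    then have "c *\<^sub>C r *\<^sub>R g \<in> span ?G"
      using g(2) by (intro span_base) blast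
    with step show ?case
      by (simp add: span_add)
  qed
  have "c *\<^sub>C x \<in> closure (span ?G)" if x: "x \<in> closure (span ?G)" for c x
  proof -
    have "(*\<^sub>C) c ` closure (span ?G) \<subseteq> closure ((*\<^sub>C) c ` span ?G)"
      by (intro closure_bounded_linear_image_subset bounded_linear_scaleC)
    also have "\<dots> \<subseteq> closure (span ?G)"
      by (intro closure_mono) (auto simp: span)
    finally show ?thesis
      using x by auto
  qed
  then show ?thesis
    using add zero by (auto simp: closed_csubspace_def closed_cspan_def)
qed

lemma closed_csubspace_orthogonal: "closed_csubspace {x. \<forall>y\<in>Y. cinner y x = 0}"
proof -
  have "closed (\<Inter>y\<in>Y. {x. cinner y x = 0})"
    by (intro closed_INT ballI closed_Collect_eq continuous_intros
        bounded_linear.continuous_on[OF bounded_linear_cinner_right])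
  also have "(\<Inter>y\<in>Y. {x. cinner y x = 0}) = {x. \<forall>y\<in>Y. cinner y x = 0}"
    by auto
  finally show ?thesis
    by (auto simp: closed_csubspace_def cinner_add_right)
qed

lemma closed_csubspace_vimage:
  assumes M: "closed_csubspace M" and T: "bounded_linear T" "\<And>c x. T (c *\<^sub>C x) = c *\<^sub>C T x"
  shows "closed_csubspace (T -` M)"
proof -
  have "closed (T -` M)"
    by (intro closed_vimage closed_csubspaceD(1)[OF M] linear_continuous_on T)
  then show ?thesis
    using bounded_linear.linear[OF T(1)]
    by (auto simp: closed_csubspace_def linear_0 linear_add T(2) closed_csubspaceD[OF M])
qed

text \<open>A minimising sequence in \<open>M\<close> is Cauchy by the parallelogram law. At its
  limit the residual is orthogonal to \<open>M\<close>, since no move along \<open>M\<close> can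
  shorten it.\<close>

lemma projection_exists:
  assumes M: "closed_csubspace M"
  obtains p where "p \<in> M" "\<And>m. m \<in> M \<Longrightarrow> cinner m (x - p) = 0"
proof -
  define D where "D = (INF m\<in>M. (norm (x - m))\<^sup>2)"
  have bdd: "bdd_below ((\<lambda>m. (norm (x - m))\<^sup>2) ` M)"
    by (intro bdd_belowI2[of _ 0]) auto
  have D_le: "D \<le> (norm (x - m))\<^sup>2" if "m \<in> M" for m
    unfolding D_def by (intro cINF_lower bdd that)
  have "\<exists>m\<in>M. (norm (x - m))\<^sup>2 < D + 1 / Suc n" for n
    using cINF_less_iff[OF _ bdd, of "D + 1 / Suc n"] closed_csubspaceD(2)[OF M]
    by (auto simp: D_def)
  then obtain m where mM: "\<And>n. m n \<in> M" and m: "\<And>n. (norm (x - m n))\<^sup>2 < D + 1 / Suc n"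
    by metis
  have dist_m: "(norm (m i - m j))\<^sup>2 \<le> 2 / Suc i + 2 / Suc j" for i j
  proof -
    have "(1/2) *\<^sub>R (m i + m j) \<in> M"
      using mM by (intro closed_csubspaceD[OF M]) auto
    then have "D \<le> (norm (x - (1/2) *\<^sub>R (m i + m j)))\<^sup>2"
      by (rule D_le)
    moreover have "(norm (m i - m j))\<^sup>2 + 4 * (norm (x - (1/2) *\<^sub>R (m i + m j)))\<^sup>2
        = 2 * (norm (x - m i))\<^sup>2 + 2 * (norm (x - m j))\<^sup>2"
      by (simp add: power2_norm_eq_inner inner_diff_left inner_diff_right inner_add_left
          inner_add_right inner_commute algebra_simps)
    ultimately show ?thesis
      using m[of i] m[of j] by linarith
  qed
  have "Cauchy m"
  proof (rule CauchyI)
    fix e :: real assume "e > 0"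
    then obtain N where N: "inverse (real (Suc N)) < e\<^sup>2 / 4"
      using reals_Archimedean[of "e\<^sup>2 / 4"] by auto
    have "norm (m i - m j) < e" if "i \<ge> N" "j \<ge> N" for i j
    proof (rule power2_less_imp_less)
      have "2 / Suc i \<le> 2 / real (Suc N)" "2 / Suc j \<le> 2 / real (Suc N)"
        using that by (auto intro!: divide_left_mono)
      then show "(norm (m i - m j))\<^sup>2 < e\<^sup>2"
        using dist_m[of i j] N by (simp add: inverse_eq_divide)
    qed (use \<open>e > 0\<close> in auto)
    then show "\<exists>N. \<forall>i\<ge>N. \<forall>j\<ge>N. norm (m i - m j) < e"
      by blast
  qed
  then obtain p where p: "m \<longlonglongrightarrow> p"
    by (auto simp: Cauchy_convergent_iff convergent_def)
  have pM: "p \<in> M"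
    using closed_sequentially[OF closed_csubspaceD(1)[OF M] mM p] .
  have Dp: "(norm (x - p))\<^sup>2 \<le> D"
  proof (rule LIMSEQ_le)
    show "(\<lambda>n. (norm (x - m n))\<^sup>2) \<longlonglongrightarrow> (norm (x - p))\<^sup>2"
      by (intro tendsto_intros p)
    show "(\<lambda>n. D + 1 / Suc n) \<longlonglongrightarrow> D"
      using tendsto_add[OF tendsto_const[of D] LIMSEQ_inverse_real_of_nat]
      by (simp add: inverse_eq_divide)
  qed (use m in \<open>auto intro!: exI[of _ 0] less_imp_le\<close>)
  have real_orth: "inner k (x - p) = 0" if k: "k \<in> M" for k
  proof (cases "k = 0")
    case False
    \<comment> \<open>The best real step along \<open>k\<close>; if it were nonzero, the squared
      distance would fall below the infimum \<open>D\<close>.\<close>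
    define t where "t = inner k (x - p) / (norm k)\<^sup>2"
    have "D \<le> (norm (x - (p + t *\<^sub>R k)))\<^sup>2"
      using k pM by (intro D_le closed_csubspaceD[OF M])
    also have "\<dots> = (norm (x - p))\<^sup>2 - 2 * t * inner k (x - p) + t * t * (norm k)\<^sup>2"
      by (simp add: power2_norm_eq_inner inner_diff_left inner_diff_right inner_add_left
          inner_add_right inner_commute algebra_simps)
    also have "\<dots> = (norm (x - p))\<^sup>2 - (inner k (x - p))\<^sup>2 / (norm k)\<^sup>2"
      using False by (simp add: t_def field_simps power2_eq_square)
    finally have "(inner k (x - p))\<^sup>2 / (norm k)\<^sup>2 \<le> 0"
      using Dp by simp
    with False show ?thesis
      by (simp add: divide_le_0_iff)
  qed auto
  have "cinner k (x - p) = 0" if k: "k \<in> M" for k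
  proof (rule complex_eqI)
    show "Re (cinner k (x - p)) = Re 0"
      using real_orth[OF k] by (simp add: inner_ell2_def)
    \<comment> \<open>The imaginary part is the real part of the pairing with the rotated vector
      \<open>\<i> *\<^sub>C k\<close>, again in \<open>M\<close>.\<close>
    show "Im (cinner k (x - p)) = Im 0"
      using real_orth[OF closed_csubspaceD(4)[OF M k, of \<i>]] by (simp add: inner_ell2_def)
  qed
  with pM show ?thesis
    by (rule that)
qed

text \<open>Against a finitely supported vector the pairing is a finite sum of convergent terms. The
  uniform bound \<open>C\<close> extends this to any \<open>z\<close>, replaced by a finite part
  \<open>w\<close>.\<close>

lemma tendsto_cinner_weak:
  assumes C: "\<And>n. norm (x n) \<le> C" and lim: "\<And>i. (\<lambda>n. ell2_coeff (x n) i) \<longlonglongrightarrow> ell2_coeff y i"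
  shows "(\<lambda>n. cinner z (x n)) \<longlonglongrightarrow> cinner z y"
proof (rule LIMSEQ_I)
  fix e :: real assume e: "e > 0"
  have C0: "C \<ge> 0"
    using C[of 0] norm_ge_zero order_trans by blast
  have y: "norm y \<le> C"
    using ell2_le_lim[of "\<lambda>_. C" "\<lambda>n. ell2_coeff (x n)" C] lim C
    by (intro ell2_le_norm) (auto intro: ell2_le_coeff)
  define d where "d = e / (4 * (C + 1))"
  have d: "d > 0"
    using e C0 by (simp add: d_def)
  obtain F where F: "finite F" "dist (\<Sum>i\<in>F. ell2_coeff z i *\<^sub>C ket i) z \<le> d"
    using has_sum_finite_approximation[OF has_sum_ket[of z] d] by (elim exE conjE) blast
  define w where "w = (\<Sum>i\<in>F. ell2_coeff z i *\<^sub>C ket i)"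
  have w: "cinner w u = (\<Sum>i\<in>F. cnj (ell2_coeff z i) * ell2_coeff u i)" for u
    by (simp add: w_def cinner_sum_left)
  have "(\<lambda>n. cinner w (x n)) \<longlonglongrightarrow> cinner w y"
    unfolding w by (intro tendsto_intros lim)
  then obtain N where N: "\<And>n. n \<ge> N \<Longrightarrow> norm (cinner w (x n) - cinner w y) < e / 2"
    using LIMSEQ_D[of _ "cinner w y" "e / 2"] e by auto
  have close: "norm (cinner z u - cinner w u) \<le> e / 4" if u: "norm u \<le> C" for u
  proof -
    have "norm (cinner z u - cinner w u) \<le> norm (z - w) * norm u"
      by (metis cinner_diff_left cinner_norm_le)
    also have "\<dots> \<le> d * (C + 1)"
      using F u d C0 by (intro mult_mono) (auto simp: w_def dist_norm norm_minus_commute)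
    also have "\<dots> = e / 4"
      using C0 by (simp add: d_def divide_simps)
    finally show ?thesis .
  qed
  have "norm (cinner z (x n) - cinner z y) < e" if "n \<ge> N" for n
  proof -
    have "norm ((a - b) + (b - c) + (c - d)) < e"
      if "norm (a - b) \<le> e / 4" "norm (b - c) < e / 2" "norm (d - c) \<le> e / 4" for a b c d :: complex
      using that norm_triangle_ineq[of "(a - b) + (b - c)" "c - d"] norm_triangle_ineq[of "a - b" "b - c"]
      by (simp add: norm_minus_commute)
    from this[OF close[OF C[of n]] N[OF that] close[OF y]] show ?thesis
      by simp
  qed
  then show "\<exists>no. \<forall>n\<ge>no. norm (cinner z (x n) - cinner z y) < e"
    by blast
qed

text \<open>The residual of \<open>y\<close> after projection to \<open>M\<close> is orthogonal to
  every \<open>x n\<close>, hence by weak convergence to \<open>y\<close> itself, which forces it to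
  vanish. Limits of inner factors are kept inside a cyclic subspace this way.\<close>

lemma closed_csubspace_weakly_closed:
  assumes M: "closed_csubspace M" and xM: "\<And>n. x n \<in> M" and C: "\<And>n. norm (x n) \<le> C"
    and lim: "\<And>i. (\<lambda>n. ell2_coeff (x n) i) \<longlonglongrightarrow> ell2_coeff y i"
  shows "y \<in> M"
proof -
  obtain p where p: "p \<in> M" "\<And>m. m \<in> M \<Longrightarrow> cinner m (y - p) = 0"
    using projection_exists[OF M, of y] by blast
  have "cinner (y - p) (x n) = 0" for n
    using p(2)[OF xM[of n]] by (subst cinner_commute) simp
  with tendsto_cinner_weak[of x C y "y - p", OF C lim] have "cinner (y - p) y = 0"
    by (simp add: LIMSEQ_const_iff)
  moreover have "cinner (y - p) p = 0"
    using p by (subst cinner_commute) simp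
  ultimately have "cinner (y - p) (y - p) = 0"
    by (simp add: cinner_diff_right)
  with p show ?thesis by simp
qed

section \<open>Power series in noncommuting letters as coefficient families under
  convolution\<close>

fun conv :: "('d list \<Rightarrow> complex) \<Rightarrow> ('d list \<Rightarrow> complex) \<Rightarrow> 'd list \<Rightarrow> complex" where
  "conv f g [] = f [] * g []"
| "conv f g (a # w) = f [] * g (a # w) + conv (\<lambda>u. f (a # u)) g w"

lemma conv_eq_sum: "conv f g v = (\<Sum>i\<le>length v. f (take i v) * g (drop i v))"
  by (induction f g v rule: conv.induct) (simp_all add: sum.atMost_Suc_shift del: sum.atMost_Suc)

lemma conv_add_left: "conv (\<lambda>u. f u + g u) h v = conv f h v + conv g h v"
  and conv_add_right: "conv f (\<lambda>u. g u + h u) v = conv f g v + conv f h v"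
  and conv_diff_right: "conv f (\<lambda>u. g u - h u) v = conv f g v - conv f h v"
  and conv_cmult_left: "conv (\<lambda>u. c * f u) g v = c * conv f g v"
  and conv_cmult_right: "conv f (\<lambda>u. c * g u) v = c * conv f g v"
  by (simp_all add: conv_eq_sum algebra_simps sum.distrib sum_distrib_left sum_subtractf)

lemma conv_zero [simp]: "conv (\<lambda>_. 0) f v = 0" "conv f (\<lambda>_. 0) v = 0"
  by (simp_all add: conv_eq_sum)

text \<open>\<open>conv\<close> recurses on the first letter of the word, so induction on the word
  suffices. Each coefficient is a finite sum, whence this holds for arbitrary families.\<close>

lemma conv_assoc_apply: "conv (conv f g) h v = conv f (conv g h) v"
proof (induction v arbitrary: f)
  case (Cons a w)
  then show ?case
    by (simp add: conv_add_left conv_cmult_left algebra_simps)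
qed simp

lemma conv_assoc: "conv (conv f g) h = conv f (conv g h)"
  by (rule ext) (rule conv_assoc_apply)

text \<open>Right multiplication by the word \<open>w\<close> moves the coefficient at
  \<open>u\<close> to \<open>u @ w\<close>: by length, only the splitting into \<open>u\<close> and
  \<open>w\<close> contributes.\<close>

lemma conv_ket_append [simp]: "conv f (ell2_coeff (ket w)) (u @ w) = f u"
proof -
  have "conv f (ell2_coeff (ket w)) (u @ w) = (\<Sum>i\<in>{length u}. f (take i (u @ w)))"
    unfolding conv_eq_sum
  proof (rule sum.mono_neutral_cong_right, goal_cases)
    case 3
    show ?case
    proof
      fix i assume i: "i \<in> {..length (u @ w)} - {length u}"
      then have "length (drop i (u @ w)) \<noteq> length w"
        by auto
      then have "drop i (u @ w) \<noteq> w" by metis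
      then show "f (take i (u @ w)) * ell2_coeff (ket w) (drop i (u @ w)) = 0"
        by simp
    qed
  qed auto
  then show ?thesis by simp
qed

lemma conv_ket_not_suffix:
  assumes "\<And>u. v \<noteq> u @ w"
  shows "conv f (ell2_coeff (ket w)) v = 0"
  unfolding conv_eq_sum
proof (rule sum.neutral, rule ballI)
  fix i
  have "drop i v \<noteq> w"
    using assms[of "take i v"] append_take_drop_id[of i v] by auto
  then show "f (take i v) * ell2_coeff (ket w) (drop i v) = 0"
    by simp
qed

lemma conv_one_right: "conv f (ell2_coeff (ket [])) = f"
  using conv_ket_append[of f "[]"] by (intro ext) simp

lemma conv_one_left: "conv (ell2_coeff (ket [])) f = f"
proof
  show "conv (ell2_coeff (ket [])) f v = f v" for v
    by (cases v) simp_all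
qed

text \<open>Absence of zero divisors. With \<open>v\<close> a shortest word in the support of
  \<open>g\<close>, look at the coefficient of the product at \<open>u @ v\<close>: splittings
  before the end of \<open>u\<close> vanish by induction on the length of \<open>u\<close>, later
  ones by minimality of \<open>v\<close>, and \<open>f u * g v\<close> remains.\<close>

lemma conv_nonzero:
  assumes "conv f g = (\<lambda>_. 0)" "g \<noteq> (\<lambda>_. 0)"
  shows "f = (\<lambda>_. 0)"
proof -
  obtain v where v: "g v \<noteq> 0" "\<And>u. g u \<noteq> 0 \<Longrightarrow> length v \<le> length u"
    using assms(2) ex_has_least_nat[of "\<lambda>v. g v \<noteq> 0" _ length] by fast
  have "f u = 0" for u
  proof (induction "length u" arbitrary: u rule: less_induct)
    case less
    have "0 = conv f g (u @ v)"
      using assms(1) by simp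
    also have "\<dots> = (\<Sum>i\<in>{length u}. f (take i (u @ v)) * g (drop i (u @ v)))"
      unfolding conv_eq_sum
    proof (rule sum.mono_neutral_cong_right, goal_cases)
      case 3
      show ?case
      proof
        fix i assume i: "i \<in> {..length (u @ v)} - {length u}"
        show "f (take i (u @ v)) * g (drop i (u @ v)) = 0"
        proof (cases "i < length u")
          case True
          then show ?thesis using less by simp
        next
          case False
          with i have "length (drop i (u @ v)) < length v" by auto
          then show ?thesis using v(2)[of "drop i (u @ v)"] by auto
        qed
      qed
    qed auto
    finally show ?case using v by simp
  qed
  then show ?thesis by auto
qed

lemma conv_nonzero':
  assumes "conv f g = (\<lambda>_. 0)" "f \<noteq> (\<lambda>_. 0)"
  shows "g = (\<lambda>_. 0)"
  using conv_nonzero[OF assms(1)] assms(2) by blast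

lemma conv_left_cancel:
  assumes "conv f g = conv f h" "f \<noteq> (\<lambda>_. 0)"
  shows "g = h"
proof -
  have "conv f (\<lambda>u. g u - h u) = (\<lambda>_. 0)"
    using assms(1) by (auto simp: conv_diff_right fun_eq_iff)
  from conv_nonzero'[OF this assms(2)] show ?thesis
    by (auto simp: fun_eq_iff)
qed

section \<open>Multipliers, dilations and cyclic subspaces of the Fock space\<close>

text \<open>The value is meaningful only if the convolution is square-summable. Hence the equations
  between \<open>ell2_coeff (fmul f g)\<close> and \<open>conv\<close> that appear as hypotheses
  below.\<close>

definition fmul :: "'d fock \<Rightarrow> 'd fock \<Rightarrow> 'd fock" where
  "fmul f g = Abs_ell2 (conv (ell2_coeff f) (ell2_coeff g))"

text \<open>Left multiplication by \<open>f\<close> is everywhere defined with operator norm at most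
  \<open>M\<close>; \<open>ell2_le\<close> expresses both at once, before the product is known to
  lie in the space.\<close>

definition multiplier :: "real \<Rightarrow> 'd fock \<Rightarrow> bool" where
  "multiplier M f \<longleftrightarrow> (\<forall>g. ell2_le (M * norm g) (conv (ell2_coeff f) (ell2_coeff g)))"

lemma ell2_coeff_fmul:
  "ell2_le C (conv (ell2_coeff f) (ell2_coeff g)) \<Longrightarrow>
   ell2_coeff (fmul f g) = conv (ell2_coeff f) (ell2_coeff g)"
  unfolding fmul_def by (rule ell2_le_Abs)

lemma fmul_eqI: "ell2_coeff h = conv (ell2_coeff f) (ell2_coeff g) \<Longrightarrow> fmul f g = h"
  unfolding fmul_def by (drule sym) (simp add: ell2_coeff_inverse)

lemma multiplierD:
  assumes "multiplier M f"
  shows "ell2_coeff (fmul f g) = conv (ell2_coeff f) (ell2_coeff g)" "norm (fmul f g) \<le> M * norm g"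
  unfolding fmul_def using assms[unfolded multiplier_def, THEN spec[of _ g]] by (rule ell2_le_Abs)+

lemma multiplier_nonneg:
  fixes f :: "'d fock"
  assumes "multiplier M f"
  shows "0 \<le> M"
  using order_trans[OF norm_ge_zero multiplierD(2)[OF assms, of "ket []"]] by simp

lemma multiplierI:
  assumes "\<And>g. ell2_coeff (h g) = conv (ell2_coeff f) (ell2_coeff g)"
    and "\<And>g. norm (h g) \<le> M * norm g"
  shows "multiplier M f"
  unfolding multiplier_def using assms by (metis ell2_le_coeff)

lemma ell2_le_mono: "ell2_le C x \<Longrightarrow> C \<le> C' \<Longrightarrow> ell2_le C' x"
  unfolding ell2_le_def by (meson order_trans power_mono)

lemma multiplier_mono: "multiplier M f \<Longrightarrow> M \<le> M' \<Longrightarrow> multiplier M' f"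
  unfolding multiplier_def by (meson ell2_le_mono mult_right_mono norm_ge_zero)

lemma ell2_ne_zeroD: "x \<noteq> 0 \<Longrightarrow> ell2_coeff x \<noteq> (\<lambda>_. 0)"
  by (metis ell2_eqI zero_ell2.rep_eq)

text \<open>The product lives on words ending in \<open>w\<close>, and deleting this ending is
  injective. So translates by words make sense for every H^2 element, multiplier or not.\<close>

lemma ell2_le_fmul_ket: "ell2_le (norm f) (conv (ell2_coeff f) (ell2_coeff (ket w)))"
  unfolding ell2_le_def
proof (intro conjI allI impI)
  fix A :: "'a list set" assume A: "finite A"
  define B where "B = (\<lambda>u. u @ w) -` A"
  have inj: "inj_on (\<lambda>u. u @ w) B"
    by (auto intro: inj_onI)
  have B: "finite B"
    unfolding B_def by (rule finite_vimageI[OF A]) (auto intro: injI)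
  have "(\<Sum>v\<in>A. (cmod (conv (ell2_coeff f) (ell2_coeff (ket w)) v))\<^sup>2) =
        (\<Sum>v\<in>(\<lambda>u. u @ w) ` B. (cmod (conv (ell2_coeff f) (ell2_coeff (ket w)) v))\<^sup>2)"
  proof (rule sum.mono_neutral_right, goal_cases)
    case 3
    show ?case
    proof
      fix v assume "v \<in> A - (\<lambda>u. u @ w) ` B"
      then have "v \<noteq> u @ w" for u by (auto simp: B_def)
      then show "(cmod (conv (ell2_coeff f) (ell2_coeff (ket w)) v))\<^sup>2 = 0"
        by (simp add: conv_ket_not_suffix)
    qed
  qed (use A in \<open>auto simp: B_def\<close>)
  also have "\<dots> = (\<Sum>u\<in>B. (cmod (ell2_coeff f u))\<^sup>2)"
    by (simp add: sum.reindex[OF inj])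
  also have "\<dots> \<le> (norm f)\<^sup>2"
    by (rule sum_coeff_le_norm[OF B])
  finally show "(\<Sum>v\<in>A. (cmod (conv (ell2_coeff f) (ell2_coeff (ket w)) v))\<^sup>2) \<le> (norm f)\<^sup>2" .
qed simp

lemma ell2_coeff_fmul_ket: "ell2_coeff (fmul f (ket w)) = conv (ell2_coeff f) (ell2_coeff (ket w))"
  by (rule ell2_coeff_fmul[OF ell2_le_fmul_ket])

lemma ell2_coeff_fmul_ket_append [simp]: "ell2_coeff (fmul f (ket w)) (u @ w) = ell2_coeff f u"
  by (simp add: ell2_coeff_fmul_ket)

lemma cinner_fmul_ket [simp]: "cinner (fmul f (ket w)) (fmul g (ket w)) = cinner f g"
  by (rule cinner_reindex[where h = "\<lambda>u. u @ w"])
    (auto intro!: injI conv_ket_not_suffix simp: ell2_coeff_fmul_ket)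

lemma norm_fmul_ket [simp]: "norm (fmul f (ket w)) = norm f"
proof -
  have "of_real ((norm (fmul f (ket w)))\<^sup>2) = (of_real ((norm f)\<^sup>2) :: complex)"
    unfolding cinner_self[symmetric] by simp
  then show ?thesis
    using of_real_eq_iff power2_eq_iff_nonneg norm_ge_zero by blast
qed

lemma bounded_linear_fmul_ket: "bounded_linear (\<lambda>f. fmul f (ket w))"
  by (rule bounded_linear_intro[where K = 1])
    (auto intro!: ell2_eqI simp: ell2_coeff_fmul_ket conv_add_left conv_cmult_left plus_ell2.rep_eq
      scaleR_ell2.rep_eq)

lemma fmul_ket_scaleC: "fmul (c *\<^sub>C f) (ket w) = c *\<^sub>C fmul f (ket w)"
  by (rule ell2_eqI) (simp add: ell2_coeff_fmul_ket conv_cmult_left scaleC.rep_eq)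

lemma fmul_ket_ket: "fmul (ket u) (ket w) = ket (u @ w)"
proof (rule ell2_eqI)
  fix v
  show "ell2_coeff (fmul (ket u) (ket w)) v = ell2_coeff (ket (u @ w)) v"
  proof (cases "\<exists>x. v = x @ w")
    case False
    then show ?thesis by (auto simp: ell2_coeff_fmul_ket conv_ket_not_suffix)
  next
    case True
    then obtain x where "v = x @ w" by blast
    then show ?thesis by simp
  qed
qed

lemma fmul_ket_assoc: "fmul (fmul f (ket u)) (ket w) = fmul f (ket (u @ w))"
proof (rule fmul_eqI[symmetric])
  have "ell2_coeff (ket (u @ w)) = conv (ell2_coeff (ket u)) (ell2_coeff (ket w))"
    by (simp only: fmul_ket_ket[symmetric] ell2_coeff_fmul_ket)
  then show "ell2_coeff (fmul (fmul f (ket u)) (ket w)) = conv (ell2_coeff f) (ell2_coeff (ket (u @ w)))"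
    by (simp only: ell2_coeff_fmul_ket conv_assoc)
qed

lemma fmul_ket_Nil [simp]: "fmul f (ket []) = f"
  by (rule ell2_eqI) (simp add: ell2_coeff_fmul_ket conv_one_right)

lemma fmul_one_left [simp]: "fmul (ket []) f = f"
  by (rule fmul_eqI) (simp add: conv_one_left)

section \<open>Polynomials and operators of left multiplication\<close>

definition poly :: "'d fock \<Rightarrow> bool" where
  "poly p \<longleftrightarrow> finite {w. ell2_coeff p w \<noteq> 0}"

lemma poly_sum_ket: "finite A \<Longrightarrow> poly (\<Sum>w\<in>A. c w *\<^sub>C ket w)"
  unfolding poly_def by (rule finite_subset[of _ A]) (auto intro: sum.neutral)

lemma poly_ket [simp]: "poly (ket w)"
  by (simp add: poly_def)

lemma poly_eq: "poly p \<Longrightarrow> p = (\<Sum>w | ell2_coeff p w \<noteq> 0. ell2_coeff p w *\<^sub>C ket w)"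
  unfolding poly_def by (rule ell2_eqI) (simp add: if_distrib cong: if_cong)

lemma conv_sum_ket:
  "conv f (ell2_coeff (\<Sum>w\<in>A. c w *\<^sub>C ket w)) v = (\<Sum>w\<in>A. c w * conv f (ell2_coeff (ket w)) v)"
  by (induction A rule: infinite_finite_induct)
    (simp_all add: conv_add_right conv_cmult_right zero_ell2.rep_eq plus_ell2.rep_eq scaleC.rep_eq
      del: ell2_coeff_sum ell2_coeff_ket)

lemma fmul_poly:
  assumes "finite A"
  shows "ell2_coeff (fmul f (\<Sum>w\<in>A. c w *\<^sub>C ket w)) = conv (ell2_coeff f) (ell2_coeff (\<Sum>w\<in>A. c w *\<^sub>C ket w))"
    "fmul f (\<Sum>w\<in>A. c w *\<^sub>C ket w) = (\<Sum>w\<in>A. c w *\<^sub>C fmul f (ket w))"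
proof -
  have *: "ell2_coeff (\<Sum>w\<in>A. c w *\<^sub>C fmul f (ket w)) = conv (ell2_coeff f) (ell2_coeff (\<Sum>w\<in>A. c w *\<^sub>C ket w))"
    by (rule ext) (simp add: conv_sum_ket ell2_coeff_fmul_ket del: ell2_coeff_ket)
  then show "fmul f (\<Sum>w\<in>A. c w *\<^sub>C ket w) = (\<Sum>w\<in>A. c w *\<^sub>C fmul f (ket w))"
    by (rule fmul_eqI)
  with * show "ell2_coeff (fmul f (\<Sum>w\<in>A. c w *\<^sub>C ket w)) = conv (ell2_coeff f) (ell2_coeff (\<Sum>w\<in>A. c w *\<^sub>C ket w))"
    by simp
qed

lemma ell2_coeff_fmul_poly: "poly p \<Longrightarrow> ell2_coeff (fmul f p) = conv (ell2_coeff f) (ell2_coeff p)"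
  using fmul_poly(1)[of "{w. ell2_coeff p w \<noteq> 0}" f "ell2_coeff p"] poly_eq[of p]
  by (simp add: poly_def)


text \<open>Every coefficient of a product involves only finitely many coefficients of either factor,
  so multiplier bounds need only be tested on polynomials.\<close>

lemma multiplierI_poly:
  assumes M: "0 \<le> M" and le: "\<And>p. poly p \<Longrightarrow> norm (fmul f p) \<le> M * norm p"
  shows "multiplier M f"
  unfolding multiplier_def
proof
  fix g
  show "ell2_le (M * norm g) (conv (ell2_coeff f) (ell2_coeff g))"
    unfolding ell2_le_def
  proof (intro conjI allI impI)
    fix A :: "'a list set" assume A: "finite A"
    define S where "S = (\<Union>v\<in>A. (\<lambda>i. drop i v) ` {..length v})"
    have S: "finite S"
      using A by (auto simp: S_def)
    define p where "p = (\<Sum>w\<in>S. ell2_coeff g w *\<^sub>C ket w)"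
    have pc: "ell2_coeff p w = (if w \<in> S then ell2_coeff g w else 0)" for w
      using S by (simp add: p_def if_distrib cong: if_cong)
    have "(norm p)\<^sup>2 \<le> (norm g)\<^sup>2"
      unfolding p_def norm_sum_ket[OF S] by (rule sum_coeff_le_norm[OF S])
    then have pg: "norm p \<le> norm g"
      by (rule power2_le_imp_le) simp
    have "poly p"
      unfolding p_def by (rule poly_sum_ket[OF S])
    have "conv (ell2_coeff f) (ell2_coeff g) v = ell2_coeff (fmul f p) v" if "v \<in> A" for v
      unfolding ell2_coeff_fmul_poly[OF \<open>poly p\<close>] conv_eq_sum
      by (rule sum.cong) (use that in \<open>auto simp: pc S_def\<close>)
    then have "(\<Sum>v\<in>A. (cmod (conv (ell2_coeff f) (ell2_coeff g) v))\<^sup>2) =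
               (\<Sum>v\<in>A. (cmod (ell2_coeff (fmul f p) v))\<^sup>2)"
      by simp
    also have "\<dots> \<le> (norm (fmul f p))\<^sup>2"
      by (rule sum_coeff_le_norm[OF A])
    also have "\<dots> \<le> (M * norm g)\<^sup>2"
      using le[OF \<open>poly p\<close>] mult_left_mono[OF pg M] by (intro power_mono) auto
    finally show "(\<Sum>v\<in>A. (cmod (conv (ell2_coeff f) (ell2_coeff g) v))\<^sup>2) \<le> (M * norm g)\<^sup>2" .
  qed (use M in simp)
qed

lemma multiplier_lim:
  assumes "\<And>n. multiplier M (f n)" "\<And>w. (\<lambda>n. ell2_coeff (f n) w) \<longlonglongrightarrow> ell2_coeff g w"
  shows "multiplier M g"
  unfolding multiplier_def
proof
  fix h
  show "ell2_le (M * norm h) (conv (ell2_coeff g) (ell2_coeff h))"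
  proof (rule ell2_le_lim)
    show "ell2_le (M * norm h) (conv (ell2_coeff (f n)) (ell2_coeff h))" for n
      using assms(1) by (simp add: multiplier_def)
    show "(\<lambda>n. conv (ell2_coeff (f n)) (ell2_coeff h) w) \<longlonglongrightarrow> conv (ell2_coeff g) (ell2_coeff h) w" for w
      unfolding conv_eq_sum by (intro tendsto_intros assms(2))
  qed auto
qed

lemma bounded_linear_fmul:
  assumes "multiplier M f"
  shows "bounded_linear (fmul f)"
  by (rule bounded_linear_intro[where K = M])
    (use multiplierD(2)[OF assms] in
      \<open>auto intro!: ell2_eqI simp: multiplierD(1)[OF assms] conv_add_right conv_cmult_right
        plus_ell2.rep_eq scaleR_ell2.rep_eq mult.commute\<close>)

lemma fmul_scaleC_right:
  assumes "multiplier M f"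
  shows "fmul f (c *\<^sub>C g) = c *\<^sub>C fmul f g"
  by (rule ell2_eqI) (simp add: multiplierD(1)[OF assms] conv_cmult_right scaleC.rep_eq)

text \<open>Associativity comes from \<open>conv_assoc\<close>; the two equations only certify that
  the intermediate products are genuine. In the main application \<open>g\<close> is any H^2 element
  and \<open>h\<close> a polynomial.\<close>

lemma fmul_assoc:
  assumes f: "multiplier M f" and g: "ell2_coeff (fmul g h) = conv (ell2_coeff g) (ell2_coeff h)"
    and fg: "ell2_coeff (fmul f g) = conv (ell2_coeff f) (ell2_coeff g)"
  shows "fmul (fmul f g) h = fmul f (fmul g h)"
  by (rule fmul_eqI) (simp add: multiplierD(1)[OF f] fg g conv_assoc)

lemma fmul_assoc_poly:
  assumes "multiplier M f" "poly p"
  shows "fmul (fmul f g) p = fmul f (fmul g p)"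
  using assms by (intro fmul_assoc) (auto simp: multiplierD ell2_coeff_fmul_poly)

lemma fmul_left_cancel:
  assumes "multiplier M f" "f \<noteq> 0" "fmul f g = fmul f h"
  shows "g = h"
proof -
  have "conv (ell2_coeff f) (ell2_coeff g) = conv (ell2_coeff f) (ell2_coeff h)"
    using assms(3) multiplierD(1)[OF assms(1)] by metis
  from conv_left_cancel[OF this ell2_ne_zeroD[OF assms(2)]] show ?thesis
    by (simp add: ell2_coeff_inject)
qed

text \<open>The coefficients of f(rZ). For r < 1 the result is a multiplier even when
  \<open>f\<close> is not, by \<open>multiplier_dilate\<close>.\<close>

definition dilate :: "real \<Rightarrow> 'd fock \<Rightarrow> 'd fock" where
  "dilate r f = Abs_ell2 (\<lambda>w. of_real (r ^ length w) * ell2_coeff f w)"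

lemma ell2_le_dilate:
  assumes "0 \<le> r" "r \<le> 1"
  shows "ell2_le (norm f) (\<lambda>w. of_real (r ^ length w) * ell2_coeff f w)"
  unfolding ell2_le_def
proof (intro conjI allI impI)
  fix A :: "'a list set" assume A: "finite A"
  have "(\<Sum>w\<in>A. (cmod (of_real (r ^ length w) * ell2_coeff f w))\<^sup>2) \<le> (\<Sum>w\<in>A. (cmod (ell2_coeff f w))\<^sup>2)"
  proof (intro sum_mono power_mono)
    fix w :: "'a list"
    have "r ^ length w \<le> 1"
      using assms by (intro power_le_one)
    then show "cmod (of_real (r ^ length w) * ell2_coeff f w) \<le> cmod (ell2_coeff f w)"
      using assms by (simp add: norm_mult norm_power mult_left_le_one_le)
  qed auto
  also have "\<dots> \<le> (norm f)\<^sup>2"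
    by (rule sum_coeff_le_norm[OF A])
  finally show "(\<Sum>w\<in>A. (cmod (of_real (r ^ length w) * ell2_coeff f w))\<^sup>2) \<le> (norm f)\<^sup>2" .
qed simp

context
  fixes r :: real assumes r: "0 \<le> r" "r \<le> 1"
begin

lemma ell2_coeff_dilate: "ell2_coeff (dilate r f) w = of_real (r ^ length w) * ell2_coeff f w"
  unfolding dilate_def ell2_le_Abs(1)[OF ell2_le_dilate[OF r]] ..

lemma norm_dilate_le: "norm (dilate r f) \<le> norm f"
  unfolding dilate_def by (rule ell2_le_Abs(2)[OF ell2_le_dilate[OF r]])

lemma bounded_linear_dilate: "bounded_linear (dilate r)"
  by (rule bounded_linear_intro[where K = 1])
    (auto intro!: ell2_eqI simp: ell2_coeff_dilate algebra_simps norm_dilate_le)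

lemma dilate_scaleC: "dilate r (c *\<^sub>C f) = c *\<^sub>C dilate r f"
  by (rule ell2_eqI) (simp add: ell2_coeff_dilate)

text \<open>Lengths add up along every splitting of a word, so dilation is multiplicative.\<close>

lemma conv_dilate:
  "conv (ell2_coeff (dilate r f)) (ell2_coeff (dilate r g)) v =
   of_real (r ^ length v) * conv (ell2_coeff f) (ell2_coeff g) v"
  unfolding conv_eq_sum sum_distrib_left
proof (rule sum.cong)
  fix i assume "i \<in> {..length v}"
  then have "r ^ length v = r ^ length (take i v) * r ^ length (drop i v)"
    by (simp flip: power_add)
  then show "ell2_coeff (dilate r f) (take i v) * ell2_coeff (dilate r g) (drop i v) =
      of_real (r ^ length v) * (ell2_coeff f (take i v) * ell2_coeff g (drop i v))"
    by (simp only: ell2_coeff_dilate of_real_mult mult_ac)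
qed auto

lemma conv_dilate_fmul:
  assumes "ell2_coeff (fmul f g) = conv (ell2_coeff f) (ell2_coeff g)"
  shows "ell2_coeff (dilate r (fmul f g)) = conv (ell2_coeff (dilate r f)) (ell2_coeff (dilate r g))"
  by (rule ext) (simp add: conv_dilate ell2_coeff_dilate assms)

lemma dilate_ket: "dilate r (ket w) = of_real (r ^ length w) *\<^sub>C ket w"
  by (rule ell2_eqI) (simp add: ell2_coeff_dilate)

lemma dilate_fmul_ket: "dilate r (fmul f (ket w)) = of_real (r ^ length w) *\<^sub>C fmul (dilate r f) (ket w)"
proof (rule ell2_eqI)
  fix v
  show "ell2_coeff (dilate r (fmul f (ket w))) v = ell2_coeff (of_real (r ^ length w) *\<^sub>C fmul (dilate r f) (ket w)) v"
    unfolding conv_dilate_fmul[OF ell2_coeff_fmul_ket] dilate_ket scaleC.rep_eq conv_cmult_right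
    by (simp add: ell2_coeff_fmul_ket del: ell2_coeff_ket)
qed

lemma dilate_nonzero:
  assumes "r \<noteq> 0" "f \<noteq> 0"
  shows "dilate r f \<noteq> 0"
proof
  assume "dilate r f = 0"
  then have "ell2_coeff f w = 0" for w
    using ell2_coeff_dilate[of f w] assms(1) by (simp add: zero_ell2.rep_eq)
  then show False
    using assms(2) ell2_ne_zeroD by blast
qed

end

lemma dilate_dilate:
  "0 \<le> r \<Longrightarrow> r \<le> 1 \<Longrightarrow> 0 \<le> s \<Longrightarrow> s \<le> 1 \<Longrightarrow> dilate r (dilate s f) = dilate (r * s) f"
  by (rule ell2_eqI) (simp add: ell2_coeff_dilate mult_le_one power_mult_distrib)


section \<open>Cyclic subspaces of the right shifts\<close>

definition cyc :: "'d fock \<Rightarrow> 'd fock set" where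
  "cyc f = closed_cspan (range (\<lambda>w. fmul f (ket w)))"

lemma closed_csubspace_cyc: "closed_csubspace (cyc f)"
  unfolding cyc_def by (rule closed_csubspace_closed_cspan)

lemma cyc_least: "closed_csubspace M \<Longrightarrow> (\<And>w. fmul f (ket w) \<in> M) \<Longrightarrow> cyc f \<subseteq> M"
  unfolding cyc_def by (rule closed_cspan_least) auto

lemma fmul_ket_in_cyc: "fmul f (ket w) \<in> cyc f"
  unfolding cyc_def by (rule closed_cspan_base) simp

lemma self_in_cyc: "f \<in> cyc f"
  using fmul_ket_in_cyc[of f "[]"] by simp

text \<open>Left multiplication by \<open>f\<close> is continuous, so \<open>g\<close> may be
  expanded into words; every partial sum of the product is a combination of translates of
  \<open>f\<close>.\<close>

lemma fmul_in_closed_csubspace: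
  assumes M: "closed_csubspace M" and f: "\<And>w. fmul f (ket w) \<in> M" and mult: "multiplier C f"
  shows "fmul f g \<in> M"
proof -
  have "((\<lambda>w. fmul f (ell2_coeff g w *\<^sub>C ket w)) has_sum fmul f g) UNIV"
    by (intro has_sum_bounded_linear[OF bounded_linear_fmul[OF mult]] has_sum_ket)
  then have *: "(sum (\<lambda>w. ell2_coeff g w *\<^sub>C fmul f (ket w)) \<longlongrightarrow> fmul f g) (finite_subsets_at_top UNIV)"
    by (simp add: has_sum_def fmul_scaleC_right[OF mult])
  have "sum (\<lambda>w. ell2_coeff g w *\<^sub>C fmul f (ket w)) F \<in> M" if "finite F" for F
    using that by (induction F rule: finite_induct) (auto intro: closed_csubspaceD[OF M] f)
  then have "\<forall>\<^sub>F F in finite_subsets_at_top UNIV. sum (\<lambda>w. ell2_coeff g w *\<^sub>C fmul f (ket w)) F \<in> M"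
    by (intro eventually_finite_subsets_at_top_weakI)
  then show ?thesis
    using Lim_in_closed_set[OF closed_csubspaceD(1)[OF M] _ _ *] by simp
qed

lemma fmul_in_cyc: "multiplier C f \<Longrightarrow> fmul f g \<in> cyc f"
  by (rule fmul_in_closed_csubspace[OF closed_csubspace_cyc fmul_ket_in_cyc])

lemma cyc_ket_Nil: "cyc (ket []) = UNIV"
proof -
  have "multiplier 1 (ket [] :: 'a fock)"
    by (rule multiplierI[where h = "\<lambda>g. g"]) (auto simp: conv_one_left)
  from fmul_in_cyc[OF this] show ?thesis
    by auto
qed

text \<open>Combinations of the translates of \<open>f\<close> are exactly products of
  \<open>f\<close> with polynomials. Together with \<open>in_cycI\<close> this is the form in which
  cyclicity is used.\<close>

lemma cyc_approx:
  assumes "x \<in> cyc f" "0 < e"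
  obtains p where "poly p" "norm (fmul f p - x) < e"
proof -
  let ?G = "{c *\<^sub>C g | c g. g \<in> range (\<lambda>w. fmul f (ket w))}"
  have "\<exists>p. poly p \<and> y = fmul f p" if "y \<in> span ?G" for y
    using that
  proof (induction rule: span_induct_alt)
    case base
    have "fmul f 0 = 0"
      by (rule fmul_eqI) (auto simp: zero_ell2.rep_eq)
    then show ?case
      by (intro exI[of _ 0]) (auto simp: poly_def zero_ell2.rep_eq)
  next
    case (step r g y)
    then obtain c w p where g: "g = c *\<^sub>C fmul f (ket w)" and p: "poly p" "y = fmul f p"
      by blast
    define q where "q = (of_real r * c) *\<^sub>C ket w + p"
    have "fmul f q = r *\<^sub>R g + y"
      by (rule fmul_eqI, rule ext)
        (simp add: q_def g p ell2_coeff_fmul_poly ell2_coeff_fmul_ket conv_add_right conv_cmult_right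
          plus_ell2.rep_eq scaleR_ell2.rep_eq scaleC.rep_eq del: ell2_coeff_ket)
    moreover have "{v. ell2_coeff q v \<noteq> 0} \<subseteq> insert w {v. ell2_coeff p v \<noteq> 0}"
      by (auto simp: q_def)
    then have "poly q"
      using p(1) unfolding poly_def by (meson finite_insert finite_subset)
    ultimately show ?case by metis
  qed
  moreover obtain y where "y \<in> span ?G" "dist y x < e"
    using assms(1)[unfolded cyc_def closed_cspan_def closure_approachable, rule_format, OF assms(2)]
    by (elim bexE)
  ultimately show ?thesis
    using that by (auto simp: dist_norm)
qed

lemma dilate_in_cyc:
  assumes g: "g \<in> cyc f" and r: "0 \<le> r" "r \<le> 1"
  shows "dilate r g \<in> cyc (dilate r f)"
proof -
  have "cyc f \<subseteq> dilate r -` cyc (dilate r f)"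
    by (intro cyc_least closed_csubspace_vimage closed_csubspace_cyc bounded_linear_dilate dilate_scaleC r)
      (simp add: dilate_fmul_ket[OF r] closed_csubspaceD(4)[OF closed_csubspace_cyc] fmul_ket_in_cyc)
  with g show ?thesis by auto
qed

section \<open>Evaluation on the row ball\<close>

lemma norm_truncate_le: "norm (truncate n x) \<le> norm x"
proof (rule power2_le_imp_le)
  show "(norm (truncate n x))\<^sup>2 \<le> (norm x)\<^sup>2"
    unfolding norm_ell2_sq by (intro infsum_mono summable_ell2) simp
qed simp

lemma scaleC_op_add_left: "(a + b) *\<^sub>O T = a *\<^sub>O T + b *\<^sub>O T"
  and scaleC_op_scaleC_op [simp]: "a *\<^sub>O b *\<^sub>O T = (a * b) *\<^sub>O T"
  and scaleC_op_one [simp]: "1 *\<^sub>O T = T"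
  and scaleC_op_zero_left [simp]: "0 *\<^sub>O T = 0"
  and scaleC_op_compose_left [simp]: "(a *\<^sub>O S) o\<^sub>L T = a *\<^sub>O (S o\<^sub>L T)"
  by (auto intro!: blinfun_eqI simp: scaleC_add_left plus_blinfun.rep_eq)

lemma blinfun_compose_assoc': "(R o\<^sub>L S) o\<^sub>L T = R o\<^sub>L (S o\<^sub>L T)"
  by (rule blinfun_eqI) simp

lemma norm_scaleC_op_le: "norm (c *\<^sub>O T) \<le> cmod c * norm T"
proof (rule norm_blinfun_bound)
  show "norm (blinfun_apply (c *\<^sub>O T) x) \<le> cmod c * norm T * norm x" for x
    using mult_left_mono[OF norm_blinfun[of T x] norm_ge_zero[of c]] by (simp add: norm_scaleC mult.assoc)
qed simp

lemma bounded_linear_scaleC_op: "bounded_linear ((*\<^sub>O) c)"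
  by (rule bounded_linear_intro[where K = "cmod c"])
    (auto intro!: blinfun_eqI norm_scaleC_op_le[THEN order_trans]
      simp: plus_blinfun.rep_eq scaleR_blinfun.rep_eq scaleR_scaleC mult.commute)

lemma mat_spaceD:
  assumes "T \<in> mat_space n"
  shows "blinfun_apply T (c *\<^sub>C x) = c *\<^sub>C blinfun_apply T x"
    "blinfun_apply T (truncate n x) = blinfun_apply T x"
    "truncate n (blinfun_apply T x) = blinfun_apply T x"
    "blinfun_apply T x \<in> vec_space n"
    "unit_op n o\<^sub>L T = T" "T o\<^sub>L unit_op n = T"
proof -
  show "blinfun_apply T (c *\<^sub>C x) = c *\<^sub>C blinfun_apply T x"
    using assms by (simp add: mat_space_def)
  have eq: "truncate n (blinfun_apply T (truncate n x)) = blinfun_apply T x" for x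
  proof -
    have "unit_op n o\<^sub>L T o\<^sub>L unit_op n = T"
      using assms by (simp add: mat_space_def)
    then have "blinfun_apply (unit_op n o\<^sub>L T o\<^sub>L unit_op n) x = blinfun_apply T x"
      by simp
    then show ?thesis by simp
  qed
  show r: "blinfun_apply T (truncate n x) = blinfun_apply T x" for x
    using eq[of x] eq[of "truncate n x"] by simp
  show l: "truncate n (blinfun_apply T x) = blinfun_apply T x" for x
    using eq[of x] by (simp add: r)
  show "blinfun_apply T x \<in> vec_space n"
    by (subst l[symmetric]) simp
  show "unit_op n o\<^sub>L T = T" "T o\<^sub>L unit_op n = T"
    by (auto intro!: blinfun_eqI simp: l r)
qed

lemma mat_spaceI:
  assumes "\<And>c x. blinfun_apply T (c *\<^sub>C x) = c *\<^sub>C blinfun_apply T x"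
    "\<And>x. truncate n (blinfun_apply T (truncate n x)) = blinfun_apply T x"
  shows "T \<in> mat_space n"
  using assms by (auto simp: mat_space_def intro!: blinfun_eqI)

lemma unit_op_mat_space [simp]: "unit_op n \<in> mat_space n"
  by (rule mat_spaceI) auto

lemma compose_mat_space: "S \<in> mat_space n \<Longrightarrow> T \<in> mat_space n \<Longrightarrow> S o\<^sub>L T \<in> mat_space n"
  by (rule mat_spaceI) (simp_all add: mat_spaceD)

lemma scaleC_op_mat_space: "T \<in> mat_space n \<Longrightarrow> c *\<^sub>O T \<in> mat_space n"
  by (rule mat_spaceI) (simp_all add: mat_spaceD mult.commute)

lemma scaleC_op_compose_right: "S \<in> mat_space n \<Longrightarrow> S o\<^sub>L (a *\<^sub>O T) = a *\<^sub>O (S o\<^sub>L T)"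
  by (rule blinfun_eqI) (simp add: mat_spaceD)

lemma vec_space_zero [simp]: "0 \<in> vec_space n"
  and vec_space_scaleC: "x \<in> vec_space n \<Longrightarrow> c *\<^sub>C x \<in> vec_space n"
  and vec_space_sum: "(\<And>i. i \<in> A \<Longrightarrow> f i \<in> vec_space n) \<Longrightarrow> sum f A \<in> vec_space n"
  by (simp_all add: vec_space_def)

text \<open>The row norm tested on finite families, with the constant made explicit. The next two
  lemmas identify the points having such a constant below 1 with \<open>row_ball\<close>.\<close>

definition row_bound :: "enat \<Rightarrow> real \<Rightarrow> ('d \<Rightarrow> operator) \<Rightarrow> bool" where
  "row_bound n r Z \<longleftrightarrow> 0 \<le> r \<and> (\<forall>k. Z k \<in> mat_space n) \<and>
     (\<forall>K x. finite K \<and> (\<forall>k\<in>K. x k \<in> vec_space n) \<longrightarrow>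
        (norm (\<Sum>k\<in>K. (Z k) (x k)))\<^sup>2 \<le> r\<^sup>2 * (\<Sum>k\<in>K. (norm (x k))\<^sup>2))"

lemma row_boundD:
  assumes "row_bound n r Z" "finite K" "\<And>k. k \<in> K \<Longrightarrow> x k \<in> vec_space n"
  shows "(norm (\<Sum>k\<in>K. (Z k) (x k)))\<^sup>2 \<le> r\<^sup>2 * (\<Sum>k\<in>K. (norm (x k))\<^sup>2)"
  using assms unfolding row_bound_def by blast

lemma row_bound_imp_row_ball:
  fixes Z :: "'d::countable \<Rightarrow> operator"
  assumes Z: "row_bound n r Z" and r: "r < 1"
  shows "Z \<in> row_ball n"
proof -
  have r0: "0 \<le> r"
    using Z by (simp add: row_bound_def)
  have "(\<lambda>k. (Z k) (x k)) summable_on UNIV \<and>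
      norm (\<Sum>\<^sub>\<infinity>k. (Z k) (x k)) \<le> r * sqrt (\<Sum>\<^sub>\<infinity>k. (norm (x k))\<^sup>2)"
    if x: "\<forall>k. x k \<in> vec_space n" "(\<lambda>k. (norm (x k))\<^sup>2) summable_on UNIV" for x
  proof
    have bound: "(norm (\<Sum>k\<in>K. (Z k) (x k)))\<^sup>2 \<le> (\<Sum>k\<in>K. r\<^sup>2 * (norm (x k))\<^sup>2)"
      if "finite K" for K
      using row_boundD[OF Z that, of x] x(1) by (simp add: sum_distrib_left)
    have s: "(\<lambda>k. r\<^sup>2 * (norm (x k))\<^sup>2) summable_on UNIV"
      by (intro summable_on_cmult_right x)
    show "(\<lambda>k. (Z k) (x k)) summable_on UNIV"
      using summable_on_square_bound(1)[OF bound s] by simp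
    have "(norm (\<Sum>\<^sub>\<infinity>k. (Z k) (x k)))\<^sup>2 \<le> r\<^sup>2 * (\<Sum>\<^sub>\<infinity>k. (norm (x k))\<^sup>2)"
      using summable_on_square_bound(2)[OF bound s] by (simp add: infsum_cmult_right')
    also have "\<dots> = (r * sqrt (\<Sum>\<^sub>\<infinity>k. (norm (x k))\<^sup>2))\<^sup>2"
      by (simp add: power_mult_distrib infsum_nonneg)
    finally show "norm (\<Sum>\<^sub>\<infinity>k. (Z k) (x k)) \<le> r * sqrt (\<Sum>\<^sub>\<infinity>k. (norm (x k))\<^sup>2)"
      by (rule power2_le_imp_le) (simp add: r0 infsum_nonneg)
  qed
  then show ?thesis
    using Z r unfolding row_ball_def row_bound_def by blast
qed

lemma row_ball_imp_row_bound:
  fixes Z :: "'d::countable \<Rightarrow> operator"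
  assumes "Z \<in> row_ball n"
  obtains r where "r < 1" "row_bound n r Z"
proof -
  obtain r where mat: "\<And>k. Z k \<in> mat_space n" and r: "r < 1"
    and bound: "\<And>x. (\<forall>k. x k \<in> vec_space n) \<Longrightarrow> (\<lambda>k. (norm (x k))\<^sup>2) summable_on UNIV \<Longrightarrow>
      norm (\<Sum>\<^sub>\<infinity>k. (Z k) (x k)) \<le> r * sqrt (\<Sum>\<^sub>\<infinity>k. (norm (x k))\<^sup>2)"
    using assms unfolding row_ball_def by blast
  \<comment> \<open>The constant supplied by \<open>row_ball\<close> may be negative, while
    \<open>row_bound\<close> asks for a nonnegative one.\<close>
  have "(norm (\<Sum>k\<in>K. (Z k) (x k)))\<^sup>2 \<le> (max r 0)\<^sup>2 * (\<Sum>k\<in>K. (norm (x k))\<^sup>2)"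
    if K: "finite K" "\<forall>k\<in>K. x k \<in> vec_space n" for K x
  proof -
    define y where "y k = (if k \<in> K then x k else 0)" for k
    have y: "\<forall>k. y k \<in> vec_space n"
      using K(2) by (simp add: y_def)
    have hs: "((\<lambda>k. (norm (y k))\<^sup>2) has_sum (\<Sum>k\<in>K. (norm (x k))\<^sup>2)) UNIV"
      by (rule has_sum_cong_neutral[THEN iffD1, OF _ _ _ has_sum_finite[OF K(1)]]) (auto simp: y_def)
    have hs': "((\<lambda>k. (Z k) (y k)) has_sum (\<Sum>k\<in>K. (Z k) (x k))) UNIV"
      by (rule has_sum_cong_neutral[THEN iffD1, OF _ _ _ has_sum_finite[OF K(1)]]) (auto simp: y_def)
    have "norm (\<Sum>k\<in>K. (Z k) (x k)) \<le> r * sqrt (\<Sum>k\<in>K. (norm (x k))\<^sup>2)"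
      using bound[OF y has_sum_imp_summable[OF hs]] by (simp add: infsumI[OF hs] infsumI[OF hs'])
    also have "\<dots> \<le> max r 0 * sqrt (\<Sum>k\<in>K. (norm (x k))\<^sup>2)"
      by (intro mult_right_mono) (auto intro: sum_nonneg)
    finally have "(norm (\<Sum>k\<in>K. (Z k) (x k)))\<^sup>2 \<le> (max r 0 * sqrt (\<Sum>k\<in>K. (norm (x k))\<^sup>2))\<^sup>2"
      by (rule power_mono) simp
    then show ?thesis
      by (simp add: power_mult_distrib sum_nonneg)
  qed
  then have "row_bound n (max r 0) Z"
    using mat by (simp add: row_bound_def)
  with r show ?thesis
    by (intro that[of "max r 0"]) auto
qed

lemma sum_words_Cons:
  fixes F :: "'d list \<Rightarrow> 'a::comm_monoid_add"
  assumes A: "finite A"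
  shows "sum F A = (if [] \<in> A then F [] else 0) + (\<Sum>k\<in>hd ` (A - {[]}). \<Sum>u | k # u \<in> A. F (k # u))"
proof -
  have fin: "finite {u. k # u \<in> A}" for k
    using finite_vimageI[OF A, of "(#) k"] by (simp add: vimage_def inj_def)
  have "(\<Sum>k\<in>hd ` (A - {[]}). \<Sum>u | k # u \<in> A. F (k # u)) =
      (\<Sum>(k, u)\<in>Sigma (hd ` (A - {[]})) (\<lambda>k. {u. k # u \<in> A}). F (k # u))"
    using A fin by (subst sum.Sigma) auto
  also have "\<dots> = sum F (A - {[]})"
  proof (rule sum.reindex_bij_witness[of _ "\<lambda>w. (hd w, tl w)" "\<lambda>(k, u). k # u"])
    fix w assume w: "w \<in> A - {[]}"
    then have "hd w # tl w = w" by simp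
    with w show "(hd w, tl w) \<in> Sigma (hd ` (A - {[]})) (\<lambda>k. {u. k # u \<in> A})"
      by auto
  qed auto
  finally show ?thesis
    using A by (auto simp: sum.remove)
qed

lemma word_op_mat_space: "(\<And>k. Z k \<in> mat_space n) \<Longrightarrow> word_op n Z w \<in> mat_space n"
  by (induction w) (auto intro: compose_mat_space)

lemma word_op_append:
  assumes "\<And>k. Z k \<in> mat_space n"
  shows "word_op n Z (u @ v) = word_op n Z u o\<^sub>L word_op n Z v"
proof (induction u)
  case Nil
  show ?case by (simp add: mat_spaceD(5)[OF word_op_mat_space[OF assms]])
qed (simp add: blinfun_compose_assoc')

text \<open>The row formed by all words in \<open>Z\<close> is bounded by the geometric series 1/(1
  - r). Induction on the maximal length: separate the empty word, group the others by first letter,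
  and apply the row bound to the groups, on which the induction hypothesis holds with the same
  constant.\<close>

lemma row_bound_words:
  assumes Z: "row_bound n r Z" and r: "r < 1"
    and A: "finite A" and x: "\<And>w. w \<in> A \<Longrightarrow> x w \<in> vec_space n"
  shows "(norm (\<Sum>w\<in>A. (word_op n Z w) (x w)))\<^sup>2 \<le> (1 / (1 - r))\<^sup>2 * (\<Sum>w\<in>A. (norm (x w))\<^sup>2)"
proof -
  define C where "C = 1 / (1 - r)"
  have r0: "0 \<le> r" and mat: "\<And>k. Z k \<in> mat_space n"
    using Z by (auto simp: row_bound_def)
  have C: "0 < C" "C * (1 - r) = 1"
    using r by (auto simp: C_def)
  have "(norm (\<Sum>w\<in>A. (word_op n Z w) (x w)))\<^sup>2 \<le> C\<^sup>2 * (\<Sum>w\<in>A. (norm (x w))\<^sup>2)"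
    if "finite A" "\<And>w. w \<in> A \<Longrightarrow> length w < N" "\<And>w. w \<in> A \<Longrightarrow> x w \<in> vec_space n" for N A x
    using that
  proof (induction N arbitrary: A x)
    case 0
    then have "A = {}" by auto
    then show ?case by simp
  next
    case (Suc N)
    define K where "K = hd ` (A - {[]})"
    define B where "B k = {u. k # u \<in> A}" for k
    have fin: "finite K" "finite (B k)" for k
      using Suc.prems(1) finite_vimageI[OF Suc.prems(1), of "(#) k"]
      by (auto simp: K_def B_def vimage_def inj_def)
    define y where "y k = (\<Sum>u\<in>B k. (word_op n Z u) (x (k # u)))" for k
    define a where "a = (if [] \<in> A then norm (x []) else 0)"
    define s where "s = sqrt (\<Sum>k\<in>K. \<Sum>u\<in>B k. (norm (x (k # u)))\<^sup>2)"
    have s2: "s\<^sup>2 = (\<Sum>k\<in>K. \<Sum>u\<in>B k. (norm (x (k # u)))\<^sup>2)" and s0: "0 \<le> s"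
      by (auto simp: s_def intro!: sum_nonneg)
    have yk: "(norm (y k))\<^sup>2 \<le> C\<^sup>2 * (\<Sum>u\<in>B k. (norm (x (k # u)))\<^sup>2)" for k
      unfolding y_def using Suc.prems(2)[of "k # _"] Suc.prems(3)
      by (intro Suc.IH fin) (auto simp: B_def)
    have yv: "y k \<in> vec_space n" for k
      unfolding y_def by (intro vec_space_sum mat_spaceD(4)[OF word_op_mat_space[OF mat]])
    have "(norm (\<Sum>k\<in>K. (Z k) (y k)))\<^sup>2 \<le> r\<^sup>2 * (\<Sum>k\<in>K. (norm (y k))\<^sup>2)"
      by (rule row_boundD[OF Z fin(1) yv])
    also have "\<dots> \<le> r\<^sup>2 * (\<Sum>k\<in>K. C\<^sup>2 * (\<Sum>u\<in>B k. (norm (x (k # u)))\<^sup>2))"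
      by (intro mult_left_mono sum_mono yk) auto
    also have "\<dots> = (r * C * s)\<^sup>2"
      by (simp add: power_mult_distrib s2 sum_distrib_left mult.assoc)
    finally have step: "norm (\<Sum>k\<in>K. (Z k) (y k)) \<le> r * C * s"
      by (rule power2_le_imp_le) (use r0 C(1) s0 in simp)
    have "(\<Sum>w\<in>A. (word_op n Z w) (x w)) =
        (if [] \<in> A then truncate n (x []) else 0) + (\<Sum>k\<in>K. \<Sum>u\<in>B k. (word_op n Z (k # u)) (x (k # u)))"
      unfolding K_def B_def by (subst sum_words_Cons[OF Suc.prems(1)]) simp
    also have "\<dots> = (if [] \<in> A then x [] else 0) + (\<Sum>k\<in>K. (Z k) (y k))"
      using Suc.prems(3)[of "[]"] by (simp add: y_def blinfun.sum_right)
    finally have "norm (\<Sum>w\<in>A. (word_op n Z w) (x w)) \<le> a + r * C * s"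
      using norm_triangle_ineq[of "if [] \<in> A then x [] else 0" "\<Sum>k\<in>K. (Z k) (y k)"] step
      by (simp add: a_def split: if_splits)
    \<comment> \<open>Since \<open>C * (1 - r) = 1\<close>, the bound is \<open>C\<close> times a
      convex combination of \<open>a\<close> and \<open>s\<close>, both at most the square root of
      the sum of their squares; this is what makes the induction close.\<close>
    also have "a + r * C * s = C * (1 - r) * a + C * (r * s)"
      unfolding C(2) by simp
    also have "\<dots> = C * ((1 - r) * a + r * s)"
      by (simp only: distrib_left mult.assoc)
    finally have "norm (\<Sum>w\<in>A. (word_op n Z w) (x w)) \<le> C * ((1 - r) * a + r * s)" .
    moreover have "(1 - r) * a + r * s \<le> sqrt (a\<^sup>2 + s\<^sup>2)"
    proof -
      have "a \<le> sqrt (a\<^sup>2 + s\<^sup>2)" "s \<le> sqrt (a\<^sup>2 + s\<^sup>2)"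
        by (auto intro!: real_le_rsqrt)
      then have "(1 - r) * a + r * s \<le> (1 - r) * sqrt (a\<^sup>2 + s\<^sup>2) + r * sqrt (a\<^sup>2 + s\<^sup>2)"
        using r r0 by (intro add_mono mult_left_mono) auto
      then show ?thesis by (simp add: algebra_simps)
    qed
    ultimately have "norm (\<Sum>w\<in>A. (word_op n Z w) (x w)) \<le> C * sqrt (a\<^sup>2 + s\<^sup>2)"
      using C(1) by (meson mult_left_mono less_imp_le order_trans)
    then have "(norm (\<Sum>w\<in>A. (word_op n Z w) (x w)))\<^sup>2 \<le> (C * sqrt (a\<^sup>2 + s\<^sup>2))\<^sup>2"
      by (rule power_mono) simp
    also have "\<dots> = C\<^sup>2 * (\<Sum>w\<in>A. (norm (x w))\<^sup>2)"
      unfolding power_mult_distrib sum_words_Cons[OF Suc.prems(1)] s2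
      by (simp add: a_def K_def B_def sum_nonneg)
    finally show ?case .
  qed
  moreover have "length w < Suc (Max (length ` A))" if "w \<in> A" for w
    using A that by (simp add: le_imp_less_Suc)
  ultimately show ?thesis
    using A x unfolding C_def by blast
qed

section \<open>Evaluation as an unconditional sum over all words\<close>

definition nc_sum :: "enat \<Rightarrow> 'd fock \<Rightarrow> ('d \<Rightarrow> operator) \<Rightarrow> operator" where
  "nc_sum n f Z = (\<Sum>\<^sub>\<infinity>w. ell2_coeff f w *\<^sub>O word_op n Z w)"

context
  fixes n :: enat and r :: real and Z :: "'d \<Rightarrow> operator"
  assumes Z: "row_bound n r Z" and r: "r < 1"
begin

lemma row_bound_mat: "Z k \<in> mat_space n"
  using Z by (simp add: row_bound_def)

lemma nc_sum_bound:
  assumes A: "finite A"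
  shows "(norm (\<Sum>w\<in>A. c w *\<^sub>O word_op n Z w))\<^sup>2 \<le> (\<Sum>w\<in>A. (1 / (1 - r))\<^sup>2 * (cmod (c w))\<^sup>2)"
proof -
  let ?S = "sqrt (\<Sum>w\<in>A. (1 / (1 - r))\<^sup>2 * (cmod (c w))\<^sup>2)"
  have "norm (\<Sum>w\<in>A. c w *\<^sub>O word_op n Z w) \<le> ?S"
  proof (rule norm_blinfun_bound)
    fix x
    have "blinfun_apply (\<Sum>w\<in>A. c w *\<^sub>O word_op n Z w) x =
        (\<Sum>w\<in>A. (word_op n Z w) (c w *\<^sub>C truncate n x))"
      by (simp add: blinfun.sum_left mat_spaceD[OF word_op_mat_space[OF row_bound_mat]])
    also have "(norm \<dots>)\<^sup>2 \<le> (1 / (1 - r))\<^sup>2 * (\<Sum>w\<in>A. (norm (c w *\<^sub>C truncate n x))\<^sup>2)"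
      by (intro row_bound_words[OF Z r A] vec_space_scaleC) simp
    also have "\<dots> \<le> (1 / (1 - r))\<^sup>2 * (\<Sum>w\<in>A. (cmod (c w))\<^sup>2 * (norm x)\<^sup>2)"
    proof (intro mult_left_mono sum_mono)
      fix w
      show "(norm (c w *\<^sub>C truncate n x))\<^sup>2 \<le> (cmod (c w))\<^sup>2 * (norm x)\<^sup>2"
        unfolding norm_scaleC power_mult_distrib by (intro mult_left_mono power_mono norm_truncate_le) auto
    qed auto
    also have "\<dots> = (?S * norm x)\<^sup>2"
      by (simp add: power_mult_distrib sum_nonneg sum_distrib_left sum_distrib_right mult.assoc)
    finally show "norm (blinfun_apply (\<Sum>w\<in>A. c w *\<^sub>O word_op n Z w) x) \<le> ?S * norm x"
      by (rule power2_le_imp_le) (simp add: sum_nonneg)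
  qed (simp add: sum_nonneg)
  then have "(norm (\<Sum>w\<in>A. c w *\<^sub>O word_op n Z w))\<^sup>2 \<le> ?S\<^sup>2"
    by (rule power_mono) simp
  then show ?thesis
    by (simp add: sum_nonneg)
qed

lemma has_sum_nc_sum: "((\<lambda>w. ell2_coeff f w *\<^sub>O word_op n Z w) has_sum nc_sum n f Z) UNIV"
  and norm_nc_sum: "norm (nc_sum n f Z) \<le> 1 / (1 - r) * norm f"
proof -
  have s: "(\<lambda>w. (1 / (1 - r))\<^sup>2 * (cmod (ell2_coeff f w))\<^sup>2) summable_on UNIV"
    by (intro summable_on_cmult_right summable_ell2)
  note * = summable_on_square_bound[OF nc_sum_bound[of _ "ell2_coeff f"] s]
  show "((\<lambda>w. ell2_coeff f w *\<^sub>O word_op n Z w) has_sum nc_sum n f Z) UNIV"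
    unfolding nc_sum_def using *(1) by (intro has_sum_infsum) simp
  have "(norm (nc_sum n f Z))\<^sup>2 \<le> (1 / (1 - r) * norm f)\<^sup>2"
    unfolding nc_sum_def power_mult_distrib norm_ell2_sq using *(2) by (simp add: infsum_cmult_right')
  then show "norm (nc_sum n f Z) \<le> 1 / (1 - r) * norm f"
    by (rule power2_le_imp_le) (use r in auto)
qed

text \<open>A summable family may be grouped by word length, so the unconditional sum agrees with
  the sum over homogeneous components.\<close>

lemma nc_sum_eq_homogeneous: "(\<Sum>m. \<Sum>\<^sub>\<infinity>w\<in>{w. length w = m}. ell2_coeff f w *\<^sub>O word_op n Z w) = nc_sum n f Z"
proof -
  let ?F = "\<lambda>w. ell2_coeff f w *\<^sub>O word_op n Z w"
  let ?S = "Sigma (UNIV :: nat set) (\<lambda>m. {w :: 'd list. length w = m})"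
  have "((\<lambda>(m, w). ?F w) has_sum nc_sum n f Z) ?S"
    by (rule has_sum_reindex_bij_witness[THEN iffD1, OF _ _ _ _ _ refl has_sum_nc_sum,
          of snd "\<lambda>w. (length w, w)"]) auto
  then show ?thesis
  proof (rule has_sum_SigmaD[THEN has_sum_imp_sums, THEN sums_unique, symmetric])
    show "((\<lambda>w. (\<lambda>(m, w). ?F w) (m, w)) has_sum (\<Sum>\<^sub>\<infinity>w\<in>{w. length w = m}. ?F w)) {w. length w = m}" for m
      using has_sum_infsum[OF summable_on_subset_banach[OF has_sum_imp_summable[OF has_sum_nc_sum] subset_UNIV]]
      by simp
  qed
qed

lemma bounded_linear_nc_sum: "bounded_linear (\<lambda>f. nc_sum n f Z)"
proof (rule bounded_linear_intro)
  show "nc_sum n (f + g) Z = nc_sum n f Z + nc_sum n g Z" for f g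
    using has_sum_add[OF has_sum_nc_sum has_sum_nc_sum, of f g]
    by (auto simp: plus_ell2.rep_eq scaleC_op_add_left intro: has_sum_unique[OF has_sum_nc_sum])
  show "nc_sum n (c *\<^sub>R f) Z = c *\<^sub>R nc_sum n f Z" for c f
  proof (rule has_sum_unique[OF has_sum_nc_sum])
    have "c *\<^sub>R (a *\<^sub>O T) = (of_real c * a) *\<^sub>O T" for a T
      by (rule blinfun_eqI) (simp add: scaleR_blinfun.rep_eq scaleR_scaleC)
    then show "((\<lambda>w. ell2_coeff (c *\<^sub>R f) w *\<^sub>O word_op n Z w) has_sum c *\<^sub>R nc_sum n f Z) UNIV"
      using has_sum_scaleR[OF has_sum_nc_sum, of c f] by (simp add: scaleR_ell2.rep_eq)
  qed
  show "norm (nc_sum n f Z) \<le> norm f * (1 / (1 - r))" for f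
    using norm_nc_sum[of f] by (simp add: mult.commute)
qed

lemma nc_sum_scaleC: "nc_sum n (c *\<^sub>C f) Z = c *\<^sub>O nc_sum n f Z"
  using has_sum_bounded_linear[OF bounded_linear_scaleC_op has_sum_nc_sum, of c f]
  by (auto simp: scaleC.rep_eq intro: has_sum_unique[OF has_sum_nc_sum])

lemma has_sum_nc_sum_apply:
  "((\<lambda>w. ell2_coeff f w *\<^sub>C (word_op n Z w) x) has_sum (nc_sum n f Z) x) UNIV"
  using has_sum_bounded_linear[OF blinfun.bounded_linear_left[of x] has_sum_nc_sum[of f]] by simp

lemma nc_sum_mat_space: "nc_sum n f Z \<in> mat_space n"
proof (rule mat_spaceI)
  note W = mat_spaceD[OF word_op_mat_space[OF row_bound_mat]]
  show "(nc_sum n f Z) (c *\<^sub>C x) = c *\<^sub>C (nc_sum n f Z) x" for c x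
    using has_sum_bounded_linear[OF bounded_linear_scaleC has_sum_nc_sum_apply, of c f x]
    by (auto simp: W mult.commute intro: has_sum_unique[OF has_sum_nc_sum_apply])
  show "truncate n ((nc_sum n f Z) (truncate n x)) = (nc_sum n f Z) x" for x
    using has_sum_bounded_linear[OF bounded_linear_truncate has_sum_nc_sum_apply, of n f "truncate n x"]
    by (auto simp: W intro: has_sum_unique[OF _ has_sum_nc_sum_apply])
qed

lemma nc_sum_fmul_ket: "nc_sum n (fmul f (ket w)) Z = nc_sum n f Z o\<^sub>L word_op n Z w"
proof -
  let ?F = "\<lambda>v. ell2_coeff (fmul f (ket w)) v *\<^sub>O word_op n Z v"
  have inj: "inj (\<lambda>u. u @ w)"
    by (auto intro: injI)
  have "((\<lambda>u. (ell2_coeff f u *\<^sub>O word_op n Z u) o\<^sub>L word_op n Z w) has_sum (nc_sum n f Z o\<^sub>L word_op n Z w)) UNIV"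
    by (intro has_sum_bounded_linear[OF bounded_bilinear.bounded_linear_left[OF bounded_bilinear_blinfun_compose]] has_sum_nc_sum)
  also have "?this \<longleftrightarrow> ((\<lambda>u. ?F (u @ w)) has_sum (nc_sum n f Z o\<^sub>L word_op n Z w)) UNIV"
    by (rule has_sum_cong) (simp add: word_op_append row_bound_mat)
  also have "\<dots> \<longleftrightarrow> (?F has_sum (nc_sum n f Z o\<^sub>L word_op n Z w)) (range (\<lambda>u. u @ w))"
    by (subst has_sum_reindex[OF inj]) (simp add: o_def)
  also have "\<dots> \<longleftrightarrow> (?F has_sum (nc_sum n f Z o\<^sub>L word_op n Z w)) UNIV"
    by (rule has_sum_cong_neutral)
      (auto simp: ell2_coeff_fmul_ket image_iff conv_ket_not_suffix simp del: ell2_coeff_ket)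
  finally show ?thesis
    using has_sum_unique[OF has_sum_nc_sum] by metis
qed

text \<open>For a word on the right this is \<open>nc_sum_fmul_ket\<close>. Both sides are
  continuous in \<open>g\<close>, the left one because \<open>f\<close> is a multiplier, and
  expanding \<open>g\<close> into words gives the general case.\<close>

lemma nc_sum_fmul:
  assumes f: "multiplier M f"
  shows "nc_sum n (fmul f g) Z = nc_sum n f Z o\<^sub>L nc_sum n g Z"
proof -
  have "((\<lambda>w. nc_sum n (fmul f (ell2_coeff g w *\<^sub>C ket w)) Z) has_sum nc_sum n (fmul f g) Z) UNIV"
    by (intro has_sum_bounded_linear[OF bounded_linear_compose[OF bounded_linear_nc_sum bounded_linear_fmul[OF f]]]
        has_sum_ket)
  moreover have "nc_sum n (fmul f (ell2_coeff g w *\<^sub>C ket w)) Z = nc_sum n f Z o\<^sub>L (ell2_coeff g w *\<^sub>O word_op n Z w)" for w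
    by (simp add: fmul_scaleC_right[OF f] nc_sum_scaleC nc_sum_fmul_ket scaleC_op_compose_right[OF nc_sum_mat_space])
  moreover have "((\<lambda>w. nc_sum n f Z o\<^sub>L (ell2_coeff g w *\<^sub>O word_op n Z w)) has_sum (nc_sum n f Z o\<^sub>L nc_sum n g Z)) UNIV"
    by (intro has_sum_bounded_linear[OF bounded_bilinear.bounded_linear_right[OF bounded_bilinear_blinfun_compose]] has_sum_nc_sum)
  ultimately show ?thesis
    by (auto intro: has_sum_unique)
qed

end

lemma nc_eval_eq:
  fixes Z :: "'d::countable \<Rightarrow> operator"
  assumes "row_bound n r Z" "r < 1"
  shows "nc_eval n f Z = nc_sum n f Z"
  unfolding nc_eval_def by (rule nc_sum_eq_homogeneous[OF assms])

lemma word_op_scaleC_op: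
  assumes "\<And>k. W k \<in> mat_space n"
  shows "word_op n (\<lambda>k. c *\<^sub>O W k) w = c ^ length w *\<^sub>O word_op n W w"
proof (induction w)
  case (Cons k w)
  then show ?case
    by (simp add: scaleC_op_compose_right[OF assms])
qed simp

lemma nc_sum_dilate:
  assumes "\<And>k. W k \<in> mat_space n" "0 \<le> r" "r \<le> 1"
  shows "nc_sum n (dilate r f) W = nc_sum n f (\<lambda>k. of_real r *\<^sub>O W k)"
  unfolding nc_sum_def word_op_scaleC_op[OF assms(1)] ell2_coeff_dilate[OF assms(2,3)]
  by (simp add: mult.commute)

text \<open>Strictness leaves room: with \<open>s\<close> midway between \<open>r\<close> and 1, the
  point \<open>Z\<close> divided by \<open>s\<close> is still a strict row contraction. Thus f(Z) is
  the value of a dilation of f at another point of the ball, which carries statements about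
  dilations to all points.\<close>

lemma row_bound_dilate:
  assumes "row_bound n r Z" "r < 1"
  obtains s q W where "0 < s" "s < 1" "q < 1" "row_bound n q W" "Z = (\<lambda>k. of_real s *\<^sub>O W k)"
proof -
  define s where "s = (1 + r) / 2"
  have r0: "0 \<le> r" and mat: "\<And>k. Z k \<in> mat_space n"
    using assms(1) by (auto simp: row_bound_def)
  have s: "0 < s" "s < 1" "r < s"
    using r0 assms(2) by (auto simp: s_def)
  define W where "W k = of_real (1 / s) *\<^sub>O Z k" for k
  have "row_bound n (r / s) W"
    unfolding row_bound_def
  proof (intro conjI allI impI)
    show "W k \<in> mat_space n" for k
      unfolding W_def by (intro scaleC_op_mat_space mat)
    fix K and x :: "'a \<Rightarrow> nat ell2" assume x: "finite K \<and> (\<forall>k\<in>K. x k \<in> vec_space n)"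
    have "(\<Sum>k\<in>K. blinfun_apply (W k) (x k)) = of_real (1 / s) *\<^sub>C (\<Sum>k\<in>K. (Z k) (x k))"
      by (simp add: W_def scaleC_sum_right)
    then have "(norm (\<Sum>k\<in>K. blinfun_apply (W k) (x k)))\<^sup>2 = (1 / s)\<^sup>2 * (norm (\<Sum>k\<in>K. (Z k) (x k)))\<^sup>2"
      using s by (simp add: norm_scaleC power_mult_distrib power_divide norm_divide)
    also have "\<dots> \<le> (1 / s)\<^sup>2 * (r\<^sup>2 * (\<Sum>k\<in>K. (norm (x k))\<^sup>2))"
      using x by (intro mult_left_mono row_boundD[OF assms(1)]) auto
    finally show "(norm (\<Sum>k\<in>K. blinfun_apply (W k) (x k)))\<^sup>2 \<le> (r / s)\<^sup>2 * (\<Sum>k\<in>K. (norm (x k))\<^sup>2)"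
      by (simp add: power_divide)
  qed (use r0 s in auto)
  moreover have "Z = (\<lambda>k. of_real s *\<^sub>O W k)"
    using s by (auto simp: W_def fun_eq_iff simp flip: of_real_mult)
  ultimately show ?thesis
    using s r0 by (intro that[of s "r / s" W]) auto
qed

section \<open>Compressed left shifts as points of the row ball\<close>

text \<open>Compressions of \<open>r\<close> times the left shifts to the span of a suffix-closed set \<open>W\<close> of words,
  realised on \<open>\<ell>\<^sup>2(\<nat>)\<close> by enumerating the words. For \<open>W = UNIV\<close> this is \<open>rL\<close> at level \<open>\<infinity>\<close>,
  for finite \<open>W\<close> a point of a finite level.\<close>

definition fock_embed :: "'d::countable list set \<Rightarrow> 'd fock \<Rightarrow> nat ell2" where
  "fock_embed W f = Abs_ell2 (\<lambda>i. if i \<in> to_nat ` W then ell2_coeff f (from_nat i) else 0)"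

definition shift_coeff :: "'d::countable list set \<Rightarrow> real \<Rightarrow> 'd \<Rightarrow> nat ell2 \<Rightarrow> nat \<Rightarrow> complex" where
  "shift_coeff W r k x i = (if i \<in> to_nat ` W
     then (case (from_nat i :: 'd list) of [] \<Rightarrow> 0
           | j # w \<Rightarrow> if j = k then of_real r * ell2_coeff x (to_nat w) else 0)
     else 0)"

definition model_shift :: "'d::countable list set \<Rightarrow> real \<Rightarrow> 'd \<Rightarrow> operator" where
  "model_shift W r k = Blinfun (\<lambda>x. Abs_ell2 (shift_coeff W r k x))"

lemma ell2_le_fock_embed:
  fixes W :: "'d::countable list set" and f :: "'d fock"
  shows
  "ell2_le (norm f) (\<lambda>i. if i \<in> to_nat ` W then ell2_coeff f (from_nat i) else 0)"
  unfolding ell2_le_def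
proof (intro conjI allI impI)
  fix A :: "nat set" assume A: "finite A"
  have "(\<Sum>i\<in>A. (cmod (if i \<in> to_nat ` W then ell2_coeff f (from_nat i) else 0))\<^sup>2) =
      (\<Sum>i\<in>A \<inter> to_nat ` W. (cmod (ell2_coeff f (from_nat i)))\<^sup>2)"
    using A by (intro sum.mono_neutral_cong_right) auto
  also have "\<dots> = (\<Sum>w\<in>from_nat ` (A \<inter> to_nat ` W). (cmod (ell2_coeff f w))\<^sup>2)"
    by (subst sum.reindex) (auto intro!: inj_onI)
  also have "\<dots> \<le> (norm f)\<^sup>2"
    using A by (intro sum_coeff_le_norm) auto
  finally show "(\<Sum>i\<in>A. (cmod (if i \<in> to_nat ` W then ell2_coeff f (from_nat i) else 0))\<^sup>2) \<le> (norm f)\<^sup>2" .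
qed simp

lemma ell2_coeff_fock_embed:
  fixes W :: "'d::countable list set" and f :: "'d fock"
  shows "ell2_coeff (fock_embed W f) i = (if i \<in> to_nat ` W then ell2_coeff f (from_nat i) else 0)"
  unfolding fock_embed_def by (simp add: ell2_le_Abs(1)[OF ell2_le_fock_embed])

lemma norm_fock_embed_le:
  fixes W :: "'d::countable list set" and f :: "'d fock"
  shows "norm (fock_embed W f) \<le> norm f"
  unfolding fock_embed_def by (rule ell2_le_Abs(2)[OF ell2_le_fock_embed])

lemma cinner_fock_embed_UNIV:
  fixes f g :: "'d::countable fock"
  shows "cinner (fock_embed UNIV f) (fock_embed UNIV g) = cinner f g"
  by (rule cinner_reindex[where h = "to_nat :: 'd list \<Rightarrow> nat"]) (auto simp: ell2_coeff_fock_embed)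

lemma ell2_le_shift:
  fixes W :: "'d::countable list set"
  assumes r: "0 \<le> r"
  shows "ell2_le (r * norm x) (shift_coeff W r k x)"
  unfolding ell2_le_def
proof (intro conjI allI impI)
  fix A :: "nat set" assume A: "finite A"
  define B where "B = {w. k # w \<in> W \<and> to_nat (k # w) \<in> A}"
  have "B \<subseteq> (\<lambda>i. tl (from_nat i)) ` A"
    by (force simp: B_def)
  then have B: "finite B"
    using A finite_subset by blast
  have "(\<Sum>i\<in>A. (cmod (shift_coeff W r k x i))\<^sup>2) = (\<Sum>i\<in>(\<lambda>w. to_nat (k # w)) ` B. (cmod (shift_coeff W r k x i))\<^sup>2)"
  proof (rule sum.mono_neutral_right, goal_cases)
    case 3
    show ?case
    proof
      fix i assume i: "i \<in> A - (\<lambda>w. to_nat (k # w)) ` B"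
      show "(cmod (shift_coeff W r k x i))\<^sup>2 = 0"
      proof (cases "i \<in> to_nat ` W")
        case True
        then obtain v where v: "v \<in> W" "i = to_nat v" by blast
        with i show ?thesis
          by (cases v) (auto simp: shift_coeff_def B_def)
      qed (simp add: shift_coeff_def)
    qed
  qed (use A in \<open>auto simp: B_def\<close>)
  also have "\<dots> = (\<Sum>w\<in>B. (cmod (shift_coeff W r k x (to_nat (k # w))))\<^sup>2)"
    by (subst sum.reindex) (auto intro!: inj_onI)
  also have "\<dots> = (\<Sum>w\<in>B. r\<^sup>2 * (cmod (ell2_coeff x (to_nat w)))\<^sup>2)"
    by (rule sum.cong) (auto simp: shift_coeff_def B_def norm_mult power_mult_distrib)
  also have "\<dots> = r\<^sup>2 * (\<Sum>i\<in>to_nat ` B. (cmod (ell2_coeff x i))\<^sup>2)"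
    by (subst sum.reindex) (auto simp: sum_distrib_left)
  also have "\<dots> \<le> r\<^sup>2 * (norm x)\<^sup>2"
    using B by (intro mult_left_mono sum_coeff_le_norm) auto
  finally show "(\<Sum>i\<in>A. (cmod (shift_coeff W r k x i))\<^sup>2) \<le> (r * norm x)\<^sup>2"
    by (simp add: power_mult_distrib)
qed (use r in simp)

context
  fixes W :: "'d::countable list set" and n :: enat and r :: real
  assumes suffix_closed: "\<And>k w. k # w \<in> W \<Longrightarrow> w \<in> W"
    and level: "\<And>w. w \<in> W \<Longrightarrow> enat (to_nat w) < n"
    and r: "0 \<le> r" "r < 1"
begin

lemma ell2_coeff_model_shift: "ell2_coeff ((model_shift W r k) x) = shift_coeff W r k x"
  and norm_model_shift_le: "norm ((model_shift W r k) x) \<le> r * norm x"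
proof -
  note S = ell2_le_Abs[OF ell2_le_shift[OF r(1), of _ W k]]
  have "bounded_linear (\<lambda>x. Abs_ell2 (shift_coeff W r k x))"
    by (rule bounded_linear_intro[where K = r])
      (use S(2) in \<open>auto intro!: ell2_eqI simp: S(1) plus_ell2.rep_eq scaleR_ell2.rep_eq shift_coeff_def
        algebra_simps split: list.split\<close>)
  then have eq: "(model_shift W r k) x = Abs_ell2 (shift_coeff W r k x)"
    by (simp add: model_shift_def bounded_linear_Blinfun_apply)
  show "ell2_coeff ((model_shift W r k) x) = shift_coeff W r k x"
    "norm ((model_shift W r k) x) \<le> r * norm x"
    unfolding eq by (rule S)+
qed

lemma model_shift_mat_space: "model_shift W r k \<in> mat_space n"
proof (rule mat_spaceI)
  show "(model_shift W r k) (c *\<^sub>C x) = c *\<^sub>C (model_shift W r k) x" for c x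
    by (rule ell2_eqI) (auto simp: ell2_coeff_model_shift shift_coeff_def split: list.split)
  show "truncate n ((model_shift W r k) (truncate n x)) = (model_shift W r k) x" for x
    by (rule ell2_eqI)
      (auto simp: ell2_coeff_model_shift shift_coeff_def level dest: level[OF suffix_closed] split: list.split)
qed

text \<open>Shifts for different letters have orthogonal ranges, as words with different first
  letters are different; Pythagoras then reduces the row norm to that of a single shift.\<close>

lemma row_bound_model_shift: "row_bound n r (model_shift W r)"
  unfolding row_bound_def
proof (intro conjI allI impI)
  fix K :: "'d set" and x :: "'d \<Rightarrow> nat ell2"
  assume K: "finite K \<and> (\<forall>k\<in>K. x k \<in> vec_space n)"
  have orth: "cinner ((model_shift W r j) y) ((model_shift W r k) z) = 0"
    if "j \<noteq> k" for j k y z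
    unfolding cinner.rep_eq ell2_coeff_model_shift
    by (rule infsum_0) (use that in \<open>auto simp: shift_coeff_def split: list.split\<close>)
  have "of_real ((norm (\<Sum>k\<in>K. (model_shift W r k) (x k)))\<^sup>2) =
      (\<Sum>j\<in>K. \<Sum>k\<in>K. cinner ((model_shift W r j) (x j)) ((model_shift W r k) (x k)))"
    by (simp only: cinner_self[symmetric] cinner_sum_left cinner_sum_right)
      (rule sum.swap)
  also have "\<dots> = (\<Sum>j\<in>K. \<Sum>k\<in>K. if k = j then cinner ((model_shift W r j) (x j)) ((model_shift W r j) (x j)) else 0)"
    by (intro sum.cong) (auto simp: orth)
  also have "\<dots> = of_real (\<Sum>k\<in>K. (norm ((model_shift W r k) (x k)))\<^sup>2)"
    using K by (simp add: cinner_self)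
  finally have "(norm (\<Sum>k\<in>K. (model_shift W r k) (x k)))\<^sup>2 =
      (\<Sum>k\<in>K. (norm ((model_shift W r k) (x k)))\<^sup>2)"
    using of_real_eq_iff by blast
  also have "\<dots> \<le> (\<Sum>k\<in>K. (r * norm (x k))\<^sup>2)"
    by (intro sum_mono power_mono norm_model_shift_le) auto
  finally show "(norm (\<Sum>k\<in>K. (model_shift W r k) (x k)))\<^sup>2 \<le> r\<^sup>2 * (\<Sum>k\<in>K. (norm (x k))\<^sup>2)"
    by (simp add: power_mult_distrib sum_distrib_left)
qed (use r model_shift_mat_space in auto)

text \<open>Here suffix-closedness matters: the words outside \<open>W\<close> span a subspace
  invariant under the left shifts, so compressing to \<open>W\<close> respects products of
  shifts.\<close>

lemma word_op_model_shift:
  "ell2_coeff ((word_op n (model_shift W r) \<alpha>) (fock_embed W g)) i =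
    (if i \<in> to_nat ` W then of_real (r ^ length \<alpha>) * conv (ell2_coeff (ket \<alpha>)) (ell2_coeff g) (from_nat i) else 0)"
proof (induction \<alpha> arbitrary: i)
  case Nil
  show ?case
    by (auto simp: conv_one_left ell2_coeff_fock_embed level simp del: ell2_coeff_ket)
next
  case (Cons k \<alpha>)
  show ?case
  proof (cases "i \<in> to_nat ` W")
    case True
    then obtain v where v: "v \<in> W" "i = to_nat v" by blast
    show ?thesis
    proof (cases v)
      case (Cons j w)
      have w: "w \<in> W"
        using v(1) Cons by (auto dest: suffix_closed)
      have "(\<lambda>u. ell2_coeff (ket (k # \<alpha>)) (j # u)) = (if j = k then ell2_coeff (ket \<alpha>) else (\<lambda>_. 0))"
        "ell2_coeff (ket (k # \<alpha>)) [] = 0"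
        by auto
      then show ?thesis
        using v w Cons by (simp add: ell2_coeff_model_shift shift_coeff_def Cons.IH del: ell2_coeff_ket)
    qed (use v in \<open>simp add: ell2_coeff_model_shift shift_coeff_def\<close>)
  qed (simp add: ell2_coeff_model_shift shift_coeff_def)
qed

lemma conv_ket_left_not_prefix:
  assumes "\<alpha> \<notin> (\<lambda>i. take i v) ` {..length v}"
  shows "conv (ell2_coeff (ket \<alpha>)) g v = 0"
  unfolding conv_eq_sum using assms by (intro sum.neutral) auto

text \<open>Evaluating f at the compression of rL gives left multiplication by the dilation of f,
  read off on \<open>W\<close>. At a word \<open>v\<close> only the prefixes of \<open>v\<close>
  contribute, so the sum over all words becomes the finite sum of \<open>conv\<close>.\<close>

lemma nc_sum_model_shift:
  "ell2_coeff ((nc_sum n f (model_shift W r)) (fock_embed W g)) i =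
    (if i \<in> to_nat ` W then conv (ell2_coeff (dilate r f)) (ell2_coeff g) (from_nat i) else 0)"
proof -
  have hs: "((\<lambda>\<alpha>. ell2_coeff (ell2_coeff f \<alpha> *\<^sub>C (word_op n (model_shift W r) \<alpha>) (fock_embed W g)) i)
      has_sum ell2_coeff ((nc_sum n f (model_shift W r)) (fock_embed W g)) i) UNIV"
    by (intro has_sum_bounded_linear[OF bounded_linear_ell2_coeff]
        has_sum_nc_sum_apply[OF row_bound_model_shift r(2)])
  show ?thesis
  proof (cases "i \<in> to_nat ` W")
    case False
    then have "((\<lambda>_. 0) has_sum ell2_coeff ((nc_sum n f (model_shift W r)) (fock_embed W g)) i) (UNIV :: 'd list set)"
      using hs by (simp add: word_op_model_shift)
    then show ?thesis
      using False has_sum_unique[OF has_sum_0_simp] by metis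
  next
    case True
    then obtain v where v: "v \<in> W" "i = to_nat v" by blast
    define P where "P = (\<lambda>i. take i v) ` {..length v}"
    have "((\<lambda>\<alpha>. ell2_coeff (dilate r f) \<alpha> * conv (ell2_coeff (ket \<alpha>)) (ell2_coeff g) v)
        has_sum (\<Sum>\<alpha>\<in>P. ell2_coeff (dilate r f) \<alpha> * conv (ell2_coeff (ket \<alpha>)) (ell2_coeff g) v)) UNIV"
      by (rule has_sum_finite_neutralI[where B = P])
        (auto simp: P_def conv_ket_left_not_prefix simp del: ell2_coeff_ket)
    moreover have "((\<lambda>\<alpha>. ell2_coeff (dilate r f) \<alpha> * conv (ell2_coeff (ket \<alpha>)) (ell2_coeff g) v)
        has_sum ell2_coeff ((nc_sum n f (model_shift W r)) (fock_embed W g)) i) UNIV"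
      using hs v r by (simp add: word_op_model_shift ell2_coeff_dilate mult_ac del: ell2_coeff_ket)
    ultimately have "ell2_coeff ((nc_sum n f (model_shift W r)) (fock_embed W g)) i =
        (\<Sum>\<alpha>\<in>P. ell2_coeff (dilate r f) \<alpha> * conv (ell2_coeff (ket \<alpha>)) (ell2_coeff g) v)"
      using has_sum_unique by blast
    also have "\<dots> = (\<Sum>i\<le>length v. (\<Sum>\<alpha>\<in>P. ell2_coeff (dilate r f) \<alpha> * ell2_coeff (ket \<alpha>) (take i v)) * ell2_coeff g (drop i v))"
      unfolding conv_eq_sum sum_distrib_left sum_distrib_right
      by (subst sum.swap) (simp only: mult.assoc)
    also have "\<dots> = (\<Sum>i\<le>length v. ell2_coeff (dilate r f) (take i v) * ell2_coeff g (drop i v))"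
    proof (rule sum.cong)
      fix i assume i: "i \<in> {..length v}"
      have "(\<Sum>\<alpha>\<in>P. ell2_coeff (dilate r f) \<alpha> * ell2_coeff (ket \<alpha>) (take i v)) =
          (\<Sum>\<alpha>\<in>P. if \<alpha> = take i v then ell2_coeff (dilate r f) \<alpha> else 0)"
        by (rule sum.cong) auto
      also have "\<dots> = ell2_coeff (dilate r f) (take i v)"
        using i by (simp add: P_def)
      finally show "(\<Sum>\<alpha>\<in>P. ell2_coeff (dilate r f) \<alpha> * ell2_coeff (ket \<alpha>) (take i v)) * ell2_coeff g (drop i v) =
          ell2_coeff (dilate r f) (take i v) * ell2_coeff g (drop i v)"
        by simp
    qed simp
    also have "\<dots> = conv (ell2_coeff (dilate r f)) (ell2_coeff g) v"
      by (simp only: conv_eq_sum)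
    finally show ?thesis
      using v by simp
  qed
qed

end

text \<open>Multiplication by \<open>dilate r f\<close> is, up to the enumeration of words, the
  operator f(rL). Its norm is therefore controlled by the evaluation bound 1/(1 - r) times the norm
  of \<open>f\<close>.\<close>

lemma multiplier_dilate:
  fixes f :: "'d::countable fock"
  assumes r: "0 \<le> r" "r < 1"
  shows "multiplier (norm f / (1 - r)) (dilate r f)"
    and nc_sum_left_shift:
      "(nc_sum \<infinity> f (model_shift UNIV r)) (fock_embed UNIV g) = fock_embed UNIV (fmul (dilate r f) g)"
    and row_bound_left_shift: "row_bound \<infinity> r (model_shift (UNIV :: 'd list set) r)"
proof -
  show rb: "row_bound \<infinity> r (model_shift (UNIV :: 'd list set) r)"
    by (rule row_bound_model_shift) (use r in auto)
  have coeff: "ell2_coeff ((nc_sum \<infinity> f (model_shift UNIV r)) (fock_embed UNIV g)) i =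
      (if i \<in> range (to_nat :: 'd list \<Rightarrow> nat) then conv (ell2_coeff (dilate r f)) (ell2_coeff g) (from_nat i) else 0)" for i and g :: "'d fock"
    by (rule nc_sum_model_shift) (use r in auto)
  show mult: "multiplier (norm f / (1 - r)) (dilate r f)"
    unfolding multiplier_def ell2_le_def
  proof (intro conjI allI impI)
    fix g :: "'d fock" and A :: "'d list set" assume A: "finite A"
    let ?x = "(nc_sum \<infinity> f (model_shift UNIV r)) (fock_embed UNIV g)"
    have "(\<Sum>v\<in>A. (cmod (conv (ell2_coeff (dilate r f)) (ell2_coeff g) v))\<^sup>2) = (\<Sum>i\<in>to_nat ` A. (cmod (ell2_coeff ?x i))\<^sup>2)"
      by (subst sum.reindex) (auto simp: coeff)
    also have "\<dots> \<le> (norm ?x)\<^sup>2"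
      using A by (intro sum_coeff_le_norm) simp
    also have "\<dots> \<le> (norm f / (1 - r) * norm g)\<^sup>2"
    proof (rule power_mono)
      have "norm ?x \<le> norm (nc_sum \<infinity> f (model_shift UNIV r)) * norm (fock_embed UNIV g)"
        by (rule norm_blinfun)
      also have "\<dots> \<le> (1 / (1 - r) * norm f) * norm g"
        using r by (intro mult_mono norm_nc_sum[OF rb] norm_fock_embed_le) auto
      finally show "norm ?x \<le> norm f / (1 - r) * norm g" by simp
    qed simp
    finally show "(\<Sum>v\<in>A. (cmod (conv (ell2_coeff (dilate r f)) (ell2_coeff g) v))\<^sup>2) \<le> (norm f / (1 - r) * norm g)\<^sup>2" .
  qed (use r in auto)
  show "(nc_sum \<infinity> f (model_shift UNIV r)) (fock_embed UNIV g) = fock_embed UNIV (fmul (dilate r f) g)"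
    by (rule ell2_eqI) (simp add: coeff ell2_coeff_fock_embed multiplierD[OF mult])
qed

section \<open>Finite levels determine coefficients and multiplier norms\<close>

definition suffix_closure :: "'d list set \<Rightarrow> 'd list set" where
  "suffix_closure A = (\<Union>v\<in>A. (\<lambda>i. drop i v) ` {..length v})"

lemma suffix_closure:
  "finite A \<Longrightarrow> finite (suffix_closure A)" "A \<subseteq> suffix_closure A"
  "k # w \<in> suffix_closure A \<Longrightarrow> w \<in> suffix_closure A"
proof -
  show "finite A \<Longrightarrow> finite (suffix_closure A)"
    by (simp add: suffix_closure_def)
  show "A \<subseteq> suffix_closure A"
    by (force simp: suffix_closure_def)
  assume "k # w \<in> suffix_closure A"
  then obtain v i where v: "v \<in> A" "i \<le> length v" "k # w = drop i v"
    by (auto simp: suffix_closure_def)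
  then have "w = drop (Suc i) v" "Suc i \<le> length v"
    by (metis drop_Suc list.sel(3) tl_drop) (metis v(2,3) drop_all leI le_antisym list.distinct(1) not_less_eq_eq)
  with v(1) show "w \<in> suffix_closure A"
    by (auto simp: suffix_closure_def)
qed

lemma finite_level_model:
  fixes A :: "'d::countable list set"
  assumes A: "finite A" and r: "0 \<le> r" "r < 1"
  obtains n :: nat and Z where "0 < n" "row_bound (enat n) r Z"
    "\<And>f g v. v \<in> A \<Longrightarrow> ell2_coeff ((nc_sum (enat n) f Z) (fock_embed (suffix_closure A) g)) (to_nat v) =
       conv (ell2_coeff (dilate r f)) (ell2_coeff g) v"
proof -
  define W where "W = suffix_closure A"
  \<comment> \<open>The level must exceed the code of every word of \<open>W\<close>, since C^n
    consists of the indices below \<open>n\<close>.\<close>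
  define n where "n = Suc (Max (to_nat ` W))"
  have W: "finite W" "A \<subseteq> W" "\<And>k w. k # w \<in> W \<Longrightarrow> w \<in> W"
    unfolding W_def by (fact suffix_closure(1)[OF A] suffix_closure(2,3))+
  have level: "enat (to_nat w) < enat n" if "w \<in> W" for w
    using W(1) that by (simp add: n_def less_Suc_eq_le)
  show ?thesis
  proof (rule that)
    show "0 < n" by (simp add: n_def)
    show "row_bound (enat n) r (model_shift W r)"
      by (rule row_bound_model_shift[OF W(3) level r])
    show "ell2_coeff ((nc_sum (enat n) f (model_shift W r)) (fock_embed (suffix_closure A) g)) (to_nat v) =
       conv (ell2_coeff (dilate r f)) (ell2_coeff g) v" if "v \<in> A" for f g v
      using nc_sum_model_shift[OF W(3) level r, where f = f and g = g and i = "to_nat v"] that W(2) by (auto simp: W_def)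
  qed
qed

text \<open>Applied to the empty word, the half left shift compressed to the suffixes of
  \<open>v\<close> displays the coefficient at \<open>v\<close>, scaled by a power of 1/2.\<close>

lemma nc_eval_determines:
  fixes f g :: "'d::countable fock"
  assumes "\<And>n Z. 0 < n \<Longrightarrow> Z \<in> row_ball (enat n) \<Longrightarrow> nc_eval (enat n) f Z = nc_eval (enat n) g Z"
  shows "f = g"
proof (rule ell2_eqI)
  fix v :: "'d list"
  obtain n :: nat and Z where n: "0 < n" "row_bound (enat n) (1/2) Z"
    "\<And>f g. ell2_coeff ((nc_sum (enat n) f Z) (fock_embed (suffix_closure {v}) g)) (to_nat v) =
       conv (ell2_coeff (dilate (1/2) f)) (ell2_coeff g) v"
    using finite_level_model[of "{v}" "1/2"] by auto
  have "nc_sum (enat n) f Z = nc_sum (enat n) g Z"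
    using assms[OF n(1) row_bound_imp_row_ball[OF n(2)]] by (simp add: nc_eval_eq[OF n(2)])
  then have "ell2_coeff (dilate (1/2) f) v = ell2_coeff (dilate (1/2) g) v"
    using n(3)[of f "ket []"] n(3)[of g "ket []"] by (simp only: conv_one_right)
  then show "ell2_coeff f v = ell2_coeff g v"
    by (simp add: ell2_coeff_dilate)
qed

lemma represents_unique: "represents f \<phi> \<Longrightarrow> represents g \<phi> \<Longrightarrow> f = g"
  unfolding represents_def by (rule nc_eval_determines) simp

text \<open>Finitely many coefficients of a product with \<open>dilate r f\<close> are visible at
  one finite level, so the sup bound controls them uniformly in the finite set and in
  \<open>r\<close>. The coefficientwise limit as r tends to 1 removes the dilation.\<close>

lemma H_inf_imp_multiplier:
  fixes f :: "'d::countable fock"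
  assumes "f \<in> H_inf"
  obtains M where "multiplier M f"
proof -
  obtain M where M: "\<And>n Z. 0 < n \<Longrightarrow> Z \<in> row_ball (enat n) \<Longrightarrow> norm (nc_eval (enat n) f Z) \<le> M"
    using assms by (auto simp: H_inf_def)
  have bound: "ell2_le (max M 0 * norm g) (conv (ell2_coeff (dilate r f)) (ell2_coeff g))"
    if r: "0 \<le> r" "r < 1" for r g
    unfolding ell2_le_def
  proof (intro conjI allI impI)
    fix A :: "'d list set" assume A: "finite A"
    obtain n :: nat and Z where n: "0 < n" "row_bound (enat n) r Z"
      "\<And>f g v. v \<in> A \<Longrightarrow> ell2_coeff ((nc_sum (enat n) f Z) (fock_embed (suffix_closure A) g)) (to_nat v) =
         conv (ell2_coeff (dilate r f)) (ell2_coeff g) v"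
      using finite_level_model[OF A r] by metis
    let ?x = "(nc_sum (enat n) f Z) (fock_embed (suffix_closure A) g)"
    have "(\<Sum>v\<in>A. (cmod (conv (ell2_coeff (dilate r f)) (ell2_coeff g) v))\<^sup>2) = (\<Sum>i\<in>to_nat ` A. (cmod (ell2_coeff ?x i))\<^sup>2)"
      by (subst sum.reindex) (auto simp: n(3))
    also have "\<dots> \<le> (norm ?x)\<^sup>2"
      using A by (intro sum_coeff_le_norm) simp
    also have "\<dots> \<le> (max M 0 * norm g)\<^sup>2"
    proof (rule power_mono)
      have "norm ?x \<le> norm (nc_sum (enat n) f Z) * norm (fock_embed (suffix_closure A) g)"
        by (rule norm_blinfun)
      also have "\<dots> \<le> max M 0 * norm g"
        using M[OF n(1) row_bound_imp_row_ball[OF n(2) r(2)]]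
        by (intro mult_mono norm_fock_embed_le) (auto simp: nc_eval_eq[OF n(2) r(2)])
      finally show "norm ?x \<le> max M 0 * norm g" .
    qed simp
    finally show "(\<Sum>v\<in>A. (cmod (conv (ell2_coeff (dilate r f)) (ell2_coeff g) v))\<^sup>2) \<le> (max M 0 * norm g)\<^sup>2" .
  qed simp
  define r where "r n = 1 - 1 / real (Suc n)" for n
  have r: "0 \<le> r n" "r n < 1" for n
    by (auto simp: r_def field_simps)
  have "r \<longlonglongrightarrow> 1 - 0"
    unfolding r_def by (intro tendsto_diff tendsto_const LIMSEQ_inverse_real_of_nat[unfolded inverse_eq_divide])
  then have lim: "(\<lambda>n. ell2_coeff (dilate (r n) f) w) \<longlonglongrightarrow> ell2_coeff f w" for w
    using r by (subst ell2_coeff_dilate) (auto intro!: tendsto_eq_intros less_imp_le)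
  have "multiplier (max M 0) f"
  proof (rule multiplier_lim[OF _ lim])
    show "multiplier (max M 0) (dilate (r n) f)" for n
      unfolding multiplier_def using bound[OF r] by blast
  qed
  then show ?thesis by (rule that)
qed

section \<open>The von Neumann inequality\<close>

lemma le_of_mult_self_le:
  fixes s c :: real
  assumes "s * s \<le> c * s" "0 \<le> s" "0 \<le> c"
  shows "s \<le> c"
  using assms by (cases "s = 0") (auto simp: mult_le_cancel_right)

lemma eq_cmod_of_real: "of_real a = z \<Longrightarrow> 0 \<le> a \<Longrightarrow> a = cmod z"
  by (metis norm_of_real abs_of_nonneg)

lemma has_sum_sum:
  fixes f :: "'i \<Rightarrow> 'a \<Rightarrow> 'b::topological_comm_monoid_add"
  assumes "finite I" "\<And>i. i \<in> I \<Longrightarrow> (f i has_sum s i) A"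
  shows "((\<lambda>x. \<Sum>i\<in>I. f i x) has_sum (\<Sum>i\<in>I. s i)) A"
  using assms by (induction I rule: finite_induct) (auto intro: has_sum_add)

section \<open>Positive semidefinite forms as finite sums of squares\<close>

definition psd_form :: "('a ell2 \<Rightarrow> 'a ell2 \<Rightarrow> complex) \<Rightarrow> bool" where
  "psd_form \<beta> \<longleftrightarrow> (\<forall>x y z. \<beta> x (y + z) = \<beta> x y + \<beta> x z) \<and> (\<forall>c x y. \<beta> x (c *\<^sub>C y) = c * \<beta> x y) \<and>
     (\<forall>x y. \<beta> y x = cnj (\<beta> x y)) \<and> (\<forall>x. 0 \<le> Re (\<beta> x x))"

lemma psd_formD:
  assumes "psd_form \<beta>"
  shows "\<beta> x (y + z) = \<beta> x y + \<beta> x z" "\<beta> x (c *\<^sub>C y) = c * \<beta> x y"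
    "\<beta> y x = cnj (\<beta> x y)" "0 \<le> Re (\<beta> x x)"
    "\<beta> (x + y) z = \<beta> x z + \<beta> y z" "\<beta> (c *\<^sub>C x) z = cnj c * \<beta> x z"
proof -
  note F = assms[unfolded psd_form_def]
  show add: "\<beta> x (y + z) = \<beta> x y + \<beta> x z" for x y z
    by (rule F[THEN conjunct1, rule_format])
  show scale: "\<beta> x (c *\<^sub>C y) = c * \<beta> x y" for x y c
    by (rule F[THEN conjunct2, THEN conjunct1, rule_format])
  show herm: "\<beta> y x = cnj (\<beta> x y)" for x y
    by (rule F[THEN conjunct2, THEN conjunct2, THEN conjunct1, rule_format])
  show "0 \<le> Re (\<beta> x x)"
    by (rule F[THEN conjunct2, THEN conjunct2, THEN conjunct2, rule_format])
  show "\<beta> (x + y) z = \<beta> x z + \<beta> y z"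
    by (simp only: herm[of _ z] add complex_cnj_add)
  show "\<beta> (c *\<^sub>C x) z = cnj c * \<beta> x z"
    by (simp only: herm[of _ z] scale complex_cnj_mult)
qed

lemma psd_form_null:
  assumes \<beta>: "psd_form \<beta>" and e: "\<beta> e e = 0"
  shows "\<beta> e v = 0"
proof (rule ccontr)
  assume "\<beta> e v \<noteq> 0"
  then have pos: "0 < (cmod (\<beta> e v))\<^sup>2" by simp
  note add = psd_formD(1)[OF \<beta>] and scale = psd_formD(2)[OF \<beta>] and herm = psd_formD(3)[OF \<beta>]
    and psd = psd_formD(4)[OF \<beta>] and add' = psd_formD(5)[OF \<beta>] and scale' = psd_formD(6)[OF \<beta>]
  \<comment> \<open>Large enough to push the form at \<open>v + c *\<^sub>C e\<close> down to
    -1.\<close>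
  define t where "t = (Re (\<beta> v v) + 1) / (2 * (cmod (\<beta> e v))\<^sup>2)"
  define c where "c = - of_real t * \<beta> e v"
  have "\<beta> (v + c *\<^sub>C e) (v + c *\<^sub>C e) = \<beta> v v + cnj c * \<beta> e v + c * \<beta> v e"
    by (simp add: add add' scale scale' e)
  also have "\<beta> v e = cnj (\<beta> e v)"
    by (rule herm)
  also have "cnj c * \<beta> e v = - of_real (t * (cmod (\<beta> e v))\<^sup>2)"
    using complex_norm_square[of "\<beta> e v"] by (simp add: c_def mult_ac)
  also have "c * cnj (\<beta> e v) = - of_real (t * (cmod (\<beta> e v))\<^sup>2)"
    using complex_norm_square[of "\<beta> e v"] by (simp add: c_def mult_ac)
  finally have "Re (\<beta> (v + c *\<^sub>C e) (v + c *\<^sub>C e)) = Re (\<beta> v v) - 2 * (t * (cmod (\<beta> e v))\<^sup>2)"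
    by simp
  also have "2 * (t * (cmod (\<beta> e v))\<^sup>2) = Re (\<beta> v v) + 1"
    using pos by (simp add: t_def)
  finally show False
    using psd[of "v + c *\<^sub>C e"] by simp
qed

text \<open>One Cholesky step, by a Schur complement: subtracting a rank-one square puts
  \<open>e\<close> into the radical and preserves positivity. The last clause ensures that vectors
  eliminated earlier stay in the radical.\<close>

lemma psd_form_eliminate:
  assumes \<beta>: "psd_form \<beta>"
  obtains \<phi> where "\<And>x y. \<phi> (x + y) = \<phi> x + \<phi> y" "\<And>c x. \<phi> (c *\<^sub>C x) = c * \<phi> x"
    "psd_form (\<lambda>u v. \<beta> u v - cnj (\<phi> u) * \<phi> v)" "\<And>v. \<beta> e v - cnj (\<phi> e) * \<phi> v = 0"
    "\<And>z. (\<And>v. \<beta> z v = 0) \<Longrightarrow> \<phi> z = 0"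
proof (cases "\<beta> e e = 0")
  case True
  show ?thesis
    by (rule that[of "\<lambda>_. 0"]) (use \<beta> psd_form_null[OF \<beta> True] in auto)
next
  case False
  note add = psd_formD(1)[OF \<beta>] and scale = psd_formD(2)[OF \<beta>] and herm = psd_formD(3)[OF \<beta>]
    and psd = psd_formD(4)[OF \<beta>] and add' = psd_formD(5)[OF \<beta>] and scale' = psd_formD(6)[OF \<beta>]
  define b where "b = Re (\<beta> e e)"
  have ee: "\<beta> e e = of_real b"
    using herm[of e e] by (simp add: b_def complex_eq_iff)
  have b: "b > 0"
  proof -
    have "b \<noteq> 0"
      using False ee by auto
    moreover have "b \<ge> 0"
      unfolding b_def by (rule psd)
    ultimately show ?thesis by simp
  qed
  define \<phi> where "\<phi> v = \<beta> e v / of_real (sqrt b)" for v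
  have prod: "cnj (\<phi> u) * \<phi> v = \<beta> u e * \<beta> e v / of_real b" for u v
  proof -
    have "cnj (\<phi> u) * \<phi> v = cnj (\<beta> e u) * \<beta> e v / of_real (sqrt b * sqrt b)"
      by (simp add: \<phi>_def del: real_sqrt_mult_self)
    then show ?thesis
      using b herm[of u e] by simp
  qed
  show ?thesis
  proof (rule that[of \<phi>])
    show "psd_form (\<lambda>u v. \<beta> u v - cnj (\<phi> u) * \<phi> v)"
      unfolding psd_form_def
    proof (intro conjI allI)
      fix x y z :: "'a ell2" and c :: complex
      show "\<beta> x (y + z) - cnj (\<phi> x) * \<phi> (y + z) = \<beta> x y - cnj (\<phi> x) * \<phi> y + (\<beta> x z - cnj (\<phi> x) * \<phi> z)"
        by (simp add: \<phi>_def add add_divide_distrib algebra_simps)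
      show "\<beta> x (c *\<^sub>C y) - cnj (\<phi> x) * \<phi> (c *\<^sub>C y) = c * (\<beta> x y - cnj (\<phi> x) * \<phi> y)"
        by (simp add: \<phi>_def scale algebra_simps)
      show "\<beta> y x - cnj (\<phi> y) * \<phi> x = cnj (\<beta> x y - cnj (\<phi> x) * \<phi> y)"
        using herm[of y x] by simp
      \<comment> \<open>Completing the square: this shift makes \<open>x + t *\<^sub>C e\<close>
        orthogonal to \<open>e\<close> for the form, and the form there equals the reduced form at
        \<open>x\<close>.\<close>
      define t where "t = - \<beta> e x / of_real b"
      have "\<beta> (x + t *\<^sub>C e) (x + t *\<^sub>C e) = \<beta> x x + t * \<beta> x e + cnj t * (\<beta> e x + t * \<beta> e e)"
        by (simp add: add add' scale scale' algebra_simps)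
      also have "\<beta> e x + t * \<beta> e e = 0"
        using b by (simp add: t_def ee)
      finally have "\<beta> (x + t *\<^sub>C e) (x + t *\<^sub>C e) = \<beta> x x - cnj (\<phi> x) * \<phi> x"
        by (simp add: prod t_def)
      then show "0 \<le> Re (\<beta> x x - cnj (\<phi> x) * \<phi> x)"
        using psd[of "x + t *\<^sub>C e"] by simp
    qed
    show "\<beta> e v - cnj (\<phi> e) * \<phi> v = 0" for v
      using b by (simp add: prod ee)
    show "\<phi> z = 0" if "\<And>v. \<beta> z v = 0" for z
      using herm[of e z] that by (simp add: \<phi>_def)
  qed (auto simp: \<phi>_def add scale add_divide_distrib)
qed

lemma psd_form_cholesky:
  fixes \<beta> :: "nat ell2 \<Rightarrow> nat ell2 \<Rightarrow> complex"
  assumes \<beta>: "psd_form \<beta>"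
  shows "\<exists>\<phi>. (\<forall>l x y. \<phi> l (x + y) = \<phi> l x + \<phi> l y) \<and> (\<forall>l c x. \<phi> l (c *\<^sub>C x) = c * \<phi> l x) \<and>
    psd_form (\<lambda>u v. \<beta> u v - (\<Sum>l<m. cnj (\<phi> l u) * \<phi> l v)) \<and>
    (\<forall>i<m. \<forall>v. \<beta> (ket i) v - (\<Sum>l<m. cnj (\<phi> l (ket i)) * \<phi> l v) = 0)"
proof (induction m)
  case 0
  show ?case
    by (rule exI[of _ "\<lambda>_ _. 0"]) (use \<beta> in auto)
next
  case (Suc m)
  then obtain \<phi> where \<phi>: "\<And>l x y. \<phi> l (x + y) = \<phi> l x + \<phi> l y" "\<And>l c x. \<phi> l (c *\<^sub>C x) = c * \<phi> l x"
    and psd: "psd_form (\<lambda>u v. \<beta> u v - (\<Sum>l<m. cnj (\<phi> l u) * \<phi> l v))"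
    and null: "\<And>i v. i < m \<Longrightarrow> \<beta> (ket i) v - (\<Sum>l<m. cnj (\<phi> l (ket i)) * \<phi> l v) = 0"
    by blast
  obtain \<psi> where \<psi>: "\<And>x y. \<psi> (x + y) = \<psi> x + \<psi> y" "\<And>c x. \<psi> (c *\<^sub>C x) = c * \<psi> x"
    "psd_form (\<lambda>u v. \<beta> u v - (\<Sum>l<m. cnj (\<phi> l u) * \<phi> l v) - cnj (\<psi> u) * \<psi> v)"
    "\<And>v. \<beta> (ket m) v - (\<Sum>l<m. cnj (\<phi> l (ket m)) * \<phi> l v) - cnj (\<psi> (ket m)) * \<psi> v = 0"
    "\<And>z. (\<And>v. \<beta> z v - (\<Sum>l<m. cnj (\<phi> l z) * \<phi> l v) = 0) \<Longrightarrow> \<psi> z = 0"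
    using psd_form_eliminate[OF psd, of "ket m"] by blast
  define \<omega> where "\<omega> l = (if l = m then \<psi> else \<phi> l)" for l
  have sum: "\<beta> u v - (\<Sum>l<Suc m. cnj (\<omega> l u) * \<omega> l v) =
      \<beta> u v - (\<Sum>l<m. cnj (\<phi> l u) * \<phi> l v) - cnj (\<psi> u) * \<psi> v" for u v
    by (simp add: \<omega>_def)
  have "\<beta> (ket i) v - (\<Sum>l<Suc m. cnj (\<omega> l (ket i)) * \<omega> l v) = 0" if "i < Suc m" for i v
    unfolding sum using that null[of i] \<psi>(4) \<psi>(5)[of "ket i"] by (cases "i = m") auto
  then show ?case
    using \<phi> \<psi>(1-3) by (intro exI[of _ \<omega>]) (simp only: sum, simp add: \<omega>_def)
qed

lemma vec_space_expand:
  assumes "x \<in> vec_space (enat n)"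
  shows "x = (\<Sum>i<n. ell2_coeff x i *\<^sub>C ket i)"
  by (rule ell2_eqI) (use assms in \<open>auto simp: vec_space_def if_distrib cong: if_cong\<close>)

text \<open>After \<open>n\<close> elimination steps the remainder vanishes on C^n. This stands in
  for the square root of the defect operator in the Poisson kernel.\<close>

lemma psd_form_sum_squares:
  fixes \<beta> :: "nat ell2 \<Rightarrow> nat ell2 \<Rightarrow> complex"
  assumes \<beta>: "psd_form \<beta>"
  obtains c :: "nat \<Rightarrow> nat \<Rightarrow> complex" where
    "\<And>u. u \<in> vec_space (enat n) \<Longrightarrow> \<beta> u u = of_real (\<Sum>l<n. (cmod (\<Sum>i<n. c l i * ell2_coeff u i))\<^sup>2)"
proof -
  obtain \<phi> where \<phi>: "\<And>l x y. \<phi> l (x + y) = \<phi> l x + \<phi> l y" "\<And>l c x. \<phi> l (c *\<^sub>C x) = c * \<phi> l x"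
    and psd: "psd_form (\<lambda>u v. \<beta> u v - (\<Sum>l<n. cnj (\<phi> l u) * \<phi> l v))"
    and null: "\<And>i v. i < n \<Longrightarrow> \<beta> (ket i) v - (\<Sum>l<n. cnj (\<phi> l (ket i)) * \<phi> l v) = 0"
    using psd_form_cholesky[OF \<beta>, of n] by blast
  define \<gamma> where "\<gamma> u v = \<beta> u v - (\<Sum>l<n. cnj (\<phi> l u) * \<phi> l v)" for u v
  have "psd_form \<gamma>"
    using psd by (simp only: \<gamma>_def[abs_def])
  note add = psd_formD(1)[OF this] and scale = psd_formD(2)[OF this] and herm = psd_formD(3)[OF this]
  have zero: "\<gamma> x 0 = 0" "\<phi> l 0 = 0" for x l
    using scale[of x 0 0] \<phi>(2)[of l 0 0] by simp_all
  have g_sum: "\<gamma> x (\<Sum>i\<in>A. a i *\<^sub>C ket i) = (\<Sum>i\<in>A. a i * \<gamma> x (ket i))" if "finite A" for x a A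
    using that by (induction A rule: finite_induct) (auto simp: add scale zero)
  have phi_sum: "\<phi> l (\<Sum>i\<in>A. a i *\<^sub>C ket i) = (\<Sum>i\<in>A. a i * \<phi> l (ket i))" if "finite A" for l a A
    using that by (induction A rule: finite_induct) (auto simp: \<phi> zero)
  show ?thesis
  proof (rule that[of "\<lambda>l i. \<phi> l (ket i)"])
    fix u assume u: "u \<in> vec_space (enat n)"
    have "\<gamma> u (ket i) = 0" if "i < n" for i
      using null[OF that, of u] herm[of u "ket i"] by (simp add: \<gamma>_def)
    then have "\<gamma> u u = 0"
      by (subst (2) vec_space_expand[OF u]) (simp add: g_sum)
    moreover have "\<phi> l u = (\<Sum>i<n. \<phi> l (ket i) * ell2_coeff u i)" for l
      by (subst vec_space_expand[OF u]) (simp add: phi_sum mult.commute del: ell2_coeff_sum)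
    ultimately show "\<beta> u u = of_real (\<Sum>l<n. (cmod (\<Sum>i<n. \<phi> l (ket i) * ell2_coeff u i))\<^sup>2)"
      by (simp add: \<gamma>_def complex_norm_square[unfolded of_real_power] mult.commute)
  qed
qed

section \<open>Adjoints, the defect form and the Poisson kernel at a finite level\<close>

definition op_adjoint :: "nat \<Rightarrow> operator \<Rightarrow> nat ell2 \<Rightarrow> nat ell2" where
  "op_adjoint n T y = (\<Sum>i<n. cinner (blinfun_apply T (ket i)) y *\<^sub>C ket i)"

lemma ell2_coeff_op_adjoint:
  "ell2_coeff (op_adjoint n T y) i = (if i < n then cinner (blinfun_apply T (ket i)) y else 0)"
  by (simp add: op_adjoint_def if_distrib cong: if_cong)

lemma op_adjoint_vec_space: "op_adjoint n T y \<in> vec_space (enat n)"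
  by (simp add: vec_space_def ell2_coeff_op_adjoint)

lemma op_adjoint:
  assumes T: "T \<in> mat_space (enat n)" and x: "x \<in> vec_space (enat n)"
  shows "cinner (op_adjoint n T y) x = cinner y (blinfun_apply T x)"
proof -
  have "blinfun_apply T x = (\<Sum>i<n. ell2_coeff x i *\<^sub>C blinfun_apply T (ket i))"
    by (subst vec_space_expand[OF x]) (simp add: blinfun.sum_right mat_spaceD[OF T])
  then have "cinner y (blinfun_apply T x) = (\<Sum>i<n. ell2_coeff x i * cinner y (blinfun_apply T (ket i)))"
    by (simp add: cinner_sum_right)
  also have "\<dots> = cinner (op_adjoint n T y) x"
    unfolding op_adjoint_def cinner_sum_left
    by (rule sum.cong) (auto simp: cinner_commute[of _ y] mult.commute)
  finally show ?thesis ..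
qed

lemma op_adjoint_compose:
  assumes S: "S \<in> mat_space (enat n)" and T: "T \<in> mat_space (enat n)"
  shows "op_adjoint n (S o\<^sub>L T) y = op_adjoint n T (op_adjoint n S y)"
proof (rule ell2_eqI)
  fix i
  have "cinner (blinfun_apply S (blinfun_apply T (ket i))) y = cinner (blinfun_apply T (ket i)) (op_adjoint n S y)"
    using op_adjoint[OF S mat_spaceD(4)[OF T], of y "ket i"]
    by (subst (1 2) cinner_commute) simp
  then show "ell2_coeff (op_adjoint n (S o\<^sub>L T) y) i = ell2_coeff (op_adjoint n T (op_adjoint n S y)) i"
    by (simp add: ell2_coeff_op_adjoint)
qed

context
  fixes n :: nat and r :: real and Z :: "'d::countable \<Rightarrow> operator"
  assumes Z: "row_bound (enat n) r Z" and r: "r < 1"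
begin

lemma row_bound_nonneg: "0 \<le> r"
  using Z by (simp add: row_bound_def)

text \<open>Duality turns the row bound into a column bound: the sum \<open>S\<close> is the pairing
  of \<open>u\<close> with the row applied to the adjoint column, hence at most
  \<open>norm u * sqrt S\<close>, and one factor \<open>sqrt S\<close> cancels.\<close>

lemma sum_op_adjoint_le:
  assumes K: "finite K"
  shows "(\<Sum>k\<in>K. (norm (op_adjoint n (Z k) u))\<^sup>2) \<le> (norm u)\<^sup>2"
proof -
  define S where "S = (\<Sum>k\<in>K. (norm (op_adjoint n (Z k) u))\<^sup>2)"
  have S0: "0 \<le> S"
    unfolding S_def by (intro sum_nonneg) auto
  have "of_real S = (\<Sum>k\<in>K. cinner u ((Z k) (op_adjoint n (Z k) u)))"
    by (simp add: S_def cinner_self[symmetric, unfolded of_real_power]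
        op_adjoint[OF row_bound_mat[OF Z r] op_adjoint_vec_space])
  also have "\<dots> = cinner u (\<Sum>k\<in>K. (Z k) (op_adjoint n (Z k) u))"
    by (simp add: cinner_sum_right)
  finally have "S \<le> cmod (cinner u (\<Sum>k\<in>K. (Z k) (op_adjoint n (Z k) u)))"
    using eq_cmod_of_real[OF _ S0] by (metis order_refl)
  also have "\<dots> \<le> norm u * norm (\<Sum>k\<in>K. (Z k) (op_adjoint n (Z k) u))"
    by (rule cinner_norm_le)
  also have "\<dots> \<le> norm u * sqrt S"
  proof (rule mult_left_mono)
    have "(norm (\<Sum>k\<in>K. (Z k) (op_adjoint n (Z k) u)))\<^sup>2 \<le> r\<^sup>2 * S"
      unfolding S_def by (intro row_boundD[OF Z K] op_adjoint_vec_space)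
    also have "\<dots> \<le> S"
      using r row_bound_nonneg S0 by (intro mult_left_le_one_le) (auto simp: power_le_one)
    finally show "norm (\<Sum>k\<in>K. (Z k) (op_adjoint n (Z k) u)) \<le> sqrt S"
      by (rule real_le_rsqrt)
  qed simp
  finally have "sqrt S * sqrt S \<le> norm u * sqrt S"
    using S0 by simp
  then have "sqrt S \<le> norm u"
    by (rule le_of_mult_self_le) (use S0 in auto)
  then have "(sqrt S)\<^sup>2 \<le> (norm u)\<^sup>2"
    using S0 by (intro power_mono) auto
  then show ?thesis
    using S0 by (simp add: S_def)
qed

lemma summable_op_adjoint: "(\<lambda>k. (norm (op_adjoint n (Z k) u))\<^sup>2) summable_on UNIV"
  by (rule nonneg_bounded_partial_sums_imp_summable_on[where C = "(norm u)\<^sup>2"])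
    (auto intro!: eventually_finite_subsets_at_top_weakI sum_op_adjoint_le)

text \<open>On C^n this is the form of the defect operator, the identity minus the sum of the
  products of \<open>Z k\<close> with its adjoint.\<close>

definition defect_form :: "nat ell2 \<Rightarrow> nat ell2 \<Rightarrow> complex" where
  "defect_form u v = cinner u v - (\<Sum>\<^sub>\<infinity>k. cinner (op_adjoint n (Z k) u) (op_adjoint n (Z k) v))"

lemma defect_form_self:
  "defect_form u u = of_real ((norm u)\<^sup>2 - (\<Sum>\<^sub>\<infinity>k. (norm (op_adjoint n (Z k) u))\<^sup>2))"
proof -
  have "((\<lambda>k. of_real ((norm (op_adjoint n (Z k) u))\<^sup>2) :: complex) has_sum
      of_real (\<Sum>\<^sub>\<infinity>k. (norm (op_adjoint n (Z k) u))\<^sup>2)) UNIV"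
    by (intro has_sum_of_real has_sum_infsum summable_op_adjoint)
  then show ?thesis
    by (simp add: defect_form_def cinner_self infsumI)
qed

lemma psd_defect_form: "psd_form defect_form"
  unfolding psd_form_def
proof (intro conjI allI)
  let ?A = "\<lambda>k. op_adjoint n (Z k)"
  have summ: "(\<lambda>k. cinner (?A k u) (?A k v)) summable_on UNIV" for u v
  proof (rule abs_summable_summable, rule summable_on_comparison_test)
    show "(\<lambda>k. (norm (?A k u))\<^sup>2 + (norm (?A k v))\<^sup>2) summable_on UNIV"
      by (intro summable_on_add summable_op_adjoint)
    show "norm (cinner (?A k u) (?A k v)) \<le> (norm (?A k u))\<^sup>2 + (norm (?A k v))\<^sup>2" for k
    proof -
      have "norm (cinner (?A k u) (?A k v)) \<le> norm (?A k u) * norm (?A k v)"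
        by (rule cinner_norm_le)
      also have "\<dots> \<le> (norm (?A k u))\<^sup>2 + (norm (?A k v))\<^sup>2"
      proof -
        have "0 \<le> norm (?A k u) * norm (?A k v)"
          by simp
        moreover have "2 * (norm (?A k u) * norm (?A k v)) \<le> (norm (?A k u))\<^sup>2 + (norm (?A k v))\<^sup>2"
          using sum_squares_bound[of "norm (?A k u)" "norm (?A k v)"] by (simp only: mult.assoc)
        ultimately show ?thesis by linarith
      qed
      finally show ?thesis .
    qed
  qed auto
  have A_add: "?A k (x + y) = ?A k x + ?A k y" and A_scale: "?A k (c *\<^sub>C x) = c *\<^sub>C ?A k x" for k x y c
    by (auto intro!: ell2_eqI simp: ell2_coeff_op_adjoint cinner_add_right plus_ell2.rep_eq scaleC.rep_eq)
  fix x y z :: "nat ell2" and c :: complex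
  show "defect_form x (y + z) = defect_form x y + defect_form x z"
    by (simp add: defect_form_def A_add cinner_add_right infsum_add[OF summ summ])
  show "defect_form x (c *\<^sub>C y) = c * defect_form x y"
    by (simp add: defect_form_def A_scale infsum_cmult_right' algebra_simps)
  have "(\<Sum>\<^sub>\<infinity>k. cinner (?A k y) (?A k x)) = cnj (\<Sum>\<^sub>\<infinity>k. cinner (?A k x) (?A k y))"
    unfolding infsum_cnj[symmetric] by (intro infsum_cong) (rule cinner_commute)
  then show "defect_form y x = cnj (defect_form x y)"
    using cinner_commute[of y x] by (simp add: defect_form_def)
  have "(\<Sum>\<^sub>\<infinity>k. (norm (?A k x))\<^sup>2) \<le> (norm x)\<^sup>2"
    by (rule infsum_le_finite_sums[OF summable_op_adjoint sum_op_adjoint_le])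
  then show "0 \<le> Re (defect_form x x)"
    unfolding defect_form_self by simp
qed

text \<open>The NC Szego kernel vectors at \<open>Z\<close>: the functional \<open>g \<mapsto> y\<^sup>* g(Z) e\<^sub>i\<close> on the Fock space.\<close>

definition kernel_vec :: "nat \<Rightarrow> nat ell2 \<Rightarrow> 'd fock" where
  "kernel_vec i y = Abs_ell2 (\<lambda>\<alpha>. cinner ((word_op (enat n) Z \<alpha>) (ket i)) y)"

lemma ell2_coeff_kernel_vec:
  "ell2_coeff (kernel_vec i y) \<alpha> = cinner ((word_op (enat n) Z \<alpha>) (ket i)) y"
proof -
  let ?c = "\<lambda>\<alpha>. cinner ((word_op (enat n) Z \<alpha>) (ket i)) y"
  have "ell2_le (1 / (1 - r) * norm y) ?c"
    unfolding ell2_le_def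
  proof (intro conjI allI impI)
    show "0 \<le> 1 / (1 - r) * norm y"
      using r by simp
    fix A :: "'d list set" assume A: "finite A"
    define S where "S = (\<Sum>\<alpha>\<in>A. (cmod (?c \<alpha>))\<^sup>2)"
    have S0: "0 \<le> S"
      unfolding S_def by (intro sum_nonneg) auto
    \<comment> \<open>Testing the functional on its own coefficients makes the pairing equal to
      \<open>S\<close>, while the evaluation bound limits it by a multiple of
      \<open>sqrt S\<close>.\<close>
    let ?T = "\<Sum>\<alpha>\<in>A. ?c \<alpha> *\<^sub>O word_op (enat n) Z \<alpha>"
    have "(norm ?T)\<^sup>2 \<le> (1 / (1 - r))\<^sup>2 * S"
      using nc_sum_bound[OF Z r A, of ?c] by (simp add: S_def sum_distrib_left)
    also have "\<dots> = (1 / (1 - r) * sqrt S)\<^sup>2"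
      unfolding power_mult_distrib using S0 by simp
    finally have T: "norm ?T \<le> 1 / (1 - r) * sqrt S"
      by (rule power2_le_imp_le) (use r S0 in simp)
    have "of_real S = cinner (?T (ket i)) y"
      by (simp add: S_def cinner_sum_left blinfun.sum_left complex_norm_square[unfolded of_real_power] mult.commute)
    from this S0 have "S = cmod (cinner (?T (ket i)) y)"
      by (rule eq_cmod_of_real)
    also have "\<dots> \<le> norm (?T (ket i)) * norm y"
      by (rule cinner_norm_le)
    also have "\<dots> \<le> (1 / (1 - r) * sqrt S) * norm y"
      using norm_blinfun[of ?T "ket i"] T by (intro mult_right_mono) auto
    finally have "sqrt S * sqrt S \<le> (1 / (1 - r) * norm y) * sqrt S"
      using S0 by (simp add: mult_ac)
    then have "sqrt S \<le> 1 / (1 - r) * norm y"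
      by (rule le_of_mult_self_le) (use S0 r in auto)
    then have "(sqrt S)\<^sup>2 \<le> (1 / (1 - r) * norm y)\<^sup>2"
      using S0 by (intro power_mono) auto
    then show "(\<Sum>\<alpha>\<in>A. (cmod (?c \<alpha>))\<^sup>2) \<le> (1 / (1 - r) * norm y)\<^sup>2"
      using S0 by (simp add: S_def)
  qed
  from ell2_le_Abs(1)[OF this] show ?thesis
    by (simp add: kernel_vec_def)
qed

lemma cinner_kernel_vec:
  "cinner (kernel_vec i y) g = cinner y ((nc_sum (enat n) g Z) (ket i))"
proof -
  have "((\<lambda>\<alpha>. cinner y (ell2_coeff g \<alpha> *\<^sub>C (word_op (enat n) Z \<alpha>) (ket i))) has_sum
      cinner y ((nc_sum (enat n) g Z) (ket i))) UNIV"
    by (intro has_sum_bounded_linear[OF bounded_linear_cinner_right] has_sum_nc_sum_apply[OF Z r])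
  also have "(\<lambda>\<alpha>. cinner y (ell2_coeff g \<alpha> *\<^sub>C (word_op (enat n) Z \<alpha>) (ket i))) =
      (\<lambda>\<alpha>. cnj (ell2_coeff (kernel_vec i y) \<alpha>) * ell2_coeff g \<alpha>)"
    by (rule ext) (simp add: ell2_coeff_kernel_vec cinner_commute[of y] mult.commute)
  finally show ?thesis
    using has_sum_unique[OF has_sum_cinner] by metis
qed

text \<open>The Poisson kernel is isometric. Let u_\<alpha> be the adjoint of the word \<alpha> in
  \<open>Z\<close> applied to \<open>y\<close>. The defect form at u_\<alpha> is its squared norm
  minus the squared norms of all u_{\<alpha>k}; summed over all words this telescopes to the empty
  word, whose contribution is the squared norm of \<open>y\<close>. The sums are finite because the
  kernel vectors lie in the Fock space.\<close>

lemma poisson_identity: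
  assumes c: "\<And>u. u \<in> vec_space (enat n) \<Longrightarrow>
      defect_form u u = of_real (\<Sum>l<n. (cmod (\<Sum>i<n. c l i * ell2_coeff u i))\<^sup>2)"
    and y: "y \<in> vec_space (enat n)"
  shows "(\<Sum>l<n. (norm (\<Sum>i<n. c l i *\<^sub>C kernel_vec i y))\<^sup>2) = (norm y)\<^sup>2"
proof -
  define u where "u \<alpha> = op_adjoint n (word_op (enat n) Z \<alpha>) y" for \<alpha>
  note Zm = row_bound_mat[OF Z r]
  note Wm = word_op_mat_space[OF Zm]
  have u_coeff: "ell2_coeff (u \<alpha>) i = ell2_coeff (kernel_vec i y) \<alpha>" if "i < n" for i \<alpha>
    using that by (simp add: u_def ell2_coeff_op_adjoint ell2_coeff_kernel_vec)
  have u_vec: "u \<alpha> \<in> vec_space (enat n)" for \<alpha>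
    by (simp add: u_def op_adjoint_vec_space)
  have u_Nil: "u [] = y"
  proof (rule cinner_eqI)
    fix z
    have "cinner (u []) (truncate (enat n) z) = cinner y (truncate (enat n) z)"
      unfolding u_def by (subst op_adjoint[OF Wm]) auto
    moreover have "cinner v z = cinner v (truncate (enat n) z)" if "v \<in> vec_space (enat n)" for v
      unfolding cinner.rep_eq by (rule infsum_cong) (use that in \<open>auto simp: vec_space_def\<close>)
    ultimately have "cinner (u []) z = cinner y z"
      using u_vec y by metis
    then show "cinner z (u []) = cinner z y"
      by (subst (1 2) cinner_commute) simp
  qed
  have u_snoc: "u (\<alpha> @ [k]) = op_adjoint n (Z k) (u \<alpha>)" for \<alpha> k
    by (simp add: u_def word_op_append[OF Zm] op_adjoint_compose[OF Wm Zm] mat_spaceD(6)[OF Zm])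
  define b where "b \<alpha> = (norm (u \<alpha>))\<^sup>2" for \<alpha>
  have b_eq: "b \<alpha> = (\<Sum>i<n. (cmod (ell2_coeff (kernel_vec i y) \<alpha>))\<^sup>2)" for \<alpha>
    unfolding b_def by (subst vec_space_expand[OF u_vec]) (simp add: norm_sum_ket u_coeff)
  define S where "S = (\<Sum>i<n. (norm (kernel_vec i y))\<^sup>2)"
  have b_sum: "(b has_sum S) UNIV"
    unfolding b_eq[abs_def] S_def by (intro has_sum_sum has_sum_norm_ell2) simp
  let ?c = "\<lambda>\<alpha>. \<Sum>\<^sub>\<infinity>k. (norm (op_adjoint n (Z k) (u \<alpha>)))\<^sup>2"
  let ?k = "\<lambda>l. \<Sum>i<n. c l i *\<^sub>C kernel_vec i y"
  \<comment> \<open>Each nonempty word is a unique word followed by one letter, so the subtracted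
    terms sum to everything but the empty word.\<close>
  have "(b has_sum (S - b [])) (UNIV - {[]})"
    by (rule has_sum_Diff[OF b_sum has_sum_finiteI]) auto
  then have "((\<lambda>(\<alpha>, k). b (\<alpha> @ [k])) has_sum (S - b [])) (Sigma UNIV (\<lambda>_. UNIV))"
    by (subst (asm) has_sum_reindex_bij_witness[where i = "\<lambda>(\<alpha>, k). \<alpha> @ [k]"
          and j = "\<lambda>w. (butlast w, last w)" and T = "Sigma UNIV (\<lambda>_. UNIV)"
          and h = "\<lambda>(\<alpha>, k). b (\<alpha> @ [k])" and s' = "S - b []"]) auto
  moreover have "((\<lambda>k. (\<lambda>(\<alpha>, k). b (\<alpha> @ [k])) (\<alpha>, k)) has_sum ?c \<alpha>) UNIV" for \<alpha>
    using has_sum_infsum[OF summable_op_adjoint[of "u \<alpha>"]] by (simp add: b_def u_snoc)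
  ultimately have "((\<lambda>\<alpha>. ?c \<alpha>) has_sum (S - b [])) UNIV"
    by (rule has_sum_SigmaD)
  then have "((\<lambda>\<alpha>. b \<alpha> + - ?c \<alpha>) has_sum (S + - (S - b []))) UNIV"
    by (intro has_sum_add b_sum) (simp add: has_sum_uminus)
  moreover have "b \<alpha> + - ?c \<alpha> =
      (\<Sum>l<n. (cmod (ell2_coeff (?k l) \<alpha>))\<^sup>2)" for \<alpha>
  proof -
    have "complex_of_real (b \<alpha> + - ?c \<alpha>) =
        of_real (\<Sum>l<n. (cmod (\<Sum>i<n. c l i * ell2_coeff (u \<alpha>) i))\<^sup>2)"
      unfolding c[OF u_vec, symmetric] defect_form_self b_def by simp
    also have "\<dots> = of_real (\<Sum>l<n. (cmod (ell2_coeff (?k l) \<alpha>))\<^sup>2)"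
      by (simp add: u_coeff)
    finally show ?thesis
      using of_real_eq_iff by blast
  qed
  ultimately have "((\<lambda>\<alpha>. \<Sum>l<n. (cmod (ell2_coeff (?k l) \<alpha>))\<^sup>2) has_sum b []) UNIV"
    by simp
  moreover have "((\<lambda>\<alpha>. \<Sum>l<n. (cmod (ell2_coeff (?k l) \<alpha>))\<^sup>2) has_sum
      (\<Sum>l<n. (norm (?k l))\<^sup>2)) UNIV"
    by (intro has_sum_sum has_sum_norm_ell2) simp
  ultimately have "b [] = (\<Sum>l<n. (norm (?k l))\<^sup>2)"
    by (rule has_sum_unique)
  then show ?thesis
    by (simp add: b_def u_Nil)
qed

text \<open>The adjoint of left multiplication by \<open>f\<close> sends the kernel vector of
  \<open>y\<close> to that of the adjoint of f(Z) applied to \<open>y\<close>. It acts on all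
  indices \<open>i\<close> alike, hence on combinations with fixed coefficients \<open>c\<close>,
  and has norm at most \<open>M\<close>.\<close>

lemma kernel_vec_multiplier:
  assumes f: "multiplier M f"
  shows "norm (\<Sum>i<n. c i *\<^sub>C kernel_vec i (op_adjoint n (nc_sum (enat n) f Z) y)) \<le>
    M * norm (\<Sum>i<n. c i *\<^sub>C kernel_vec i y)"
    (is "norm ?k' \<le> M * norm ?k")
proof -
  note F = nc_sum_mat_space[OF Z r]
  have "cinner (kernel_vec i (op_adjoint n (nc_sum (enat n) f Z) y)) g = cinner (kernel_vec i y) (fmul f g)" for i g
    by (simp add: cinner_kernel_vec nc_sum_fmul[OF Z r f] op_adjoint[OF F mat_spaceD(4)[OF F]])
  then have "cinner ?k' g = cinner ?k (fmul f g)" for g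
    by (simp add: cinner_sum_left)
  then have "of_real ((norm ?k')\<^sup>2) = cinner ?k (fmul f ?k')"
    by (simp only: cinner_self[symmetric])
  then have "(norm ?k')\<^sup>2 = cmod (cinner ?k (fmul f ?k'))"
    by (rule eq_cmod_of_real) simp
  also have "\<dots> \<le> norm ?k * norm (fmul f ?k')"
    by (rule cinner_norm_le)
  also have "\<dots> \<le> norm ?k * (M * norm ?k')"
    by (intro mult_left_mono multiplierD[OF f]) simp
  finally have "norm ?k' * norm ?k' \<le> (M * norm ?k) * norm ?k'"
    by (simp add: power2_eq_square mult_ac)
  then show ?thesis
    by (rule le_of_mult_self_le) (use multiplier_nonneg[OF f] in auto)
qed

text \<open>The Poisson isometry intertwines the adjoint of f(Z) with copies of the adjoint of left
  multiplication, so the bound \<open>M\<close> carries over; a pairing then transfers it from the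
  adjoint to f(Z).\<close>

theorem von_neumann_inequality:
  assumes f: "multiplier M f"
  shows "norm (nc_sum (enat n) f Z) \<le> M"
proof -
  obtain c :: "nat \<Rightarrow> nat \<Rightarrow> complex" where c: "\<And>u. u \<in> vec_space (enat n) \<Longrightarrow>
      defect_form u u = of_real (\<Sum>l<n. (cmod (\<Sum>i<n. c l i * ell2_coeff u i))\<^sup>2)"
    using psd_form_sum_squares[OF psd_defect_form, of n] by blast
  define T where "T = nc_sum (enat n) f Z"
  have T: "T \<in> mat_space (enat n)"
    unfolding T_def by (rule nc_sum_mat_space[OF Z r])
  have M: "0 \<le> M"
    by (rule multiplier_nonneg[OF f])
  have adj: "norm (op_adjoint n T y) \<le> M * norm y" if y: "y \<in> vec_space (enat n)" for y
  proof (rule power2_le_imp_le)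
    have "(norm (op_adjoint n T y))\<^sup>2 = (\<Sum>l<n. (norm (\<Sum>i<n. c l i *\<^sub>C kernel_vec i (op_adjoint n T y)))\<^sup>2)"
      by (rule poisson_identity[OF c op_adjoint_vec_space, symmetric])
    also have "\<dots> \<le> (\<Sum>l<n. (M * norm (\<Sum>i<n. c l i *\<^sub>C kernel_vec i y))\<^sup>2)"
      unfolding T_def by (intro sum_mono power_mono kernel_vec_multiplier f) auto
    also have "\<dots> = M\<^sup>2 * (\<Sum>l<n. (norm (\<Sum>i<n. c l i *\<^sub>C kernel_vec i y))\<^sup>2)"
      by (simp add: power_mult_distrib sum_distrib_left)
    also have "\<dots> = M\<^sup>2 * (norm y)\<^sup>2"
      by (simp only: poisson_identity[OF c y])
    finally show "(norm (op_adjoint n T y))\<^sup>2 \<le> (M * norm y)\<^sup>2"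
      by (simp add: power_mult_distrib)
  qed (use M in simp)
  show ?thesis
    unfolding T_def[symmetric]
  proof (rule norm_blinfun_bound[OF M])
    fix x
    let ?y = "blinfun_apply T x"
    have "of_real ((norm ?y)\<^sup>2) = cinner (op_adjoint n T ?y) (truncate (enat n) x)"
      by (simp add: op_adjoint[OF T] mat_spaceD[OF T] cinner_self)
    then have "(norm ?y)\<^sup>2 = cmod (cinner (op_adjoint n T ?y) (truncate (enat n) x))"
      by (rule eq_cmod_of_real) simp
    also have "\<dots> \<le> norm (op_adjoint n T ?y) * norm (truncate (enat n) x)"
      by (rule cinner_norm_le)
    also have "\<dots> \<le> (M * norm ?y) * norm x"
      using M by (intro mult_mono adj norm_truncate_le mat_spaceD(4)[OF T]) auto
    finally have "norm ?y * norm ?y \<le> (M * norm x) * norm ?y"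
      by (simp add: power2_eq_square mult_ac)
    then show "norm ?y \<le> M * norm x"
      by (rule le_of_mult_self_le) (use M in auto)
  qed
qed

end

lemma multiplier_imp_H_inf:
  fixes f :: "'d::countable fock"
  assumes f: "multiplier M f"
  shows "f \<in> H_inf"
  unfolding H_inf_def
proof (intro CollectI exI allI impI ballI)
  fix n :: nat and Z :: "'d \<Rightarrow> operator"
  assume "Z \<in> row_ball (enat n)"
  then obtain r where r: "r < 1" "row_bound (enat n) r Z"
    by (rule row_ball_imp_row_bound)
  show "norm (nc_eval (enat n) f Z) \<le> M"
    unfolding nc_eval_eq[OF r(2,1)] by (rule von_neumann_inequality[OF r(2,1) f])
qed

section \<open>Inner-outer factorization\<close>

definition isometric_multiplier :: "'d fock \<Rightarrow> bool" where
  "isometric_multiplier \<theta> \<longleftrightarrow> multiplier 1 \<theta> \<and> (\<forall>g. norm (fmul \<theta> g) = norm g)"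

lemma isometric_multiplier_nonzero:
  fixes \<theta> :: "'d fock"
  assumes "isometric_multiplier \<theta>"
  shows "\<theta> \<noteq> 0"
proof
  assume "\<theta> = 0"
  moreover have "norm (fmul \<theta> (ket [])) = norm (ket [] :: 'd fock)"
    using assms unfolding isometric_multiplier_def by blast
  ultimately show False by simp
qed

lemma cyc_right_invariant:
  assumes "x \<in> cyc f"
  shows "fmul x (ket w) \<in> cyc f"
proof -
  have "cyc f \<subseteq> (\<lambda>x. fmul x (ket w)) -` cyc f"
    by (intro cyc_least closed_csubspace_vimage closed_csubspace_cyc bounded_linear_fmul_ket fmul_ket_scaleC)
      (simp add: fmul_ket_assoc fmul_ket_in_cyc)
  with assms show ?thesis by auto
qed

lemma cyc_mono: "g \<in> cyc f \<Longrightarrow> cyc g \<subseteq> cyc f"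
  by (intro cyc_least closed_csubspace_cyc cyc_right_invariant)

lemma one_in_cyc_imp_UNIV: "ket [] \<in> cyc g \<Longrightarrow> cyc g = UNIV"
  using cyc_mono[of "ket []" g] by (auto simp: cyc_ket_Nil)

lemma fmul_poly_in_cyc:
  assumes "poly p"
  shows "fmul f p \<in> cyc f"
proof -
  note M = closed_csubspaceD[OF closed_csubspace_cyc[of f]]
  have sum: "(\<Sum>w\<in>A. c w *\<^sub>C fmul f (ket w)) \<in> cyc f" if "finite A" for A and c :: "'a list \<Rightarrow> complex"
    using that by (induction A rule: finite_induct) (auto intro: M fmul_ket_in_cyc)
  have "finite {w. ell2_coeff p w \<noteq> 0}"
    using assms by (simp add: poly_def)
  from fmul_poly(2)[OF this, of f "ell2_coeff p"] sum[OF this, of "ell2_coeff p"] show ?thesis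
    by (metis poly_eq[OF assms])
qed

lemma closed_csubspace_kernels:
  fixes F :: "'i \<Rightarrow> 'a ell2 \<Rightarrow> complex"
  assumes F: "\<And>i. i \<in> I \<Longrightarrow> bounded_linear (F i)" "\<And>i c x. i \<in> I \<Longrightarrow> F i (c *\<^sub>C x) = c * F i x"
  shows "closed_csubspace {x. \<forall>i\<in>I. F i x = 0}"
proof -
  have "closed (\<Inter>i\<in>I. {x. F i x = 0})"
    by (intro closed_INT ballI closed_Collect_eq continuous_intros linear_continuous_on F)
  also have "(\<Inter>i\<in>I. {x. F i x = 0}) = {x. \<forall>i\<in>I. F i x = 0}"
    by auto
  finally show ?thesis
    using F by (auto simp: closed_csubspace_def bounded_linear.linear linear_0 linear_add)
qed

lemma in_cycI:
  assumes "\<And>e. 0 < e \<Longrightarrow> \<exists>p. poly p \<and> norm (fmul f p - x) < e"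
  shows "x \<in> cyc f"
proof -
  have "x \<in> closure (cyc f)"
    unfolding closure_approachable dist_norm using assms fmul_poly_in_cyc by blast
  then show ?thesis
    using closure_closed[OF closed_csubspaceD(1)[OF closed_csubspace_cyc[of f]]] by blast
qed

text \<open>At a shortest word in the support of \<open>f\<close> every proper translate of
  \<open>f\<close> has coefficient zero. Hence the wandering vector of \<open>cyc f\<close> is
  nonzero.\<close>

lemma not_in_cyc_tail:
  assumes "f \<noteq> 0"
  shows "f \<notin> closed_cspan ((\<lambda>w. fmul f (ket w)) ` (- {[]}))"
proof -
  obtain v where v: "ell2_coeff f v \<noteq> 0" "\<And>u. ell2_coeff f u \<noteq> 0 \<Longrightarrow> length v \<le> length u"
    using ell2_ne_zeroD[OF assms] ex_has_least_nat[of "\<lambda>v. ell2_coeff f v \<noteq> 0" _ length] by fast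
  have "ell2_coeff (fmul f (ket w)) v = 0" if "w \<noteq> []" for w
  proof (cases "\<exists>u. v = u @ w")
    case True
    then obtain u where u: "v = u @ w" by blast
    with that have "length u < length v" by simp
    then have "ell2_coeff f u = 0"
      using v(2)[of u] by auto
    with u show ?thesis by simp
  next
    case False
    then show ?thesis
      unfolding ell2_coeff_fmul_ket by (intro conv_ket_not_suffix) auto
  qed
  then have "(\<lambda>w. fmul f (ket w)) ` (- {[]}) \<subseteq> {x. \<forall>y\<in>{ket v}. cinner y x = 0}"
    by auto
  then have "closed_cspan ((\<lambda>w. fmul f (ket w)) ` (- {[]})) \<subseteq> {x. \<forall>y\<in>{ket v}. cinner y x = 0}"
    by (rule closed_cspan_least[OF closed_csubspace_orthogonal])
  with v(1) show ?thesis by auto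
qed

text \<open>The adjoint of right multiplication by \<open>w\<close>; see
  \<open>cinner_backshift\<close>.\<close>

definition backshift :: "'d list \<Rightarrow> 'd fock \<Rightarrow> 'd fock" where
  "backshift w h = Abs_ell2 (\<lambda>u. ell2_coeff h (u @ w))"

lemma ell2_le_backshift: "ell2_le (norm h) (\<lambda>u. ell2_coeff h (u @ w))"
  by (rule ell2_le_inj) (auto intro: injI)

lemma ell2_coeff_backshift [simp]: "ell2_coeff (backshift w h) u = ell2_coeff h (u @ w)"
  unfolding backshift_def by (simp add: ell2_le_Abs(1)[OF ell2_le_backshift])

lemma bounded_linear_backshift: "bounded_linear (backshift w)"
proof (rule bounded_linear_intro[where K = 1])
  show "norm (backshift w h) \<le> norm h * 1" for h :: "'a fock"
    unfolding backshift_def using ell2_le_Abs(2)[OF ell2_le_backshift[of h w]] by simp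
qed (auto intro!: ell2_eqI)

lemma cinner_backshift: "cinner g (backshift w h) = cinner (fmul g (ket w)) h"
  by (rule cinner_reindex[where h = "\<lambda>u. u @ w", symmetric])
    (auto intro!: injI conv_ket_not_suffix simp: ell2_coeff_fmul_ket)

text \<open>If two words end a common word, one is a suffix of the other; otherwise the two
  translates have disjoint supports.\<close>

lemma cinner_fmul_ket_incomparable:
  assumes "\<And>u. \<alpha> \<noteq> u @ \<beta>" "\<And>u. \<beta> \<noteq> u @ \<alpha>"
  shows "cinner (fmul f (ket \<alpha>)) (fmul g (ket \<beta>)) = 0"
  unfolding cinner.rep_eq
proof (rule infsum_0)
  fix v
  have "\<not> ((\<exists>u. v = u @ \<alpha>) \<and> (\<exists>u. v = u @ \<beta>))"
  proof
    assume "(\<exists>u. v = u @ \<alpha>) \<and> (\<exists>u. v = u @ \<beta>)"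
    then obtain u u' where "u @ \<alpha> = u' @ \<beta>" by auto
    then obtain x where "\<beta> = x @ \<alpha> \<or> \<alpha> = x @ \<beta>"
      unfolding append_eq_append_conv2 by auto
    with assms[of x] show False by auto
  qed
  then show "cnj (ell2_coeff (fmul f (ket \<alpha>)) v) * ell2_coeff (fmul g (ket \<beta>)) v = 0"
    unfolding ell2_coeff_fmul_ket using conv_ket_not_suffix
    by (metis complex_cnj_zero mult_zero_left mult_zero_right)
qed

text \<open>The translates of \<theta> are orthonormal, as right multiplication by a word preserves
  norms. So multiplication by \<theta> is isometric on polynomials, and by continuity
  everywhere.\<close>

lemma isometric_multiplierI:
  assumes orth: "\<And>\<alpha> \<beta>. \<alpha> \<noteq> \<beta> \<Longrightarrow> cinner (fmul \<theta> (ket \<alpha>)) (fmul \<theta> (ket \<beta>)) = 0" and norm: "norm \<theta> = 1"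
  shows "isometric_multiplier \<theta>"
proof -
  have fin: "norm (fmul \<theta> (\<Sum>w\<in>A. c w *\<^sub>C ket w)) = norm (\<Sum>w\<in>A. c w *\<^sub>C ket w)" if A: "finite A" for A c
  proof -
    have "of_real ((norm (fmul \<theta> (\<Sum>w\<in>A. c w *\<^sub>C ket w)))\<^sup>2) =
        (\<Sum>\<alpha>\<in>A. \<Sum>\<beta>\<in>A. cnj (c \<alpha>) * c \<beta> * cinner (fmul \<theta> (ket \<alpha>)) (fmul \<theta> (ket \<beta>)))"
      unfolding cinner_self[symmetric] fmul_poly(2)[OF A]
      by (subst sum.swap)
        (simp add: cinner_sum_left cinner_sum_right sum_distrib_left mult_ac del: cinner_fmul_ket)
    also have "\<dots> = (\<Sum>\<alpha>\<in>A. \<Sum>\<beta>\<in>A. if \<beta> = \<alpha> then cnj (c \<alpha>) * c \<alpha> else 0)"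
      using orth by (intro sum.cong) (auto simp: cinner_self norm)
    also have "\<dots> = of_real ((norm (\<Sum>w\<in>A. c w *\<^sub>C ket w))\<^sup>2)"
      unfolding norm_sum_ket[OF A] using A by (simp add: complex_norm_square[unfolded of_real_power] mult.commute)
    finally have "(norm (fmul \<theta> (\<Sum>w\<in>A. c w *\<^sub>C ket w)))\<^sup>2 = (norm (\<Sum>w\<in>A. c w *\<^sub>C ket w))\<^sup>2"
      using of_real_eq_iff by blast
    then show ?thesis
      by simp
  qed
  have mult: "multiplier 1 \<theta>"
  proof (rule multiplierI_poly)
    fix p :: "'a fock" assume p: "poly p"
    show "norm (fmul \<theta> p) \<le> 1 * norm p"
      using fin[of "{w. ell2_coeff p w \<noteq> 0}" "ell2_coeff p"] p poly_eq[OF p] by (simp add: poly_def)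
  qed simp
  have "norm (fmul \<theta> g) = norm g" for g
  proof (rule tendsto_unique)
    have lim: "((\<lambda>F. \<Sum>w\<in>F. ell2_coeff g w *\<^sub>C ket w) \<longlongrightarrow> g) (finite_subsets_at_top UNIV)"
      using has_sum_ket[of g] by (simp add: has_sum_def)
    show "((\<lambda>F. norm (\<Sum>w\<in>F. ell2_coeff g w *\<^sub>C ket w)) \<longlongrightarrow> norm g) (finite_subsets_at_top UNIV)"
      by (intro tendsto_norm lim)
    have "((\<lambda>F. norm (fmul \<theta> (\<Sum>w\<in>F. ell2_coeff g w *\<^sub>C ket w))) \<longlongrightarrow> norm (fmul \<theta> g)) (finite_subsets_at_top UNIV)"
      by (intro tendsto_norm bounded_linear.tendsto[OF bounded_linear_fmul[OF mult]] lim)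
    moreover have "\<forall>\<^sub>F F in finite_subsets_at_top UNIV. norm (fmul \<theta> (\<Sum>w\<in>F. ell2_coeff g w *\<^sub>C ket w)) =
        norm (\<Sum>w\<in>F. ell2_coeff g w *\<^sub>C ket w)"
      by (intro eventually_finite_subsets_at_top_weakI fin)
    ultimately show "((\<lambda>F. norm (\<Sum>w\<in>F. ell2_coeff g w *\<^sub>C ket w)) \<longlongrightarrow> norm (fmul \<theta> g)) (finite_subsets_at_top UNIV)"
      by (rule Lim_transform_eventually)
  qed simp
  with mult show ?thesis
    by (simp add: isometric_multiplier_def)
qed

lemma closed_csubspace_range:
  assumes "isometric_multiplier \<theta>"
  shows "closed_csubspace (range (fmul \<theta>))"
proof -
  have mult: "multiplier 1 \<theta>" and iso: "norm (fmul \<theta> g) = norm g" for g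
    using assms by (auto simp: isometric_multiplier_def)
  note lin = bounded_linear_fmul[OF mult]
  have "complete (range (fmul \<theta>))"
    by (rule complete_isometric_image[OF zero_less_one subspace_UNIV lin _ complete_UNIV]) (simp add: iso)
  then have "closed (range (fmul \<theta>))"
    by (rule complete_imp_closed)
  moreover have "fmul \<theta> x + fmul \<theta> y = fmul \<theta> (x + y)" "c *\<^sub>C fmul \<theta> x = fmul \<theta> (c *\<^sub>C x)" "0 = fmul \<theta> 0" for x y c
    using bounded_linear.linear[OF lin] by (simp_all add: linear_add linear_0 fmul_scaleC_right[OF mult])
  ultimately show ?thesis
    unfolding closed_csubspace_def by (auto simp only: intro: rangeI)
qed

lemma cyc_isometric:
  assumes "isometric_multiplier \<theta>"
  shows "cyc \<theta> = range (fmul \<theta>)"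
proof
  show "cyc \<theta> \<subseteq> range (fmul \<theta>)"
    by (intro cyc_least closed_csubspace_range assms) simp
  show "range (fmul \<theta>) \<subseteq> cyc \<theta>"
    using assms fmul_in_cyc by (auto simp: isometric_multiplier_def)
qed

text \<open>\<open>N\<close> is spanned by the proper translates of \<open>f\<close>, so it has
  codimension one in \<open>cyc f\<close>; \<theta> is the normalised part of \<open>f\<close>
  orthogonal to \<open>N\<close>. The range of \<theta> exhausts \<open>cyc f\<close> because a
  vector orthogonal to it could be shifted back indefinitely within \<open>cyc f\<close>.\<close>

theorem inner_outer_factorization:
  fixes f :: "'d fock"
  assumes f: "f \<noteq> 0"
  obtains \<theta> g where "isometric_multiplier \<theta>" "f = fmul \<theta> g" "\<theta> \<in> cyc f" "cyc g = UNIV"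
proof -
  define N where "N = closed_cspan ((\<lambda>w. fmul f (ket w)) ` (- {[]}))"
  have N: "closed_csubspace N"
    unfolding N_def by (rule closed_csubspace_closed_cspan)
  have gen_N: "fmul f (ket w) \<in> N" if "w \<noteq> []" for w
    unfolding N_def using that by (intro closed_cspan_base) simp
  have N_least: "N \<subseteq> M" if "closed_csubspace M" "\<And>w. w \<noteq> [] \<Longrightarrow> fmul f (ket w) \<in> M" for M
    unfolding N_def by (rule closed_cspan_least[OF that(1)]) (use that(2) in auto)
  have N_cyc: "N \<subseteq> cyc f"
    by (intro N_least closed_csubspace_cyc fmul_ket_in_cyc)
  have cyc_shift: "fmul x (ket w) \<in> N" if "x \<in> cyc f" "w \<noteq> []" for x w
  proof -
    have "cyc f \<subseteq> (\<lambda>x. fmul x (ket w)) -` N"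
      using \<open>w \<noteq> []\<close>
      by (intro cyc_least closed_csubspace_vimage N bounded_linear_fmul_ket fmul_ket_scaleC)
        (simp add: fmul_ket_assoc gen_N)
    with that show ?thesis by auto
  qed
  obtain p where p: "p \<in> N" and orth_N: "\<And>m. m \<in> N \<Longrightarrow> cinner m (f - p) = 0"
    using projection_exists[OF N, of f] by blast
  define t where "t = norm (f - p)"
  have t: "t > 0"
    using p not_in_cyc_tail[OF f] by (auto simp: t_def N_def)
  define \<theta> where "\<theta> = of_real (1 / t) *\<^sub>C (f - p)"
  have fp: "f = of_real t *\<^sub>C \<theta> + p"
    using t by (simp add: \<theta>_def flip: of_real_mult)
  have \<theta>_N: "cinner m \<theta> = 0" if "m \<in> N" for m
    using orth_N[OF that] by (simp add: \<theta>_def del: scaleC_diff_right)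
  have \<theta>_cyc: "\<theta> \<in> cyc f"
    unfolding \<theta>_def using p N_cyc by (intro closed_csubspaceD[OF closed_csubspace_cyc] self_in_cyc) auto
  have \<theta>_self: "cinner (fmul \<theta> (ket w)) \<theta> = 0" if "w \<noteq> []" for w
    by (rule \<theta>_N[OF cyc_shift[OF \<theta>_cyc that]])
  have iso: "isometric_multiplier \<theta>"
  proof (rule isometric_multiplierI)
    show "norm \<theta> = 1"
      using t by (simp add: \<theta>_def norm_scaleC norm_divide t_def del: scaleC_diff_right)
    have suffix: "cinner (fmul \<theta> (ket (u @ \<beta>))) (fmul \<theta> (ket \<beta>)) = 0" if "u \<noteq> []" for u \<beta>
      using \<theta>_self[OF that] by (simp flip: fmul_ket_assoc)
    fix \<alpha> \<beta> :: "'d list" assume "\<alpha> \<noteq> \<beta>"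
    show "cinner (fmul \<theta> (ket \<alpha>)) (fmul \<theta> (ket \<beta>)) = 0"
    proof (cases "\<exists>u. \<alpha> = u @ \<beta>")
      case True
      with suffix \<open>\<alpha> \<noteq> \<beta>\<close> show ?thesis by auto
    next
      case False
      show ?thesis
      proof (cases "\<exists>u. \<beta> = u @ \<alpha>")
        case True
        with suffix \<open>\<alpha> \<noteq> \<beta>\<close> have "cinner (fmul \<theta> (ket \<beta>)) (fmul \<theta> (ket \<alpha>)) = 0" by auto
        then show ?thesis
          by (subst cinner_commute) simp
      next
        case f: False
        with False show ?thesis
          by (intro cinner_fmul_ket_incomparable) auto
      qed
    qed
  qed
  then have mult: "multiplier 1 \<theta>" and norm_\<theta>: "norm (fmul \<theta> g) = norm g" for g
    by (auto simp: isometric_multiplier_def)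
  \<comment> \<open>The part of \<open>h\<close> orthogonal to \<open>N\<close> is also orthogonal
    to \<theta>, hence to \<open>f\<close> and all its translates, although it lies in
    \<open>cyc f\<close>; so it is zero.\<close>
  have in_N: "h \<in> N" if h: "h \<in> cyc f" "\<And>g. cinner (fmul \<theta> g) h = 0" for h
  proof -
    obtain m where m: "m \<in> N" "\<And>x. x \<in> N \<Longrightarrow> cinner x (h - m) = 0"
      using projection_exists[OF N, of h] by blast
    have "cinner \<theta> h = 0"
      using h(2)[of "ket []"] by simp
    moreover have "cinner \<theta> m = 0"
      using \<theta>_N[OF m(1)] by (subst cinner_commute) simp
    ultimately have "cinner f (h - m) = 0"
      using m(2)[OF p] by (subst fp) (simp add: cinner_add_left cinner_diff_right)
    then have "cinner (fmul f (ket w)) (h - m) = 0" for w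
      using m(2)[OF gen_N] by (cases "w = []") auto
    then have "cinner (h - m) (fmul f (ket w)) = 0" for w
      by (subst cinner_commute) simp
    then have "cyc f \<subseteq> {x. \<forall>y\<in>{h - m}. cinner y x = 0}"
      by (intro cyc_least closed_csubspace_orthogonal) simp
    moreover have "h - m \<in> cyc f"
      using h(1) m(1) N_cyc by (intro closed_csubspaceD[OF closed_csubspace_cyc]) auto
    ultimately have "h - m = 0" by auto
    with m(1) show ?thesis by simp
  qed
  have N_Nil: "N \<subseteq> {x. \<forall>y\<in>{ket []}. cinner y x = 0}"
  proof (rule N_least[OF closed_csubspace_orthogonal])
    fix w :: "'d list" assume "w \<noteq> []"
    then have "ell2_coeff (fmul f (ket w)) [] = 0"
      unfolding ell2_coeff_fmul_ket by (intro conv_ket_not_suffix) auto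
    then show "fmul f (ket w) \<in> {x. \<forall>y\<in>{ket []}. cinner y x = 0}" by simp
  qed
  have N_back: "N \<subseteq> backshift [k] -` cyc f" for k
  proof (rule N_least)
    show "closed_csubspace (backshift [k] -` cyc f)"
      by (intro closed_csubspace_vimage closed_csubspace_cyc bounded_linear_backshift) (rule ell2_eqI, simp)
    fix w :: "'d list" assume "w \<noteq> []"
    then obtain w' j where w: "w = w' @ [j]"
      by (metis append_butlast_last_id)
    have "backshift [k] (fmul f (ket w)) = (if j = k then fmul f (ket w') else 0)"
    proof (rule ell2_eqI)
      fix u
      have "ell2_coeff (fmul (fmul f (ket w')) (ket [j])) (u @ [k]) = 0" if "j \<noteq> k"
        unfolding ell2_coeff_fmul_ket using that by (intro conv_ket_not_suffix) auto
      then show "ell2_coeff (backshift [k] (fmul f (ket w))) u = ell2_coeff (if j = k then fmul f (ket w') else 0) u"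
        by (auto simp: w fmul_ket_assoc[symmetric])
    qed
    then show "fmul f (ket w) \<in> backshift [k] -` cyc f"
      by (simp add: fmul_ket_in_cyc closed_csubspaceD(2)[OF closed_csubspace_cyc])
  qed
  \<comment> \<open>Induction from the last letter: such an \<open>h\<close> lies in
    \<open>N\<close>, so its constant term is zero and each backward shift of \<open>h\<close>
    satisfies the same two conditions.\<close>
  have vanish: "ell2_coeff h v = 0" if "h \<in> cyc f" "\<And>g. cinner (fmul \<theta> g) h = 0" for h v
    using that
  proof (induction v arbitrary: h rule: rev_induct)
    case (Nil h)
    have "h \<in> N" by (rule in_N) (use Nil in auto)
    then have "h \<in> {x. \<forall>y\<in>{ket []}. cinner y x = 0}"
      using N_Nil by blast
    then show ?case by simp
  next
    case (snoc k u h)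
    have "h \<in> N" by (rule in_N) (use snoc.prems in auto)
    then have "backshift [k] h \<in> cyc f"
      using N_back by blast
    moreover have "cinner (fmul \<theta> g) (backshift [k] h) = 0" for g
    proof -
      have "fmul (fmul \<theta> g) (ket [k]) = fmul \<theta> (fmul g (ket [k]))"
        by (rule fmul_assoc_poly[OF mult]) simp
      then show ?thesis
        using snoc.prems(2)[of "fmul g (ket [k])"] by (simp add: cinner_backshift)
    qed
    ultimately have "ell2_coeff (backshift [k] h) u = 0"
      by (rule snoc.IH)
    then show ?case by simp
  qed
  obtain q where q: "q \<in> range (fmul \<theta>)" and orth: "\<And>m. m \<in> range (fmul \<theta>) \<Longrightarrow> cinner m (f - q) = 0"
    using projection_exists[OF closed_csubspace_range[OF iso], of f] by blast
  have "range (fmul \<theta>) \<subseteq> cyc f"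
    using cyc_mono[OF \<theta>_cyc] by (simp add: cyc_isometric[OF iso])
  then have "f - q \<in> cyc f"
    using q by (intro closed_csubspaceD[OF closed_csubspace_cyc] self_in_cyc) auto
  then have "ell2_coeff (f - q) v = 0" for v
    by (rule vanish) (use orth in auto)
  then have "f = q"
    by (intro ell2_eqI) (simp add: minus_ell2.rep_eq)
  with q obtain g where g: "f = fmul \<theta> g" by auto
  \<comment> \<open>Products of \<open>f\<close> with polynomials approximate \<theta>; undoing the
    isometry \<theta>, products of \<open>g\<close> with the same polynomials approximate 1.\<close>
  have "ket [] \<in> cyc g"
  proof (rule in_cycI)
    fix e :: real assume "e > 0"
    then obtain p where p: "poly p" "norm (fmul f p - \<theta>) < e"
      using cyc_approx[OF \<theta>_cyc] by blast
    have "fmul \<theta> (fmul g p - ket []) = fmul f p - \<theta>"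
      using linear_diff[OF bounded_linear.linear[OF bounded_linear_fmul[OF mult]]]
      by (simp add: g fmul_assoc_poly[OF mult p(1)])
    then show "\<exists>p. poly p \<and> norm (fmul g p - ket []) < e"
      using p norm_\<theta> by metis
  qed
  with that[OF iso g \<theta>_cyc] show ?thesis
    by (simp add: one_in_cyc_imp_UNIV)
qed

section \<open>Singularity spaces and dilations\<close>

lemma SingD:
  fixes Z :: "'d::countable \<Rightarrow> operator"
  assumes "(n, Z, y) \<in> Sing f"
  obtains r where "row_bound n r Z" "r < 1" "y \<in> vec_space n"
    "\<forall>x\<in>vec_space n. cinner y ((nc_sum n f Z) x) = 0" "0 < n" "Z \<in> row_ball n"
proof -
  have Z: "Z \<in> row_ball n" and *: "y \<in> vec_space n" "0 < n" "left_null n y (nc_eval n f Z)"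
    using assms by (auto simp: Sing_def)
  from Z obtain r where r: "r < 1" "row_bound n r Z"
    by (rule row_ball_imp_row_bound)
  show ?thesis
    using that[OF r(2,1) *(1) _ *(2) Z] *(3) unfolding left_null_def nc_eval_eq[OF r(2,1)] by blast
qed

lemma in_sing_space_iff: "h \<in> sing_space H \<longleftrightarrow> Sing H \<subseteq> Sing h"
  by (auto simp: sing_space_def Sing_def)

text \<open>\<open>to_nat\<close> may miss indices, so the sequence space can exceed the embedded
  Fock space; the evaluated operator creates nothing in the Fock part from the surplus.\<close>

lemma left_shift_off_range:
  fixes f :: "'d::countable fock" and z :: "nat ell2"
  assumes r: "0 \<le> r" "r < 1" and z: "\<And>w :: 'd list. ell2_coeff z (to_nat w) = 0"
  shows "ell2_coeff ((nc_sum \<infinity> f (model_shift UNIV r)) z) (to_nat (v :: 'd list)) = 0"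
proof -
  have coeff: "ell2_coeff ((model_shift (UNIV :: 'd list set) r k) x) = shift_coeff UNIV r k x" for k x
    by (rule ell2_coeff_model_shift[where n = \<infinity>]) (use r in auto)
  have word: "ell2_coeff ((word_op \<infinity> (model_shift (UNIV :: 'd list set) r) \<alpha>) z) (to_nat v) = 0" for \<alpha> and v :: "'d list"
  proof (induction \<alpha> arbitrary: v)
    case (Cons k \<alpha>)
    then show ?case
      by (auto simp: coeff shift_coeff_def split: list.split)
  qed (simp add: z)
  have "((\<lambda>\<alpha>. ell2_coeff (ell2_coeff f \<alpha> *\<^sub>C (word_op \<infinity> (model_shift UNIV r) \<alpha>) z) (to_nat v))
      has_sum ell2_coeff ((nc_sum \<infinity> f (model_shift UNIV r)) z) (to_nat v)) UNIV"
    by (intro has_sum_bounded_linear[OF bounded_linear_ell2_coeff]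
        has_sum_nc_sum_apply[OF row_bound_left_shift[OF r] r(2)])
  then have "((\<lambda>_. 0) has_sum ell2_coeff ((nc_sum \<infinity> f (model_shift UNIV r)) z) (to_nat v)) (UNIV :: 'd list set)"
    by (simp add: word)
  then show ?thesis
    by (rule has_sum_unique[OF _ has_sum_0_simp])
qed

lemma sing_space_imp_cyc:
  fixes H h :: "'d::countable fock"
  assumes h: "h \<in> sing_space H" and r: "0 < r" "r < 1"
  shows "dilate r h \<in> cyc (dilate r H)"
proof -
  have r0: "0 \<le> r" using r by simp
  let ?Z = "model_shift (UNIV :: 'd list set) r"
  note Z = row_bound_left_shift[OF r0 r(2), where 'd = 'd]
  obtain p where p: "p \<in> cyc (dilate r H)" "\<And>m. m \<in> cyc (dilate r H) \<Longrightarrow> cinner m (dilate r h - p) = 0"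
    using projection_exists[OF closed_csubspace_cyc[of "dilate r H"], of "dilate r h"] by blast
  \<comment> \<open>The residual of the projection annihilates the range of H(rL), which yields a
    point of \<open>Sing H\<close>. The same must then hold for h; applied to the empty word this
    says that \<open>y\<close> is orthogonal to \<open>dilate r h\<close>, hence to itself.\<close>
  define y where "y = dilate r h - p"
  have orth: "cinner y m = 0" if "m \<in> cyc (dilate r H)" for m
    using p(2)[OF that] by (subst cinner_commute) (simp add: y_def)
  have emb: "cinner (fock_embed UNIV y) ((nc_sum \<infinity> f ?Z) (fock_embed UNIV g)) =
      cinner y (fmul (dilate r f) g)" for f g
    by (simp add: nc_sum_left_shift[OF r0 r(2)] cinner_fock_embed_UNIV)
  have "cinner (fock_embed UNIV y) ((nc_sum \<infinity> H ?Z) x) = 0" for x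
  proof -
    define g where "g = Abs_ell2 (\<lambda>w :: 'd list. ell2_coeff x (to_nat w))"
    have "ell2_le (norm x) (\<lambda>w :: 'd list. ell2_coeff x (to_nat w))"
      by (rule ell2_le_inj) simp
    then have g: "ell2_coeff g w = ell2_coeff x (to_nat w)" for w
      unfolding g_def by (simp add: ell2_le_Abs(1))
    have off: "ell2_coeff ((nc_sum \<infinity> H ?Z) (x - fock_embed UNIV g)) (to_nat w) = 0" for w :: "'d list"
      by (rule left_shift_off_range[OF r0 r(2)]) (simp add: ell2_coeff_fock_embed g)
    have "cinner (fock_embed UNIV y) ((nc_sum \<infinity> H ?Z) (x - fock_embed UNIV g)) = 0"
      unfolding cinner.rep_eq by (rule infsum_0) (auto simp: ell2_coeff_fock_embed off)
    then have "cinner (fock_embed UNIV y) ((nc_sum \<infinity> H ?Z) x) = cinner y (fmul (dilate r H) g)"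
      by (simp add: blinfun.diff_right cinner_diff_right emb)
    also have "\<dots> = 0"
      by (intro orth fmul_in_cyc[OF multiplier_dilate(1)[OF r0 r(2)]])
    finally show ?thesis .
  qed
  then have "(\<infinity>, ?Z, fock_embed UNIV y) \<in> Sing H"
    by (auto simp: Sing_def left_null_def nc_eval_eq[OF Z r(2)] vec_space_def
        row_bound_imp_row_ball[OF Z r(2)])
  with h have "left_null \<infinity> (fock_embed UNIV y) (nc_eval \<infinity> h ?Z)"
    by (auto simp: sing_space_def)
  then have "cinner (fock_embed UNIV y) ((nc_sum \<infinity> h ?Z) (fock_embed UNIV (ket [] :: 'd fock))) = 0"
    by (auto simp: left_null_def nc_eval_eq[OF Z r(2)] vec_space_def)
  then have "cinner y (dilate r h) = 0"
    by (simp add: emb)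
  then have "cinner y y = 0"
    using orth[OF p(1)] by (subst (2) y_def) (simp add: cinner_diff_right)
  then show ?thesis
    using p(1) by (simp add: y_def)
qed

text \<open>Write Z = sW with W still in the ball. Pairing \<open>y\<close> with values at W is
  continuous on the Fock space and kills all translates of \<open>dilate s H\<close>, hence the
  cyclic subspace containing \<open>dilate s h\<close>, whose value at W is h(Z).\<close>

lemma cyc_imp_sing_space:
  fixes H h :: "'d::countable fock"
  assumes cyc: "\<And>r. 0 < r \<Longrightarrow> r < 1 \<Longrightarrow> dilate r h \<in> cyc (dilate r H)"
  shows "h \<in> sing_space H"
  unfolding in_sing_space_iff
proof
  fix t assume "t \<in> Sing H"
  then obtain n Z y where t: "t = (n, Z, y)" and S: "(n, Z, y) \<in> Sing H"
    by (cases t) auto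
  from S obtain r where Z: "row_bound n r Z" and r: "r < 1" and y: "y \<in> vec_space n"
    and null: "\<forall>x\<in>vec_space n. cinner y ((nc_sum n H Z) x) = 0"
    and n: "0 < n" "Z \<in> row_ball n"
    by (rule SingD)
  from Z r obtain s q W where s: "0 < s" "s < 1" and W: "q < 1" "row_bound n q W" and ZW: "Z = (\<lambda>k. of_real s *\<^sub>O W k)"
    by (rule row_bound_dilate)
  have dil: "nc_sum n (dilate s f) W = nc_sum n f Z" for f
    unfolding ZW using s by (intro nc_sum_dilate row_bound_mat[OF W(2,1)]) auto
  let ?M = "{f. \<forall>x\<in>vec_space n. cinner y ((nc_sum n f W) x) = 0}"
  have "closed_csubspace ?M"
    by (intro closed_csubspace_kernels bounded_linear_compose[OF bounded_linear_cinner_right]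
        bounded_linear_compose[OF blinfun.bounded_linear_left] bounded_linear_nc_sum[OF W(2,1)])
      (simp add: nc_sum_scaleC[OF W(2,1)])
  moreover have "fmul (dilate s H) (ket w) \<in> ?M" for w
    by (simp add: nc_sum_fmul_ket[OF W(2,1)] dil null
        mat_spaceD(4)[OF word_op_mat_space[OF row_bound_mat[OF W(2,1)]]])
  ultimately have "cyc (dilate s H) \<subseteq> ?M"
    by (rule cyc_least)
  with cyc[OF s] have "dilate s h \<in> ?M" by auto
  then show "t \<in> Sing h"
    using n y by (auto simp: t Sing_def left_null_def nc_eval_eq[OF Z r] dil)
qed

theorem sing_space_iff_cyc:
  "h \<in> sing_space H \<longleftrightarrow> (\<forall>r. 0 < r \<and> r < 1 \<longrightarrow> dilate r h \<in> cyc (dilate r H))"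
  using sing_space_imp_cyc cyc_imp_sing_space by blast

section \<open>The defined notions in terms of coefficient products\<close>

lemma nc_eval_fmul:
  fixes Z :: "'d::countable \<Rightarrow> operator"
  assumes f: "multiplier M f" and Z: "Z \<in> row_ball n"
  shows "nc_eval n (fmul f g) Z = nc_eval n f Z o\<^sub>L nc_eval n g Z"
proof -
  obtain r where r: "r < 1" "row_bound n r Z"
    using Z by (rule row_ball_imp_row_bound)
  show ?thesis
    by (simp add: nc_eval_eq[OF r(2,1)] nc_sum_fmul[OF r(2,1) f])
qed

lemma represents_fmul:
  assumes "multiplier M f"
  shows "represents (fmul f g) (\<lambda>n Z. nc_eval n f Z o\<^sub>L nc_eval n g Z)"
  by (simp add: represents_def nc_eval_fmul[OF assms])

lemma left_mult_eq_fmul: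
  assumes "multiplier M f"
  shows "left_mult f g = fmul f g"
  unfolding left_mult_def
  by (rule the_equality[where a = "fmul f g"]) (use represents_fmul[OF assms] represents_unique in blast)+

lemma right_shift_eq:
  "right_shift k f = fmul f (ket [k])"
proof -
  have "represents (fmul f (ket [k])) (\<lambda>n Z. nc_eval n f Z o\<^sub>L Z k)"
    unfolding represents_def
  proof (intro allI impI ballI)
    fix n :: nat and Z :: "'a \<Rightarrow> operator"
    assume "Z \<in> row_ball (enat n)"
    then obtain r where r: "r < 1" "row_bound (enat n) r Z"
      by (rule row_ball_imp_row_bound)
    show "nc_eval (enat n) (fmul f (ket [k])) Z = nc_eval (enat n) f Z o\<^sub>L Z k"
      by (simp add: nc_eval_eq[OF r(2,1)] nc_sum_fmul_ket[OF r(2,1)] mat_spaceD(6)[OF row_bound_mat[OF r(2,1)]])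
  qed
  then show ?thesis
    unfolding right_shift_def
    by (intro the_equality) (use represents_unique in blast)+
qed

lemma fold_right_shift: "fold right_shift w f = fmul f (ket w)"
  by (induction w arbitrary: f) (simp_all add: right_shift_eq fmul_ket_assoc)

lemma nc_outer_iff_cyc: "nc_outer f \<longleftrightarrow> cyc f = UNIV"
proof -
  have "{c *\<^sub>C fold right_shift w f | c w. True} = {c *\<^sub>C g | c g. g \<in> range (\<lambda>w. fmul f (ket w))}"
    by (auto simp: fold_right_shift)
  then show ?thesis
    by (simp add: nc_outer_def cyc_def closed_cspan_def)
qed

lemma nc_inner_iff: "nc_inner \<theta> \<longleftrightarrow> isometric_multiplier \<theta>"
proof
  assume "nc_inner \<theta>"
  then obtain M where M: "multiplier M \<theta>" and norm: "\<And>f. norm (left_mult \<theta> f) = norm f"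
    unfolding nc_inner_def using H_inf_imp_multiplier by blast
  then have iso: "norm (fmul \<theta> f) = norm f" for f
    by (simp add: left_mult_eq_fmul[OF M])
  have "multiplier 1 \<theta>"
    by (rule multiplierI[where h = "fmul \<theta>"]) (simp_all add: multiplierD[OF M] iso)
  with iso show "isometric_multiplier \<theta>"
    by (simp add: isometric_multiplier_def)
next
  assume "isometric_multiplier \<theta>"
  then have M: "multiplier 1 \<theta>" and "\<And>f. norm (fmul \<theta> f) = norm f"
    by (auto simp: isometric_multiplier_def)
  then show "nc_inner \<theta>"
    by (simp add: nc_inner_def multiplier_imp_H_inf[OF M] left_mult_eq_fmul[OF M])
qed

lemma nc_blaschke_iff:
  "nc_blaschke \<theta> \<longleftrightarrow> isometric_multiplier \<theta> \<and> range (fmul \<theta>) = sing_space \<theta>"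
proof (cases "isometric_multiplier \<theta>")
  case True
  then have "left_mult \<theta> = fmul \<theta>"
    using left_mult_eq_fmul by (auto simp: isometric_multiplier_def)
  with True show ?thesis
    by (simp add: nc_blaschke_def nc_inner_iff)
qed (simp add: nc_blaschke_def nc_inner_iff)

lemma sing_space_cong: "Sing f = Sing g \<Longrightarrow> sing_space f = sing_space g"
  by (simp add: sing_space_def)

lemma Sing_fmul_mono:
  assumes f: "multiplier M f"
  shows "Sing f \<subseteq> Sing (fmul f g)"
proof
  fix t assume "t \<in> Sing f"
  then obtain n Z y where t: "t = (n, Z, y)" and S: "(n, Z, y) \<in> Sing f"
    by (cases t) auto
  from S obtain r where Z: "row_bound n r Z" and r: "r < 1" and y: "y \<in> vec_space n"
    and null: "\<forall>x\<in>vec_space n. cinner y ((nc_sum n f Z) x) = 0"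
    and n: "0 < n" "Z \<in> row_ball n"
    by (rule SingD)
  show "t \<in> Sing (fmul f g)"
    using n y by (auto simp: t Sing_def left_null_def nc_eval_eq[OF Z r] nc_sum_fmul[OF Z r f]
        intro!: null[rule_format] mat_spaceD(4)[OF nc_sum_mat_space[OF Z r]])
qed

section \<open>The Blaschke-singular-outer factorization\<close>

text \<open>Weak compactness of balls by a diagonal choice over the countably many coefficients; the
  norm bound survives by \<open>ell2_le_lim\<close>.\<close>

lemma bounded_coeff_convergent_subsequence:
  fixes x :: "nat \<Rightarrow> 'a::countable ell2"
  assumes C: "\<And>n. norm (x n) \<le> C"
  obtains k y where "strict_mono (k :: nat \<Rightarrow> nat)" "norm y \<le> C"
    "\<And>i. (\<lambda>n. ell2_coeff (x (k n)) i) \<longlonglongrightarrow> ell2_coeff y i"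
proof -
  have bound: "norm (ell2_coeff (x n) i) \<le> C" for n i
    by (rule order_trans[OF cmod_coeff_le_norm C])
  obtain k where k: "strict_mono (k :: nat \<Rightarrow> nat)"
    and "\<And>i. i \<in> UNIV \<Longrightarrow> \<exists>l. (\<lambda>n. ell2_coeff (x (k n)) i) \<longlonglongrightarrow> l"
    using function_convergent_subsequence[of UNIV "\<lambda>n. ell2_coeff (x n)" C, OF _ bound] by (metis uncountable_def countableI_type)
  then have "\<forall>i. \<exists>l. (\<lambda>n. ell2_coeff (x (k n)) i) \<longlonglongrightarrow> l"
    by simp
  then obtain l where l: "\<And>i. (\<lambda>n. ell2_coeff (x (k n)) i) \<longlonglongrightarrow> l i"
    by metis
  have "ell2_le C l"
    using ell2_le_lim[of "\<lambda>_. C" "\<lambda>n. ell2_coeff (x (k n))" C l] l C by (auto intro: ell2_le_coeff)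
  note Y = ell2_le_Abs[OF this]
  show ?thesis
    by (rule that[OF k Y(2)]) (simp add: Y(1) l)
qed

text \<open>The isometry \<open>S\<close> carries approximations of 1 by \<open>F\<close> times
  polynomials to approximations of \<open>S\<close>. Hence a function determines the range of its
  inner factor, which also gives uniqueness.\<close>

lemma cyc_fmul_outer:
  assumes S: "isometric_multiplier S" and F: "cyc F = UNIV"
  shows "cyc (fmul S F) = range (fmul S)"
proof
  have mult: "multiplier 1 S" and norm: "norm (fmul S g) = norm g" for g
    using S by (auto simp: isometric_multiplier_def)
  have "S \<in> cyc (fmul S F)"
  proof (rule in_cycI)
    fix e :: real assume "e > 0"
    then obtain p where p: "poly p" "norm (fmul F p - ket []) < e"
      using cyc_approx[of "ket []" F e] F by auto
    have "fmul S (fmul F p - ket []) = fmul (fmul S F) p - S"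
      using linear_diff[OF bounded_linear.linear[OF bounded_linear_fmul[OF mult]]]
      by (simp add: fmul_assoc_poly[OF mult p(1)])
    then show "\<exists>p. poly p \<and> norm (fmul (fmul S F) p - S) < e"
      using p norm by metis
  qed
  then show "range (fmul S) \<subseteq> cyc (fmul S F)"
    using cyc_mono cyc_isometric[OF S] by blast
  have "fmul S F \<in> cyc S"
    by (rule fmul_in_cyc[OF mult])
  then show "cyc (fmul S F) \<subseteq> range (fmul S)"
    using cyc_mono cyc_isometric[OF S] by blast
qed

lemma inner_outer_factorization_cyc:
  assumes "f \<noteq> 0"
  obtains \<theta> g where "isometric_multiplier \<theta>" "f = fmul \<theta> g" "cyc f = range (fmul \<theta>)" "cyc g = UNIV"
proof -
  obtain \<theta> g where "isometric_multiplier \<theta>" "f = fmul \<theta> g" "\<theta> \<in> cyc f" "cyc g = UNIV"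
    by (rule inner_outer_factorization[OF assms])
  then show ?thesis
    using cyc_fmul_outer[of \<theta> g] by (intro that[of \<theta> g]) auto
qed

lemma norm_isometric_multiplier:
  fixes \<theta> :: "'d fock"
  assumes "isometric_multiplier \<theta>"
  shows "norm \<theta> = 1"
proof -
  have "norm (fmul \<theta> (ket [])) = norm (ket [] :: 'd fock)"
    using assms unfolding isometric_multiplier_def by blast
  then show ?thesis by simp
qed

text \<open>The Blaschke factor is a coefficientwise limit, as \<open>r \<rightarrow> 1\<close>, of the inner factors of the
  dilations of \<open>H\<close>; no information about the wandering dimension of \<open>sing_space H\<close> is needed.\<close>

lemma blaschke_part:
  fixes H :: "'d::countable fock"
  assumes H: "H \<noteq> 0"
  obtains B where "isometric_multiplier B" "range (fmul B) = sing_space H" "Sing B = Sing H"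
proof -
  define r where "r n = 1 - 1 / real (Suc (Suc n))" for n
  have r: "0 < r n" "r n < 1" "0 \<le> r n" "r n \<le> 1" "r n \<noteq> 0" for n
    by (auto simp: r_def field_simps)
  have "(\<lambda>n. 1 / real (Suc (Suc n))) \<longlonglongrightarrow> 0"
    using LIMSEQ_Suc[OF LIMSEQ_inverse_real_of_nat] by (simp add: inverse_eq_divide)
  then have "r \<longlonglongrightarrow> 1 - 0"
    unfolding r_def by (intro tendsto_diff tendsto_const)
  then have r_lim: "r \<longlonglongrightarrow> 1" by simp
  have "\<exists>\<theta>. isometric_multiplier \<theta> \<and> cyc (dilate (r n) H) = range (fmul \<theta>)" for n
    using inner_outer_factorization_cyc[OF dilate_nonzero[OF r(3,4,5) H]] by metis
  then obtain \<theta> where \<theta>: "\<And>n. isometric_multiplier (\<theta> n)" "\<And>n. cyc (dilate (r n) H) = range (fmul (\<theta> n))"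
    by metis
  have mult: "multiplier 1 (\<theta> n)" and iso: "norm (fmul (\<theta> n) g) = norm g" for n g
    using \<theta>(1)[of n] by (auto simp: isometric_multiplier_def)
  obtain k B where k: "strict_mono (k :: nat \<Rightarrow> nat)" and "norm B \<le> 1"
    and B: "\<And>w. (\<lambda>n. ell2_coeff (\<theta> (k n)) w) \<longlonglongrightarrow> ell2_coeff B w"
    using bounded_coeff_convergent_subsequence[of \<theta> 1] norm_isometric_multiplier[OF \<theta>(1)] by auto
  have rk: "(\<lambda>n. r (k n)) \<longlonglongrightarrow> 1"
    using LIMSEQ_subseq_LIMSEQ[OF r_lim k] by (simp add: o_def)
  have B_mult: "multiplier 1 B"
    by (rule multiplier_lim[OF mult B])
  \<comment> \<open>The quotients of the dilations of \<open>h\<close> have norm at most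
    \<open>norm h\<close>, so a further subsequence converges; each coefficient of a product is a
    finite sum and passes to the limit.\<close>
  have factor: "\<exists>g. h = fmul B g \<and> norm g \<le> norm h" if h: "h \<in> sing_space H" for h
  proof -
    have "\<exists>g. dilate (r (k n)) h = fmul (\<theta> (k n)) g" for n
      using sing_space_imp_cyc[OF h r(1,2)] \<theta>(2) by (metis imageE)
    then obtain g where g: "\<And>n. dilate (r (k n)) h = fmul (\<theta> (k n)) (g n)"
      by metis
    have "norm (g n) \<le> norm h" for n
      using norm_dilate_le[OF r(3,4), of "k n" h] by (simp add: g iso)
    then obtain j G where j: "strict_mono (j :: nat \<Rightarrow> nat)" and G: "norm G \<le> norm h"
      "\<And>w. (\<lambda>n. ell2_coeff (g (j n)) w) \<longlonglongrightarrow> ell2_coeff G w"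
      by (rule bounded_coeff_convergent_subsequence[of g]) auto
    have rkj: "(\<lambda>n. r (k (j n))) \<longlonglongrightarrow> 1"
      using LIMSEQ_subseq_LIMSEQ[OF rk j] by (simp add: o_def)
    have Bj: "(\<lambda>n. ell2_coeff (\<theta> (k (j n))) w) \<longlonglongrightarrow> ell2_coeff B w" for w
      using LIMSEQ_subseq_LIMSEQ[OF B j] by (simp add: o_def)
    have "fmul B G = h"
    proof (rule fmul_eqI, rule ext)
      fix v
      have "(\<lambda>n. conv (ell2_coeff (\<theta> (k (j n)))) (ell2_coeff (g (j n))) v) \<longlonglongrightarrow> conv (ell2_coeff B) (ell2_coeff G) v"
        unfolding conv_eq_sum by (intro tendsto_intros Bj G)
      moreover have "conv (ell2_coeff (\<theta> (k (j n)))) (ell2_coeff (g (j n))) v = of_real (r (k (j n)) ^ length v) * ell2_coeff h v" for n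
        by (simp only: multiplierD(1)[OF mult, symmetric] g[symmetric] ell2_coeff_dilate[OF r(3,4)])
      moreover have "(\<lambda>n. of_real (r (k (j n)) ^ length v) * ell2_coeff h v) \<longlonglongrightarrow> of_real (1 ^ length v) * ell2_coeff h v"
        by (intro tendsto_intros rkj)
      ultimately show "ell2_coeff h v = conv (ell2_coeff B) (ell2_coeff G) v"
        using LIMSEQ_unique by fastforce
    qed
    with G(1) show ?thesis by blast
  qed
  have B_sing: "B \<in> sing_space H"
  proof (rule cyc_imp_sing_space)
    fix s :: real assume s: "0 < s" "s < 1"
    obtain N where N: "\<And>n. n \<ge> N \<Longrightarrow> s < r (k n)"
      using order_tendstoD(1)[OF rk s(2)] by (auto simp: eventually_sequentially)
    \<comment> \<open>Dilating the inner factor of the dilation by \<open>r (k (n + N))\<close> once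
      more by \<open>q n\<close> lands in the cyclic subspace of the fixed dilation by
      \<open>s\<close>; the offset \<open>N\<close> keeps \<open>q n\<close> at most 1.\<close>
    define q where "q n = s / r (k (n + N))" for n
    have q: "0 \<le> q n" "q n \<le> 1" for n
      using N[of "n + N"] s(1) r(1) by (auto simp: q_def divide_le_eq)
    have "q \<longlonglongrightarrow> s / 1"
      unfolding q_def by (intro tendsto_divide tendsto_const LIMSEQ_ignore_initial_segment rk) simp
    then have q_lim: "q \<longlonglongrightarrow> s" by simp
    show "dilate s B \<in> cyc (dilate s H)"
    proof (rule closed_csubspace_weakly_closed[OF closed_csubspace_cyc])
      fix n
      have "\<theta> (k (n + N)) \<in> cyc (dilate (r (k (n + N))) H)"
        unfolding \<theta>(2) cyc_isometric[OF \<theta>(1), symmetric] by (rule self_in_cyc)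
      from dilate_in_cyc[OF this q[of n]]
      show "dilate (q n) (\<theta> (k (n + N))) \<in> cyc (dilate s H)"
        by (simp add: dilate_dilate[OF q r(3,4)]) (simp add: q_def r(5))
      show "norm (dilate (q n) (\<theta> (k (n + N)))) \<le> 1"
        using norm_dilate_le[OF q] norm_isometric_multiplier[OF \<theta>(1)] by metis
    next
      fix w
      show "(\<lambda>n. ell2_coeff (dilate (q n) (\<theta> (k (n + N)))) w) \<longlonglongrightarrow> ell2_coeff (dilate s B) w"
        using s unfolding ell2_coeff_dilate[OF q] ell2_coeff_dilate[OF less_imp_le[OF s(1)] less_imp_le[OF s(2)]]
        by (intro tendsto_intros q_lim LIMSEQ_ignore_initial_segment[OF B])
    qed
  qed
  have "H \<in> sing_space H"
    by (simp add: in_sing_space_iff)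
  with factor obtain g where g: "H = fmul B g" by blast
  have "B \<noteq> 0"
  proof
    assume "B = 0"
    then have "fmul B g = 0"
      by (intro fmul_eqI) (auto simp: fun_eq_iff zero_ell2.rep_eq)
    with g H show False by simp
  qed
  have range_sub: "fmul B f \<in> sing_space H" for f
    using B_sing Sing_fmul_mono[OF B_mult, of f] by (auto simp: in_sing_space_iff)
  \<comment> \<open>\<open>factor\<close> returns a quotient of \<open>fmul B f\<close> of no larger
    norm, and cancellation identifies it with \<open>f\<close>.\<close>
  have "norm (fmul B f) = norm f" for f
  proof (rule antisym)
    show "norm (fmul B f) \<le> norm f"
      using multiplierD(2)[OF B_mult, of f] by simp
    obtain f' where f': "fmul B f = fmul B f'" "norm f' \<le> norm (fmul B f)"
      using factor[OF range_sub] by blast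
    from f'(1) have "f = f'"
      by (rule fmul_left_cancel[OF B_mult \<open>B \<noteq> 0\<close>])
    with f'(2) show "norm f \<le> norm (fmul B f)" by simp
  qed
  with B_mult have "isometric_multiplier B"
    by (simp add: isometric_multiplier_def)
  moreover have "range (fmul B) = sing_space H"
    using factor range_sub by blast
  moreover have "Sing B = Sing H"
    using B_sing Sing_fmul_mono[OF B_mult, of g] g by (auto simp: in_sing_space_iff)
  ultimately show ?thesis by (rule that)
qed

text \<open>Cancelling \<theta> gives F = G g_s. For a polynomial p with Fp near 1, dilation by t
  turns this into G_t g_{ts} p_t = 1 + E with E small. Solving (1 + E)u = G_t and cancelling G_t on
  the left leaves 1 = g_{ts} p_t u, an inverse on the side opposite to where G_t stood.\<close>

lemma dilated_quotient_invertible: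
  fixes H :: "'d::countable fock"
  assumes H: "H \<noteq> 0" "H = fmul B g" and B: "isometric_multiplier B" "B \<in> sing_space H"
    and s: "0 < s" "s < 1" and t: "0 < t" "t < 1"
  obtains v where "conv (ell2_coeff (dilate (t * s) g)) (ell2_coeff v) = ell2_coeff (ket [])"
proof -
  note s' = less_imp_le[OF s(1)] less_imp_le[OF s(2)] and t' = less_imp_le[OF t(1)] less_imp_le[OF t(2)]
  have B_mult: "multiplier 1 B"
    using B(1) by (simp add: isometric_multiplier_def)
  obtain \<theta> F where \<theta>: "isometric_multiplier \<theta>" "dilate s H = fmul \<theta> F" "cyc (dilate s H) = range (fmul \<theta>)" "cyc F = UNIV"
    using inner_outer_factorization_cyc[OF dilate_nonzero[OF s' _ H(1)]] s by (metis less_irrefl)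
  have \<theta>_mult: "multiplier 1 \<theta>"
    using \<theta>(1) by (simp add: isometric_multiplier_def)
  obtain G where G: "dilate s B = fmul \<theta> G"
    using sing_space_imp_cyc[OF B(2) s] \<theta>(3) by auto
  have "conv (ell2_coeff \<theta>) (ell2_coeff F) = ell2_coeff (dilate s (fmul B g))"
    using \<theta>(2) H(2) multiplierD(1)[OF \<theta>_mult] by metis
  also have "\<dots> = conv (ell2_coeff \<theta>) (conv (ell2_coeff G) (ell2_coeff (dilate s g)))"
    by (simp only: conv_dilate_fmul[OF s' multiplierD(1)[OF B_mult]] G multiplierD(1)[OF \<theta>_mult] conv_assoc)
  finally have F: "ell2_coeff F = conv (ell2_coeff G) (ell2_coeff (dilate s g))"
    by (rule conv_left_cancel) (rule ell2_ne_zeroD[OF isometric_multiplier_nonzero[OF \<theta>(1)]])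
  have Ft: "ell2_coeff (dilate t F) = conv (ell2_coeff (dilate t G)) (ell2_coeff (dilate (t * s) g))"
    by (rule ext) (simp add: conv_dilate[OF t'] ell2_coeff_dilate[OF t'] F flip: dilate_dilate[OF t' s'])
  \<comment> \<open>By \<open>multiplier_dilate\<close>, dilation by \<open>t\<close> costs 1/(1 -
    t), so this accuracy makes the multiplier norm of \<open>E\<close> at most 1/2.\<close>
  obtain p where p: "poly p" "norm (fmul F p - ket []) < (1 - t) / 2"
    using cyc_approx[of "ket []" F "(1 - t) / 2"] \<theta>(4) t by auto
  define E where "E = dilate t (fmul F p - ket [])"
  have E_mult: "multiplier (1 / 2) E"
    unfolding E_def using p(2) t
    by (intro multiplier_mono[OF multiplier_dilate(1)]) (auto simp: divide_le_eq)
  \<comment> \<open>The Neumann series as a fixed point; the right-hand side is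
    \<open>dilate t G\<close> instead of 1 so that it can be cancelled afterwards.\<close>
  have "\<exists>!u. dilate t G - fmul E u = u"
  proof (rule banach_fix_type[where c = "1 / 2"])
    show "\<forall>x y. dist (dilate t G - fmul E x) (dilate t G - fmul E y) \<le> 1 / 2 * dist x y"
    proof (intro allI)
      fix x y
      have "dist (dilate t G - fmul E x) (dilate t G - fmul E y) = norm (fmul E (y - x))"
        using linear_diff[OF bounded_linear.linear[OF bounded_linear_fmul[OF E_mult]]]
        by (simp add: dist_norm)
      also have "\<dots> \<le> 1 / 2 * norm (y - x)"
        by (rule multiplierD(2)[OF E_mult])
      finally show "dist (dilate t G - fmul E x) (dilate t G - fmul E y) \<le> 1 / 2 * dist x y"
        by (simp add: dist_norm norm_minus_commute)
    qed
  qed auto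
  then obtain u where u: "dilate t G = u + fmul E u"
    by (metis add.commute diff_add_cancel)
  have X: "ell2_coeff (dilate t (fmul F p)) = (\<lambda>w. ell2_coeff (ket []) w + ell2_coeff E w)"
    by (rule ext) (auto simp: E_def ell2_coeff_dilate[OF t'] minus_ell2.rep_eq algebra_simps)
  have pt: "multiplier (norm p / (1 - t)) (dilate t p)"
    by (rule multiplier_dilate(1)[OF t'(1) t(2)])
  have "conv (ell2_coeff (dilate t G)) (ell2_coeff (ket [])) = (\<lambda>w. ell2_coeff u w + conv (ell2_coeff E) (ell2_coeff u) w)"
    unfolding conv_one_right by (rule ext) (simp add: u plus_ell2.rep_eq multiplierD(1)[OF E_mult])
  also have "\<dots> = conv (ell2_coeff (dilate t (fmul F p))) (ell2_coeff u)"
    by (rule ext) (simp add: X conv_add_left conv_one_left del: ell2_coeff_ket)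
  also have "\<dots> = conv (ell2_coeff (dilate t G)) (conv (ell2_coeff (dilate (t * s) g)) (ell2_coeff (fmul (dilate t p) u)))"
    by (simp only: conv_dilate_fmul[OF t' ell2_coeff_fmul_poly[OF p(1)]] Ft multiplierD(1)[OF pt] conv_assoc)
  finally have "ell2_coeff (ket []) = conv (ell2_coeff (dilate (t * s) g)) (ell2_coeff (fmul (dilate t p) u))"
  proof (rule conv_left_cancel)
    have "dilate s B \<noteq> 0"
      using s by (intro dilate_nonzero[OF s' _ isometric_multiplier_nonzero[OF B(1)]]) simp
    then have "G \<noteq> 0"
      using G linear_0[OF bounded_linear.linear[OF bounded_linear_fmul[OF \<theta>_mult]]] by auto
    then show "ell2_coeff (dilate t G) \<noteq> (\<lambda>_. 0)"
      using t by (intro ell2_ne_zeroD dilate_nonzero[OF t']) auto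
  qed
  then show ?thesis
    by (intro that) simp
qed

lemma singular_part:
  fixes H :: "'d::countable fock"
  assumes H: "H \<noteq> 0" "H = fmul B g" and B: "isometric_multiplier B" "B \<in> sing_space H"
    and g: "g = fmul S F" and S: "isometric_multiplier S"
  shows "sing_space S = UNIV"
proof -
  have S_mult: "multiplier 1 S"
    using S by (simp add: isometric_multiplier_def)
  have "cyc (dilate r S) = UNIV" if r: "0 < r" "r < 1" for r
  proof (rule one_in_cyc_imp_UNIV)
    \<comment> \<open>Both dilations are by \<open>sqrt r\<close>, so that their product is the
      given \<open>r\<close>.\<close>
    have "0 < sqrt r" "sqrt r < 1" "sqrt r * sqrt r = r"
      using r by auto
    from dilated_quotient_invertible[OF H B this(1,2,1,2)] this(3)
    obtain v where v: "conv (ell2_coeff (dilate r g)) (ell2_coeff v) = ell2_coeff (ket [])"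
      by metis
    note r' = less_imp_le[OF r(1)] less_imp_le[OF r(2)]
    have Sr: "multiplier (norm S / (1 - r)) (dilate r S)" and Fr: "multiplier (norm F / (1 - r)) (dilate r F)"
      by (rule multiplier_dilate(1)[OF r'(1) r(2)])+
    have "conv (ell2_coeff (dilate r S)) (ell2_coeff (fmul (dilate r F) v)) = ell2_coeff (ket [])"
      by (simp only: v[symmetric] g conv_dilate_fmul[OF r' multiplierD(1)[OF S_mult]] multiplierD(1)[OF Fr] conv_assoc)
    then have "fmul (dilate r S) (fmul (dilate r F) v) = ket []"
      by (intro fmul_eqI) simp
    then show "ket [] \<in> cyc (dilate r S)"
      using fmul_in_cyc[OF Sr] by metis
  qed
  then show ?thesis
    by (auto simp: sing_space_iff_cyc)
qed

section \<open>Uniqueness of the factors\<close>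

lemma isometric_multiplier_range_unique:
  fixes A A' :: "'d fock"
  assumes A: "isometric_multiplier A" and A': "isometric_multiplier A'" and range: "range (fmul A) = range (fmul A')"
  obtains c where "cmod c = 1" "A' = c *\<^sub>C A"
proof -
  have mult: "multiplier 1 A" "multiplier 1 A'"
    and iso: "\<And>g. norm (fmul A g) = norm g" "\<And>g. norm (fmul A' g) = norm g"
    using A A' by (auto simp: isometric_multiplier_def)
  have "fmul A (ket []) \<in> range (fmul A')"
    by (metis range rangeI)
  then obtain v where v: "A = fmul A' v"
    by (elim rangeE) simp
  have "fmul A' (ket []) \<in> range (fmul A)"
    by (metis range rangeI)
  then obtain u where u: "A' = fmul A u"
    by (elim rangeE) simp
  have norm: "norm u = 1" "norm v = 1"
    using iso(1)[of u] iso(2)[of v] norm_isometric_multiplier[OF A] norm_isometric_multiplier[OF A']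
    unfolding u[symmetric] v[symmetric] by simp_all
  have "conv (ell2_coeff A) (ell2_coeff (ket [])) = ell2_coeff (fmul A' v)"
    by (simp only: conv_one_right v[symmetric])
  also have "\<dots> = conv (ell2_coeff (fmul A u)) (ell2_coeff v)"
    by (simp only: multiplierD(1)[OF mult(2)] u[symmetric])
  also have "\<dots> = conv (ell2_coeff A) (conv (ell2_coeff u) (ell2_coeff v))"
    by (simp only: multiplierD(1)[OF mult(1)] conv_assoc)
  finally have "ell2_coeff (ket []) = conv (ell2_coeff u) (ell2_coeff v)"
    by (rule conv_left_cancel) (rule ell2_ne_zeroD[OF isometric_multiplier_nonzero[OF A]])
  \<comment> \<open>The quotients \<open>u\<close> and \<open>v\<close> are unit vectors with
    product 1. Their constant terms have modulus at most 1 and product 1, so the constant term of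
    \<open>u\<close> exhausts its norm and \<open>u\<close> is a unimodular constant.\<close>
  then have "1 = ell2_coeff u [] * ell2_coeff v []"
    by (metis conv.simps(1) ell2_coeff_ket)
  then have prod: "1 = cmod (ell2_coeff u []) * cmod (ell2_coeff v [])"
    by (metis norm_mult norm_one)
  have le: "cmod (ell2_coeff u []) \<le> 1" "cmod (ell2_coeff v []) \<le> 1"
    using cmod_coeff_le_norm[of u "[]"] cmod_coeff_le_norm[of v "[]"] norm by auto
  have one: "cmod (ell2_coeff u []) = 1"
    using prod le mult_left_mono[OF le(2), of "cmod (ell2_coeff u [])"] by simp
  have "ell2_coeff u w = 0" if "w \<noteq> []" for w
    using sum_coeff_le_norm[of "{[], w}" u] that norm one by simp
  then have "u = ell2_coeff u [] *\<^sub>C ket []"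
    by (intro ell2_eqI) simp
  then have "A' = ell2_coeff u [] *\<^sub>C A"
    using u fmul_scaleC_right[OF mult(1), of "ell2_coeff u []" "ket []"] by simp
  with one show ?thesis by (rule that)
qed

lemma fmul_scaleC_left:
  assumes "multiplier M f"
  shows "fmul (c *\<^sub>C f) g = c *\<^sub>C fmul f g"
  by (rule fmul_eqI, rule ext) (simp add: multiplierD(1)[OF assms] conv_cmult_left scaleC.rep_eq)

lemma cyc_scaleC:
  assumes "c \<noteq> 0"
  shows "cyc (c *\<^sub>C f) = cyc f"
proof
  show "cyc (c *\<^sub>C f) \<subseteq> cyc f"
    by (intro cyc_mono closed_csubspaceD(4)[OF closed_csubspace_cyc] self_in_cyc)
  have "(1 / c) *\<^sub>C (c *\<^sub>C f) \<in> cyc (c *\<^sub>C f)"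
    by (intro closed_csubspaceD(4)[OF closed_csubspace_cyc] self_in_cyc)
  then show "cyc f \<subseteq> cyc (c *\<^sub>C f)"
    using assms by (intro cyc_mono) simp
qed

text \<open>The scalar \<open>b\<close> absorbs the freedom left in the Blaschke factor. Both sides
  generate the same cyclic subspace, namely the range of either inner factor; then \<open>S\<close>
  cancels.\<close>

lemma inner_outer_unique:
  assumes S: "isometric_multiplier S" and S': "isometric_multiplier S'"
    and F: "cyc F = UNIV" and F': "cyc F' = UNIV"
    and eq: "fmul S F = b *\<^sub>C fmul S' F'" and b: "cmod b = 1"
  obtains s c where "cmod s = 1" "S' = s *\<^sub>C S" "cmod c = 1" "F' = c *\<^sub>C F"
proof -
  have mult: "multiplier 1 S"
    using S by (simp add: isometric_multiplier_def)
  have "b \<noteq> 0" using b by auto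
  then have "range (fmul S) = range (fmul S')"
    using cyc_fmul_outer[OF S F] cyc_fmul_outer[OF S' F'] cyc_scaleC[of b "fmul S' F'"] eq by simp
  then obtain s where s: "cmod s = 1" "S' = s *\<^sub>C S"
    by (rule isometric_multiplier_range_unique[OF S S'])
  then have "s \<noteq> 0" by auto
  have "fmul S F = fmul S ((b * s) *\<^sub>C F')"
    by (simp add: eq s(2) fmul_scaleC_left[OF mult] fmul_scaleC_right[OF mult])
  then have "F = (b * s) *\<^sub>C F'"
    by (rule fmul_left_cancel[OF mult isometric_multiplier_nonzero[OF S]])
  then have "F' = (1 / (b * s)) *\<^sub>C F"
    using \<open>b \<noteq> 0\<close> \<open>s \<noteq> 0\<close> by simp
  moreover have "cmod (1 / (b * s)) = 1"
    using b s(1) by (simp add: norm_divide norm_mult)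
  ultimately show ?thesis
    using s by (intro that)
qed

lemma BSF_factorizationD:
  fixes H :: "'d::countable fock"
  assumes "BSF_factorization p H B S F"
  shows "isometric_multiplier B" "range (fmul B) = sing_space H" "isometric_multiplier S" "cyc F = UNIV"
    "H = fmul B (fmul S F)"
proof -
  note D = assms[unfolded BSF_factorization_def nc_blaschke_iff nc_singular_inner_def nc_inner_iff nc_outer_iff_cyc]
  show B: "isometric_multiplier B" and S: "isometric_multiplier S" and "cyc F = UNIV"
    using D by auto
  show "range (fmul B) = sing_space H"
    using D sing_space_cong by auto
  have mult: "multiplier 1 B" "multiplier 1 S"
    using B S by (auto simp: isometric_multiplier_def)
  show "H = fmul B (fmul S F)"
  proof (rule represents_unique)
    show "represents H (\<lambda>n Z. nc_eval n B Z o\<^sub>L nc_eval n S Z o\<^sub>L nc_eval n F Z)"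
      using D by auto
    show "represents (fmul B (fmul S F)) (\<lambda>n Z. nc_eval n B Z o\<^sub>L nc_eval n S Z o\<^sub>L nc_eval n F Z)"
      by (simp add: represents_def nc_eval_fmul[OF mult(1)] nc_eval_fmul[OF mult(2)] blinfun_compose_assoc')
  qed
qed

theorem theorem5p10:
  fixes H :: "'d::countable fock" and p :: enat
  assumes "p \<in> {2, \<infinity>}" and "H \<in> H_space p" and "H \<noteq> 0"
  shows "\<exists>B S F. BSF_factorization p H B S F \<and>
    (\<forall>B' S' F'. BSF_factorization p H B' S' F' \<longrightarrow>
      (\<exists>b. cmod b = 1 \<and> B' = b *\<^sub>C B) \<and>
      (\<exists>s. cmod s = 1 \<and> S' = s *\<^sub>C S) \<and>
      (\<exists>c. cmod c = 1 \<and> F' = c *\<^sub>C F))"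
proof -
  obtain B where B: "isometric_multiplier B" "range (fmul B) = sing_space H" "Sing B = Sing H"
    by (rule blaschke_part[OF assms(3)])
  have B_mult: "multiplier 1 B" and B_iso: "\<And>g. norm (fmul B g) = norm g"
    using B(1) by (auto simp: isometric_multiplier_def)
  have "H \<in> range (fmul B)"
    unfolding B(2) by (simp add: in_sing_space_iff)
  then obtain g where g: "H = fmul B g" by auto
  have "g \<noteq> 0"
    using g assms(3) linear_0[OF bounded_linear.linear[OF bounded_linear_fmul[OF B_mult]]] by auto
  then obtain S F where S: "isometric_multiplier S" and gSF: "g = fmul S F" and F: "cyc F = UNIV"
    by (rule inner_outer_factorization_cyc)
  have S_mult: "multiplier 1 S" and S_iso: "\<And>g. norm (fmul S g) = norm g"
    using S by (auto simp: isometric_multiplier_def)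
  have "B \<in> sing_space H"
    by (simp add: in_sing_space_iff B(3))
  then have S_sing: "sing_space S = UNIV"
    by (rule singular_part[OF assms(3) g B(1) _ gSF S])
  have "F \<in> H_space p"
  proof (cases "p = \<infinity>")
    case True
    then have "H \<in> H_inf"
      using assms(2) by (simp add: H_space_def)
    then obtain M where M: "multiplier M H"
      by (rule H_inf_imp_multiplier)
    have "multiplier M F"
    proof (rule multiplierI_poly)
      fix q :: "'d fock" assume q: "poly q"
      \<comment> \<open>\<open>B\<close> and \<open>S\<close> act isometrically, so \<open>F\<close>
        inherits the multiplier bound of \<open>H\<close>; polynomials are used because the products
        with \<open>F\<close> are then known to be genuine.\<close>
      have "norm (fmul F q) = norm (fmul H q)"
        by (simp add: g gSF fmul_assoc_poly[OF B_mult q] fmul_assoc_poly[OF S_mult q] B_iso S_iso)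
      then show "norm (fmul F q) \<le> M * norm q"
        using multiplierD(2)[OF M] by simp
    qed (rule multiplier_nonneg[OF M])
    then show ?thesis
      using True by (simp add: H_space_def multiplier_imp_H_inf)
  qed (auto simp: H_space_def)
  then have "BSF_factorization p H B S F"
    using B F S_sing S sing_space_cong[OF B(3)]
    by (simp add: BSF_factorization_def nc_blaschke_iff nc_singular_inner_def nc_inner_iff nc_outer_iff_cyc
        multiplier_imp_H_inf[OF B_mult] multiplier_imp_H_inf[OF S_mult] represents_def g gSF
        nc_eval_fmul[OF B_mult] nc_eval_fmul[OF S_mult] blinfun_compose_assoc')
  moreover have "(\<exists>b. cmod b = 1 \<and> B' = b *\<^sub>C B) \<and> (\<exists>s. cmod s = 1 \<and> S' = s *\<^sub>C S) \<and>
      (\<exists>c. cmod c = 1 \<and> F' = c *\<^sub>C F)" if "BSF_factorization p H B' S' F'" for B' S' F'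
  proof -
    note D = BSF_factorizationD[OF that]
    have "range (fmul B) = range (fmul B')"
      by (simp only: B(2) D(2))
    then obtain b where b: "cmod b = 1" "B' = b *\<^sub>C B"
      by (rule isometric_multiplier_range_unique[OF B(1) D(1)])
    \<comment> \<open>With \<open>B'\<close> replaced by a multiple of \<open>B\<close>, cancelling
      \<open>B\<close> leaves an inner-outer comparison twisted by \<open>b\<close>.\<close>
    have "fmul B (fmul S F) = fmul B (b *\<^sub>C fmul S' F')"
      using D(5) by (simp add: g gSF b(2) fmul_scaleC_left[OF B_mult] fmul_scaleC_right[OF B_mult])
    then have "fmul S F = b *\<^sub>C fmul S' F'"
      by (rule fmul_left_cancel[OF B_mult isometric_multiplier_nonzero[OF B(1)]])
    then obtain s c where "cmod s = 1" "S' = s *\<^sub>C S" "cmod c = 1" "F' = c *\<^sub>C F"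
      using b(1) by (rule inner_outer_unique[OF S D(3) F D(4)])
    with b show ?thesis by blast
  qed
  ultimately show ?thesis by blast
qed

end
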